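(* Consider $n$ agents $\dot x_i(t)=Ax_i(t)+Bu_i(t)$, $x_i(t)\in\mathbb{R}^N$, $i=1,\dots,n$, with undirected simple interaction graph $\mathcal{G}$, under the broadcasting protocol $$u_i(t)=K\sum_{j\in\mathcal{N}_i}(\hat x_j(t)-\hat x_i(t)),\qquad \hat x_i(t)=x_i(t^i_k)-e^i_k\ \text{ for } t\in[t^i_k+\tau^i_k,\,t^i_{k+1}+\tau^i_{k+1}),\ k=0,1,\dots,$$ with $K=B^TP$, where $P$ is positive definite, $\mu>0$, $0<\lambda\le\lambda_2$, and $$PA+A^TP-2\lambda PBB^TP=-2\mu I_N.$$ Assume that $(A,B)$ is stabilizable, $A$ is marginally stable, $\mathcal{G}$ is connected, and for every $i=1,\dots,n$ and $k=0,1,2,\dots$: (1) $t^i_{k+1}-t^i_k\le h$; (2) $\tau^i_k<t^i_{k+1}-t^i_k$; (3) $\tau^i_k\le\tau$; and that $t^i_{k+1}-t^i_k$ is lower bounded by a positive number independent of $k$. Assume also $\|e(t)\|_2\le\Delta_e$, where $e(t)$ is the stacked error signal. With $\bar\Delta$ and $\Gamma$ the functions defined in the context, let $$\mathcal{S}=\Big\{[\alpha,\beta,\gamma,\eta]:\ \alpha,\beta,\gamma,\eta>0,\ \mu-\frac{\lambda_P}{2\eta}-\frac{\sigma}{2\gamma}>0,\ \frac{\gamma\sigma}{2}-\mu+\frac{\lambda_P}{2\eta}+\lambda_n\sigma_{PB}^2\ge0,\ \Gamma(h,\tau,\alpha,\beta,\gamma,\eta)>0\Big\}.$$ If $\mathcal{S}\ne\emptyset$,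 then for any time $t'$ and any $\theta>1$ there exists some $t\ge t'$ such that $$\tilde\delta(t)^T\tilde\delta(t)\le\inf_{[\alpha,\beta,\gamma,\eta]\in\mathcal{S}}\frac{\theta\,\bar\Delta(h,\tau,\alpha,\gamma,\eta)}{\Gamma(h,\tau,\alpha,\beta,\gamma,\eta)}.$$
   Context: $\mathcal{N}_i$ is the set of neighbors of vertex $i$; $D$ is an (arbitrarily oriented) incidence matrix of $\mathcal{G}$ and $0=\lambda_1\le\lambda_2\le\dots\le\lambda_n$ are the eigenvalues of the graph Laplacian $DD^T$. $A$ marginally stable: in particular $e^{As}$ is bounded over $s\ge0$. For each agent $i$, $0\le t^i_0<t^i_1<\cdots$ are the instants at which it samples its own state, $\tau^i_k\ge0$ the delays and $e^i_k\in\mathbb{R}^N$ the measurement errors; sequences for different agents are independent (no relation is assumed). As long as $\hat x_i$ or $\hat x_j$ is not yet defined, the term $\hat x_j-\hat x_i$ is taken to be zero. $h>0$, $\tau\ge0$, $\Delta_e\ge0$. Signals: $\delta_i(t)=x_i(t)-\frac1ne^{At}\sum_{j=1}^nx_j(0)$. For $t\in[t^i_k+\tau^i_k,\,t^i_{k+1}+\tau^i_{k+1})$ set $\tilde\delta_i(t)=\delta_i(t^i_k)$ and $e_i(t)=e^i_k$; $\tilde\delta=[\tilde\delta_1^T\cdots\tilde\delta_n^T]^T$, $e=[e_1^T\cdots e_n^T]^T$ (considered for $t\ge\max_i(t^i_0+\tau^i_0)$). Constants: $\lambda_{A_s}$ is the largest eigenvalue of $\frac12(A+A^T)$; $\sigma_A,\sigma_{PB},\sigma_{BB^TP}$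 are the largest singular values of $A$, $PB$, $BB^TP$; $\lambda_P$ is the largest eigenvalue of $P$; $\sigma$ (depending on $\eta$) is the largest singular value of $(DD^T\otimes PBB^TP)-2\big(\mu-\frac{\lambda_P}{2\eta}\big)I_{nN}$; $\|\cdot\|_\infty$ is the maximum row sum matrix norm; $\max_s$ is over $s\ge0$ (supremum). $$\Delta_\kappa(h)=\frac1{\sqrt n}\Big\|\sum_{i=1}^nx_i(0)\Big\|_2\ \max_s\|e^{As}\|_2\ \frac{\sigma_A(e^{\lambda_{A_s}h}-1)}{\lambda_{A_s}}$$ (if $\lambda_{A_s}=0$, the quotient is replaced by its limit as $\lambda_{A_s}\to0$), $$\Delta(h)=\|DD^T\otimes BK\|_2\,(\Delta_\kappa(h)+\Delta_e),$$ $$\bar\Delta(h,\tau,\alpha,\gamma,\eta)=\Big(\frac{\gamma\sigma}{2}-\mu+\frac{\lambda_P}{2\eta}+\lambda_n\sigma_{PB}^2\Big)\Big(1+\frac1\alpha\Big)\max_s\|e^{As}\|_\infty^2\,n(h+\tau)^2\Delta(h)^2+\frac12\lambda_P\eta\,\Delta(h)^2,$$ $$\Gamma(h,\tau,\alpha,\beta,\gamma,\eta)=\mu-\frac{\lambda_P}{2\eta}-\frac{\sigma}{2\gamma}-\Big(\frac{\gamma\sigma}{2}-\mu+\frac{\lambda_P}{2\eta}+\lambda_n\sigma_{PB}^2\Big)(1+\alpha)\Big(\Big(1+\frac1\beta\Big)\sigma_A^2+(1+\beta)\frac73\lambda_n^2\sigma_{BB^TP}^2\Big)(h+\tau)^2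e^{2\lambda_{A_s}(h+\tau)}.$$
   Formalization: When Δ(h)=0 the stated bound is 0 and can fail (e.g. A=0, no errors or delays, h small), so in that case the inequality is proved only up to an arbitrary additive slack ε>0; for Δ(h)≠0 it is proved as stated. *)

theory Defs
  imports "HOL-Analysis.Analysis"
begin

text \<open>Matrices. A matrix of type \<open>real^'c^'r\<close> has rows indexed by \<open>'r\<close> and columns by \<open>'c\<close>;
  the spectral norm is \<open>onorm ((*v) M)\<close>.\<close>

definition is_eigenvalue :: "'a::field^'n^'n \<Rightarrow> 'a \<Rightarrow> bool" where
  "is_eigenvalue M c \<longleftrightarrow> (\<exists>v. v \<noteq> 0 \<and> M *v v = c *s v)"

definition largest_eigenvalue :: "real^'n^'n \<Rightarrow> real" where
  "largest_eigenvalue M = Max {c. is_eigenvalue M c}"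

definition is_singular_value :: "real^'c^'r \<Rightarrow> real \<Rightarrow> bool" where
  "is_singular_value M s \<longleftrightarrow> 0 \<le> s \<and> is_eigenvalue (transpose M ** M) (s\<^sup>2)"

definition largest_singular_value :: "real^'c^'r \<Rightarrow> real" where
  "largest_singular_value M = Max {s. is_singular_value M s}"

text \<open>The eigenvalues in increasing order, repeated according to their multiplicity as roots of
  the characteristic polynomial, and indexed from 1.\<close>

definition eigenvalues_increasing :: "real^'n^'n \<Rightarrow> (nat \<Rightarrow> real) \<Rightarrow> bool" where
  "eigenvalues_increasing M lam \<longleftrightarrow>
     mono_on {1..CARD('n)} lam \<and> (\<forall>z. det (mat z - M) = (\<Prod>k=1..CARD('n). z - lam k))"

definition row_sum_norm :: "real^'c^'r \<Rightarrow> real" where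
  "row_sum_norm M = Max (range (\<lambda>i. \<Sum>j\<in>UNIV. \<bar>M $ i $ j\<bar>))"

text \<open>The product of the \<open>vec\<close> instance of \<open>times\<close> is componentwise, so powers are built
  from \<open>(**)\<close> here.\<close>

definition mat_exp :: "real^'d^'d \<Rightarrow> real^'d^'d" where
  "mat_exp M = (\<Sum>k. (1 / fact k) *\<^sub>R (((**) M ^^ k) (mat 1)))"

definition kron :: "real^'c^'r \<Rightarrow> real^'q^'p \<Rightarrow> real^('c \<times> 'q)^('r \<times> 'p)" where
  "kron M N = (\<chi> a b. M $ fst a $ fst b * N $ snd a $ snd b)"

definition stack :: "('n \<Rightarrow> real^'d) \<Rightarrow> real^('n::finite \<times> 'd)" where
  "stack f = (\<chi> a. f (fst a) $ snd a)"

definition positive_definite :: "real^'d^'d \<Rightarrow> bool" where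
  "positive_definite P \<longleftrightarrow> transpose P = P \<and> (\<forall>v. v \<noteq> 0 \<longrightarrow> 0 < v \<bullet> (P *v v))"

text \<open>Linear systems.\<close>

definition hurwitz :: "real^'d^'d \<Rightarrow> bool" where
  "hurwitz M \<longleftrightarrow> (\<forall>c. is_eigenvalue (\<chi> i j. complex_of_real (M $ i $ j)) c \<longrightarrow> Re c < 0)"

definition stabilizable :: "real^'d^'d \<Rightarrow> real^'m^'d \<Rightarrow> bool" where
  "stabilizable A B \<longleftrightarrow> (\<exists>F :: real^'d^'m. hurwitz (A + B ** F))"

definition free_response :: "real^'d^'d \<Rightarrow> (real \<Rightarrow> real^'d) \<Rightarrow> bool" where
  "free_response A y \<longleftrightarrow> (\<forall>t\<ge>0. (y has_vector_derivative A *v y t) (at t within {0..}))"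

text \<open>Marginally stable: stable (every free response is bounded), but not asymptotically stable.
  The second part rules out Hurwitz matrices.\<close>

definition marginally_stable :: "real^'d^'d \<Rightarrow> bool" where
  "marginally_stable A \<longleftrightarrow>
     (\<forall>y. free_response A y \<longrightarrow> bounded (y ` {0..})) \<and>
     \<not> (\<forall>y. free_response A y \<longrightarrow> (y \<longlongrightarrow> 0) at_top)"

text \<open>Graphs on the vertex set \<open>UNIV :: 'n set\<close>, given by their adjacency relation.\<close>

definition simple_graph :: "('n \<Rightarrow> 'n \<Rightarrow> bool) \<Rightarrow> bool" where
  "simple_graph adj \<longleftrightarrow> symp adj \<and> irreflp adj"

definition connected_graph :: "('n \<Rightarrow> 'n \<Rightarrow> bool) \<Rightarrow> bool" where
  "connected_graph adj \<longleftrightarrow> (\<forall>i j. rtranclp adj i j)"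

text \<open>Columns are in bijection with the edges, each edge being oriented from \<open>src\<close> to \<open>tgt\<close>.\<close>

definition incidence_matrix :: "('n::finite \<Rightarrow> 'n \<Rightarrow> bool) \<Rightarrow> real^'e^'n \<Rightarrow> bool" where
  "incidence_matrix adj D \<longleftrightarrow>
     (\<exists>src tgt. bij_betw (\<lambda>e. {src e, tgt e}) UNIV {{i, j} | i j. adj i j} \<and>
        D = (\<chi> i e. (if i = tgt e then 1 else 0) - (if i = src e then 1 else 0)))"

text \<open>Sampled signals. \<open>ts i k\<close> is the \<open>k\<close>-th sampling instant of agent \<open>i\<close>, \<open>del i k\<close> its delay and
  \<open>err i k\<close> its measurement error. \<open>hold T y t\<close> is meaningful only for \<open>T 0 \<le> t\<close>.\<close>

definition hold :: "(nat \<Rightarrow> real) \<Rightarrow> (nat \<Rightarrow> 'v) \<Rightarrow> real \<Rightarrow> 'v" where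
  "hold T y t = y (THE k. T k \<le> t \<and> t < T (Suc k))"

definition update_time :: "('n \<Rightarrow> nat \<Rightarrow> real) \<Rightarrow> ('n \<Rightarrow> nat \<Rightarrow> real) \<Rightarrow> 'n \<Rightarrow> nat \<Rightarrow> real" where
  "update_time ts del i k = ts i k + del i k"

definition start_time :: "('n::finite \<Rightarrow> nat \<Rightarrow> real) \<Rightarrow> ('n \<Rightarrow> nat \<Rightarrow> real) \<Rightarrow> real" where
  "start_time ts del = Max (range (\<lambda>i. update_time ts del i 0))"

definition broadcast_state ::
  "('n \<Rightarrow> nat \<Rightarrow> real) \<Rightarrow> ('n \<Rightarrow> nat \<Rightarrow> real) \<Rightarrow> ('n \<Rightarrow> nat \<Rightarrow> real^'d) \<Rightarrow>
   ('n \<Rightarrow> real \<Rightarrow> real^'d) \<Rightarrow> 'n \<Rightarrow> real \<Rightarrow> real^'d" where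
  "broadcast_state ts del err x i =
     hold (update_time ts del i) (\<lambda>k. x i (ts i k) - err i k)"

definition control_input ::
  "('n::finite \<Rightarrow> 'n \<Rightarrow> bool) \<Rightarrow> real^'d^'m \<Rightarrow> ('n \<Rightarrow> nat \<Rightarrow> real) \<Rightarrow> ('n \<Rightarrow> nat \<Rightarrow> real) \<Rightarrow>
   ('n \<Rightarrow> nat \<Rightarrow> real^'d) \<Rightarrow> ('n \<Rightarrow> real \<Rightarrow> real^'d) \<Rightarrow> 'n \<Rightarrow> real \<Rightarrow> real^'m" where
  "control_input adj K ts del err x i t =
     K *v (\<Sum>j | adj i j.
       if update_time ts del i 0 \<le> t \<and> update_time ts del j 0 \<le> t
       then broadcast_state ts del err x j t - broadcast_state ts del err x i t else 0)"

text \<open>The inputs are piecewise constant and may jump at the update times, so the trajectories are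
  only required to be continuous there.\<close>

definition closed_loop_trajectory ::
  "real^'d^'d \<Rightarrow> real^'m^'d \<Rightarrow> ('n::finite \<Rightarrow> 'n \<Rightarrow> bool) \<Rightarrow> real^'d^'m \<Rightarrow>
   ('n \<Rightarrow> nat \<Rightarrow> real) \<Rightarrow> ('n \<Rightarrow> nat \<Rightarrow> real) \<Rightarrow> ('n \<Rightarrow> nat \<Rightarrow> real^'d) \<Rightarrow>
   ('n \<Rightarrow> real \<Rightarrow> real^'d) \<Rightarrow> bool" where
  "closed_loop_trajectory A B adj K ts del err x \<longleftrightarrow>
     (\<forall>i. continuous_on {0..} (x i)) \<and>
     (\<forall>i. \<forall>t\<ge>0. (\<forall>j k. t \<noteq> update_time ts del j k) \<longrightarrow>
        (x i has_vector_derivative A *v x i t + B *v control_input adj K ts del err x i t)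
          (at t within {0..}))"

definition disagreement ::
  "real^'d^'d \<Rightarrow> ('n::finite \<Rightarrow> real \<Rightarrow> real^'d) \<Rightarrow> 'n \<Rightarrow> real \<Rightarrow> real^'d" where
  "disagreement A x i t =
     x i t - (1 / real CARD('n)) *\<^sub>R (mat_exp (t *\<^sub>R A) *v (\<Sum>j\<in>UNIV. x j 0))"

definition held_disagreement ::
  "real^'d^'d \<Rightarrow> ('n \<Rightarrow> nat \<Rightarrow> real) \<Rightarrow> ('n \<Rightarrow> nat \<Rightarrow> real) \<Rightarrow>
   ('n::finite \<Rightarrow> real \<Rightarrow> real^'d) \<Rightarrow> real \<Rightarrow> real^('n \<times> 'd)" where
  "held_disagreement A ts del x t =
     stack (\<lambda>i. hold (update_time ts del i) (\<lambda>k. disagreement A x i (ts i k)) t)"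

definition held_error ::
  "('n::finite \<Rightarrow> nat \<Rightarrow> real) \<Rightarrow> ('n \<Rightarrow> nat \<Rightarrow> real) \<Rightarrow> ('n \<Rightarrow> nat \<Rightarrow> real^'d) \<Rightarrow> real \<Rightarrow>
   real^('n \<times> 'd)" where
  "held_error ts del err t = stack (\<lambda>i. hold (update_time ts del i) (err i) t)"

text \<open>Constants of the bound. The argument \<open>lamn\<close> stands for the largest Laplacian eigenvalue.\<close>

definition lam_As :: "real^'d^'d \<Rightarrow> real" where
  "lam_As A = largest_eigenvalue ((1 / 2) *\<^sub>R (A + transpose A))"

definition sigma ::
  "real^'e^'n \<Rightarrow> real^'m^'d \<Rightarrow> real^'d^'d \<Rightarrow> real \<Rightarrow> real \<Rightarrow> real" where
  "sigma D B P \<mu> \<eta> = largest_singular_value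
     (kron (D ** transpose D) (P ** B ** transpose B ** P)
        - mat (2 * (\<mu> - largest_eigenvalue P / (2 * \<eta>))))"

definition Delta_kappa ::
  "real^'d^'d \<Rightarrow> ('n::finite \<Rightarrow> real \<Rightarrow> real^'d) \<Rightarrow> real \<Rightarrow> real" where
  "Delta_kappa A x h =
     1 / sqrt (real CARD('n)) * norm (\<Sum>i\<in>UNIV. x i 0)
     * (SUP s\<in>{0..}. onorm ((*v) (mat_exp (s *\<^sub>R A))))
     * (largest_singular_value A
        * (if lam_As A = 0 then h else (exp (lam_As A * h) - 1) / lam_As A))"

definition Delta ::
  "real^'d^'d \<Rightarrow> real^'m^'d \<Rightarrow> real^'d^'m \<Rightarrow> real^'e^'n \<Rightarrow> ('n::finite \<Rightarrow> real \<Rightarrow> real^'d) \<Rightarrow>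
   real \<Rightarrow> real \<Rightarrow> real" where
  "Delta A B K D x \<Delta>e h =
     onorm ((*v) (kron (D ** transpose D) (B ** K))) * (Delta_kappa A x h + \<Delta>e)"

definition common_coeff ::
  "real^'m^'d \<Rightarrow> real^'d^'d \<Rightarrow> real^'e^'n \<Rightarrow> real \<Rightarrow> real \<Rightarrow> real \<Rightarrow> real \<Rightarrow> real" where
  "common_coeff B P D lamn \<mu> \<gamma> \<eta> =
     \<gamma> * sigma D B P \<mu> \<eta> / 2 - \<mu> + largest_eigenvalue P / (2 * \<eta>)
       + lamn * (largest_singular_value (P ** B))\<^sup>2"

definition Delta_bar ::
  "real^'d^'d \<Rightarrow> real^'m^'d \<Rightarrow> real^'d^'m \<Rightarrow> real^'d^'d \<Rightarrow> real^'e^'n \<Rightarrow> real \<Rightarrow>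
   ('n::finite \<Rightarrow> real \<Rightarrow> real^'d) \<Rightarrow> real \<Rightarrow> real \<Rightarrow>
   real \<Rightarrow> real \<Rightarrow> real \<Rightarrow> real \<Rightarrow> real \<Rightarrow> real" where
  "Delta_bar A B K P D lamn x \<mu> \<Delta>e h \<tau> \<alpha> \<gamma> \<eta> =
     common_coeff B P D lamn \<mu> \<gamma> \<eta> * (1 + 1 / \<alpha>)
       * (SUP s\<in>{0..}. (row_sum_norm (mat_exp (s *\<^sub>R A)))\<^sup>2)
       * real CARD('n) * (h + \<tau>)\<^sup>2 * (Delta A B K D x \<Delta>e h)\<^sup>2
     + 1 / 2 * largest_eigenvalue P * \<eta> * (Delta A B K D x \<Delta>e h)\<^sup>2"

definition Gamma_fun ::
  "real^'d^'d \<Rightarrow> real^'m^'d \<Rightarrow> real^'d^'d \<Rightarrow> real^'e^'n \<Rightarrow> real \<Rightarrow> real \<Rightarrow>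
   real \<Rightarrow> real \<Rightarrow> real \<Rightarrow> real \<Rightarrow> real \<Rightarrow> real \<Rightarrow> real" where
  "Gamma_fun A B P D lamn \<mu> h \<tau> \<alpha> \<beta> \<gamma> \<eta> =
     \<mu> - largest_eigenvalue P / (2 * \<eta>) - sigma D B P \<mu> \<eta> / (2 * \<gamma>)
     - common_coeff B P D lamn \<mu> \<gamma> \<eta> * (1 + \<alpha>)
       * ((1 + 1 / \<beta>) * (largest_singular_value A)\<^sup>2
          + (1 + \<beta>) * (7 / 3) * lamn\<^sup>2 * (largest_singular_value (B ** transpose B ** P))\<^sup>2)
       * (h + \<tau>)\<^sup>2 * exp (2 * lam_As A * (h + \<tau>))"

definition feasible ::
  "real^'d^'d \<Rightarrow> real^'m^'d \<Rightarrow> real^'d^'d \<Rightarrow> real^'e^'n \<Rightarrow> real \<Rightarrow> real \<Rightarrow> real \<Rightarrow> real \<Rightarrow>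
   (real \<times> real \<times> real \<times> real) set" where
  "feasible A B P D lamn \<mu> h \<tau> = {(\<alpha>, \<beta>, \<gamma>, \<eta>).
     \<alpha> > 0 \<and> \<beta> > 0 \<and> \<gamma> > 0 \<and> \<eta> > 0 \<and>
     \<mu> - largest_eigenvalue P / (2 * \<eta>) - sigma D B P \<mu> \<eta> / (2 * \<gamma>) > 0 \<and>
     common_coeff B P D lamn \<mu> \<gamma> \<eta> \<ge> 0 \<and>
     Gamma_fun A B P D lamn \<mu> h \<tau> \<alpha> \<beta> \<gamma> \<eta> > 0}"

definition ultimate_bound ::
  "real^'d^'d \<Rightarrow> real^'m^'d \<Rightarrow> real^'d^'m \<Rightarrow> real^'d^'d \<Rightarrow> real^'e^'n \<Rightarrow> real \<Rightarrow>
   ('n::finite \<Rightarrow> real \<Rightarrow> real^'d) \<Rightarrow> real \<Rightarrow> real \<Rightarrow> real \<Rightarrow> real \<Rightarrow> real \<Rightarrow> real" where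
  "ultimate_bound A B K P D lamn x \<mu> \<Delta>e h \<tau> \<theta> =
     (INF (\<alpha>, \<beta>, \<gamma>, \<eta>) \<in> feasible A B P D lamn \<mu> h \<tau>.
        \<theta> * Delta_bar A B K P D lamn x \<mu> \<Delta>e h \<tau> \<alpha> \<gamma> \<eta>
          / Gamma_fun A B P D lamn \<mu> h \<tau> \<alpha> \<beta> \<gamma> \<eta>)"

end

theory Submission
  imports Defs
begin

text \<open>Against the mean trajectory, the disagreement satisfies
  \<open>\<delta>' = A \<delta> - (D D\<^sup>T \<otimes> B K) \<delta>~ + w\<close>, where \<open>w\<close> collects the measurement errors and the
  differences between held means, so that \<open>\<bar>w\<bar> \<le> \<Delta>\<close>. With \<open>V = \<Sum> \<delta>\<^sub>i\<^sup>T P \<delta>\<^sub>i / 2\<close> the Riccati equation gives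
  \<open>V' \<le> - g \<bar>\<delta>~\<bar>\<^sup>2 + a \<bar>\<delta> - \<delta>~\<bar>\<^sup>2 + \<lambda>\<^sub>P \<eta> \<Delta>\<^sup>2 / 2\<close> with \<open>a\<close> the common coefficient and \<open>g \<le> a\<close>.
  A comparison estimate along each agent's last sampling window bounds \<open>\<bar>\<delta> - \<delta>~\<bar>\<^sup>2\<close> by \<open>\<bar>\<delta>~\<bar>\<^sup>2\<close>, by its integral
  over the window \<open>[t - h - \<tau>, t]\<close>, and by \<open>2 (h + \<tau>)\<^sup>2 \<Delta>\<^sup>2\<close>. Adding to \<open>V\<close> a Krasovskii term that
  absorbs the integral yields a nonnegative functional whose derivative is at most
  \<open>- \<Gamma> \<bar>\<delta>~\<bar>\<^sup>2 + \<Delta>\<close>-bar; hence \<open>\<bar>\<delta>~\<bar>\<^sup>2\<close> cannot stay above any \<open>\<rho>\<close> with \<open>\<rho> \<Gamma> > \<Delta>\<close>-bar.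

  The row sum norm enters the bound only through \<open>n \<parallel>e\<^bsup>As\<^esup>\<parallel>\<^sub>\<infinity>\<^sup>2 \<ge> 2\<close> at \<open>s = 0\<close>. This suffices because
  \<open>\<Gamma> > 0\<close> and \<open>g \<le> a\<close> force \<open>x e\<^sup>x < 1\<close> for \<open>x = \<lambda>\<^bsub>A\<^sub>s\<^esub> (h + \<tau>)\<close>, which keeps the mean of \<open>\<parallel>e\<^bsup>As\<^esup>\<parallel>\<^sub>2\<^sup>2\<close> over
  the window below 2.\<close>

section \<open>Extremal eigenvalues and singular values\<close>

lemma symmetric_inner: 
  fixes M :: "real^'n^'n"
  assumes "transpose M = M" shows "x \<bullet> (M *v y) = (M *v x) \<bullet> y"
  using assms by (metis dot_lmul_matrix vector_transpose_matrix)

lemma inner_matrix_transpose: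
  fixes M :: "real^'c^'r"
  shows "x \<bullet> (M *v y) = (transpose M *v x) \<bullet> y"
  by (metis dot_lmul_matrix vector_transpose_matrix transpose_transpose)

text \<open>The Rayleigh quotient attains its maximum on the compact unit sphere of
  \<open>S\<close>, and its first variation vanishes there; invariance keeps the variation inside
  \<open>S\<close>. The subspace version serves both the whole space and, for the Laplacian, the
  zero-sum vectors.\<close>

lemma symmetric_extremal_eigenvector:
  fixes M :: "real^'n^'n"
  assumes sym: "transpose M = M" and S: "subspace S" and inv: "\<And>x. x \<in> S \<Longrightarrow> M *v x \<in> S"
    and ne: "y \<in> S" "y \<noteq> 0"
  obtains c v where "v \<in> S" "v \<noteq> 0" "M *v v = c *\<^sub>R v" "\<And>x. x \<in> S \<Longrightarrow> x \<bullet> (M *v x) \<le> c * (x \<bullet> x)"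
proof -
  let ?K = "sphere 0 1 \<inter> S"
  have "compact ?K"
    by (intro compact_Int_closed closed_subspace S compact_sphere)
  moreover have "(1 / norm y) *\<^sub>R y \<in> ?K"
    using ne S by (simp add: subspace_scale)
  hence "?K \<noteq> {}" by blast
  moreover have "continuous_on ?K (\<lambda>x. x \<bullet> (M *v x))"
    by (intro continuous_intros)
  ultimately obtain v where v: "v \<in> ?K" "\<And>x. x \<in> ?K \<Longrightarrow> x \<bullet> (M *v x) \<le> v \<bullet> (M *v v)"
    using continuous_attains_sup[of ?K "\<lambda>x. x \<bullet> (M *v x)"] by blast
  define c where "c = v \<bullet> (M *v v)"
  have vv: "v \<bullet> v = 1" using v(1) by (simp add: dot_square_norm)
  have le: "x \<bullet> (M *v x) \<le> c * (x \<bullet> x)" if "x \<in> S" for x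
  proof (cases "x = 0")
    case False
    let ?u = "(1 / norm x) *\<^sub>R x"
    have "?u \<in> ?K" using False that S by (simp add: subspace_scale)
    hence "?u \<bullet> (M *v ?u) \<le> c" using v(2) c_def by blast
    hence "(x \<bullet> (M *v x)) / (norm x)\<^sup>2 \<le> c"
      by (simp add: matrix_vector_mult_scaleR power2_eq_square)
    thus ?thesis using False by (simp add: divide_le_eq dot_square_norm)
  qed simp
  \<comment> \<open>The residual of the eigenvector equation, used as the direction of
    variation.\<close>
  define u where "u = c *\<^sub>R v - M *v v"
  define q where "q = c * (u \<bullet> u) - u \<bullet> (M *v u)"
  have uS: "u \<in> S" unfolding u_def using v(1) S inv by (auto intro: subspace_diff subspace_scale)
  have q0: "q \<ge> 0" using le[OF uS] by (simp add: q_def)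
  \<comment> \<open>The form \<open>c * (x \<bullet> x) - x \<bullet> (M *v x)\<close> is
    nonnegative on \<open>S\<close> and vanishes at \<open>v\<close>. Along
    \<open>v + s *\<^sub>R u\<close> it is a quadratic in \<open>s\<close> without constant
    term.\<close>
  have quad: "s\<^sup>2 * q + 2 * s * (u \<bullet> u) \<ge> 0" for s
  proof -
    let ?x = "v + s *\<^sub>R u"
    have "?x \<in> S" using uS v(1) S by (auto intro: subspace_add subspace_scale)
    from le[OF this] have "0 \<le> c * (?x \<bullet> ?x) - ?x \<bullet> (M *v ?x)" by simp
    also have "\<dots> = s\<^sup>2 * q + 2 * s * (u \<bullet> (c *\<^sub>R v - M *v v))"
      using symmetric_inner[OF sym, of v u] vv
      by (simp add: q_def c_def[symmetric] matrix_vector_right_distrib matrix_vector_mult_scaleR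
          inner_add_left inner_add_right inner_diff_right inner_commute algebra_simps power2_eq_square)
    finally show ?thesis by (simp add: u_def)
  qed
  have "u \<bullet> u = 0"
  proof (rule ccontr)
    assume "u \<bullet> u \<noteq> 0"
    hence p: "u \<bullet> u > 0" by simp
    \<comment> \<open>A negative step \<open>s = - r\<close> makes the linear term win over the
      quadratic one; adding 1 to \<open>q\<close> keeps the denominator positive when
      \<open>q = 0\<close>.\<close>
    define r where "r = (u \<bullet> u) / (q + 1)"
    define s where "s = - r"
    have "u \<bullet> u = r * (q + 1)" using q0 by (simp add: r_def)
    hence "s\<^sup>2 * q + 2 * s * (u \<bullet> u) = r\<^sup>2 * (q - 2 * (q + 1))"
      by (simp only: s_def) (simp add: algebra_simps power2_eq_square)
    also have "\<dots> < 0" using p q0 by (intro mult_pos_neg) (auto simp: r_def)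
    finally show False using quad[of s] by simp
  qed
  hence "M *v v = c *\<^sub>R v" by (simp add: u_def)
  moreover have "v \<noteq> 0" using vv by auto
  ultimately show ?thesis using that v(1) le by blast
qed

text \<open>Eigenvectors of distinct eigenvalues are orthogonal, and a pairwise orthogonal set is
  finite. Finiteness gives the \<open>Max\<close> in \<open>largest_eigenvalue\<close> and
  \<open>largest_singular_value\<close> its intended meaning.\<close>

lemma symmetric_finite_eigenvalues:
  fixes M :: "real^'n^'n"
  assumes sym: "transpose M = M"
  shows "finite {c. is_eigenvalue M c}"
proof -
  obtain f where f: "\<And>c. is_eigenvalue M c \<Longrightarrow> f c \<noteq> 0 \<and> M *v f c = c *s f c"
    using that[of "\<lambda>c. SOME v. v \<noteq> 0 \<and> M *v v = c *s v"] someI_ex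
    unfolding is_eigenvalue_def by (smt (verit, ccfv_SIG))
  have orth: "f c \<bullet> f d = 0" if "is_eigenvalue M c" "is_eigenvalue M d" "c \<noteq> d" for c d
  proof -
    have "d * (f c \<bullet> f d) = c * (f c \<bullet> f d)"
      using symmetric_inner[OF sym, of "f c" "f d"] f[OF that(1)] f[OF that(2)]
      by (simp add: scalar_mult_eq_scaleR)
    thus ?thesis using that(3) by simp
  qed
  have inj: "inj_on f {c. is_eigenvalue M c}"
    using orth f by (fastforce intro!: inj_onI)
  have "pairwise orthogonal (f ` {c. is_eigenvalue M c})"
    using orth by (auto simp: pairwise_def orthogonal_def) 
  hence "finite (f ` {c. is_eigenvalue M c})" by (rule pairwise_orthogonal_imp_finite)
  thus ?thesis using inj by (rule finite_imageD)
qed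

text \<open>The maximal Rayleigh quotient over the whole space is itself an eigenvalue and bounds
  every other one, so it is the \<open>Max\<close>.\<close>

lemma largest_eigenvalue_symmetric:
  fixes M :: "real^'n^'n"
  assumes sym: "transpose M = M"
  shows largest_eigenvalue_is_eigenvalue: "is_eigenvalue M (largest_eigenvalue M)"
    and inner_le_largest_eigenvalue: "x \<bullet> (M *v x) \<le> largest_eigenvalue M * (x \<bullet> x)"
proof -
  obtain y :: "real^'n" where "y \<noteq> 0" using nonzero_Basis nonempty_Basis by blast
  then obtain c v where v: "v \<noteq> 0" "M *v v = c *\<^sub>R v" and le: "\<And>x. x \<bullet> (M *v x) \<le> c * (x \<bullet> x)"
    by (metis symmetric_extremal_eigenvector[OF sym subspace_UNIV, of y] UNIV_I)
  have ev: "is_eigenvalue M c" using v by (auto simp: is_eigenvalue_def scalar_mult_eq_scaleR)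
  have "d \<le> c" if d: "is_eigenvalue M d" for d
  proof -
    obtain w where w: "w \<noteq> 0" "M *v w = d *s w" using d unfolding is_eigenvalue_def by auto
    have "d * (w \<bullet> w) \<le> c * (w \<bullet> w)" using le[of w] w by (simp add: scalar_mult_eq_scaleR)
    thus ?thesis using w by simp
  qed
  hence "largest_eigenvalue M = c"
    unfolding largest_eigenvalue_def using ev symmetric_finite_eigenvalues[OF sym] by (intro Max_eqI) auto
  thus "is_eigenvalue M (largest_eigenvalue M)" "x \<bullet> (M *v x) \<le> largest_eigenvalue M * (x \<bullet> x)"
    using ev le by auto
qed

text \<open>The quadratic form of the Gram matrix is the squared norm of \<open>M *v x\<close>.
  Singular values are the square roots of Gram eigenvalues, so their maximum is
  \<open>sqrt c\<close>, with \<open>c\<close> the largest of these eigenvalues.\<close>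

lemma largest_singular_value:
  fixes M :: "real^'c^'r"
  shows largest_singular_value_nonneg: "0 \<le> largest_singular_value M"
    and norm_le_largest_singular_value: "norm (M *v x) \<le> largest_singular_value M * norm x"
proof -
  let ?G = "transpose M ** M" and ?E = "\<lambda>c. is_eigenvalue (transpose M ** M) c"
  have sym: "transpose ?G = ?G" by (simp add: matrix_transpose_mul)
  have gram: "x \<bullet> (?G *v x) = (norm (M *v x))\<^sup>2" for x
    using inner_matrix_transpose[of x "transpose M" "M *v x"]
    by (simp add: matrix_vector_mul_assoc[symmetric] dot_square_norm)
  define c where "c = largest_eigenvalue ?G"
  have c: "?E c" "\<And>x. x \<bullet> (?G *v x) \<le> c * (x \<bullet> x)"
    using largest_eigenvalue_symmetric[OF sym] by (auto simp: c_def)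
  have c0: "c \<ge> 0"
  proof -
    obtain y :: "real^'c" where y: "y \<noteq> 0" using nonzero_Basis nonempty_Basis by blast
    have "0 \<le> c * (y \<bullet> y)" using c(2)[of y] gram[of y] by (metis order_trans zero_le_power2)
    thus ?thesis using y by (metis inner_gt_zero_iff mult_neg_pos not_le)
  qed
  have "{s. is_singular_value M s} \<subseteq> sqrt ` {c. ?E c}"
    unfolding is_singular_value_def by (force simp: image_iff)
  hence fin: "finite {s. is_singular_value M s}"
    using symmetric_finite_eigenvalues[OF sym] finite_surj by blast
  have max: "d \<le> c" if "?E d" for d
    using symmetric_finite_eigenvalues[OF sym] that by (simp add: c_def largest_eigenvalue_def)
  have eq: "largest_singular_value M = sqrt c"
    unfolding largest_singular_value_def
  proof (rule Max_eqI[OF fin])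
    fix s assume "s \<in> {s. is_singular_value M s}"
    hence "s\<^sup>2 \<le> c" using max by (auto simp: is_singular_value_def)
    thus "s \<le> sqrt c" by (rule real_le_rsqrt)
  qed (use c c0 in \<open>auto simp: is_singular_value_def\<close>)
  show "0 \<le> largest_singular_value M" using eq c0 by simp
  have "(norm (M *v x))\<^sup>2 \<le> (sqrt c * norm x)\<^sup>2"
    using c(2)[of x] gram[of x] c0 by (simp add: power_mult_distrib dot_square_norm)
  thus "norm (M *v x) \<le> largest_singular_value M * norm x"
    using eq c0 power2_le_imp_le by simp
qed

text \<open>Pair the image under the transpose with itself, move one factor across, and cancel one
  norm. If the image vanishes, only \<open>b \<ge> 0\<close> is left to show, which the hypothesis
  gives at a unit vector.\<close>

lemma norm_transpose_le:
  fixes M :: "real^'c^'r"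
  assumes M: "\<And>x. norm (M *v x) \<le> b * norm x"
  shows "norm (transpose M *v y) \<le> b * norm y"
proof (cases "transpose M *v y = 0")
  case False
  let ?z = "transpose M *v y"
  have "(norm ?z)\<^sup>2 = y \<bullet> (M *v ?z)" by (simp add: inner_matrix_transpose dot_square_norm)
  also have "\<dots> \<le> norm y * (b * norm ?z)"
    by (meson M mult_left_mono norm_cauchy_schwarz norm_ge_zero order_trans)
  finally show ?thesis using False by (simp add: power2_eq_square ac_simps)
next
  case True
  have "0 \<le> b * norm (axis k 1 :: real^'c)" for k using M norm_ge_zero order_trans by blast
  hence "b \<ge> 0" by simp
  thus ?thesis using True by simp
qed

text \<open>Links eigenvectors to the roots of the characteristic polynomial, by which
  \<open>eigenvalues_increasing\<close> specifies the spectrum.\<close>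

lemma is_eigenvalue_iff_det:
  fixes M :: "real^'n^'n"
  shows "is_eigenvalue M c \<longleftrightarrow> det (mat c - M) = 0"
proof -
  have eq: "(mat c - M) *v v = c *s v - M *v v" for v
  proof -
    have "mat c *v v = c *s v"
      by (simp add: mat_def matrix_vector_mult_def vec_eq_iff if_distrib[where f="\<lambda>x. x * v $ _"] cong: if_cong)
    thus ?thesis by (simp add: matrix_vector_mult_diff_rdistrib)
  qed
  have "det (mat c - M) = 0 \<longleftrightarrow> \<not> (\<forall>v. (mat c - M) *v v = 0 \<longrightarrow> v = 0)"
    using invertible_det_nz[of "mat c - M"] invertible_left_inverse[of "mat c - M"] matrix_left_invertible_ker[of "mat c - M"] by blast
  also have "\<dots> \<longleftrightarrow> is_eigenvalue M c"
    unfolding eq is_eigenvalue_def by (metis eq_iff_diff_eq_0)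
  finally show ?thesis by simp
qed

lemma is_eigenvalue_iff_eigenvalues_increasing:
  fixes M :: "real^'n^'n"
  assumes "eigenvalues_increasing M lam"
  shows "is_eigenvalue M c \<longleftrightarrow> (\<exists>k\<in>{1..CARD('n)}. c = lam k)"
  using assms by (auto simp: is_eigenvalue_iff_det eigenvalues_increasing_def)

lemma symmetric_part:
  fixes A :: "real^'d^'d"
  defines "S \<equiv> (1 / 2) *\<^sub>R (A + transpose A)"
  shows transpose_symmetric_part: "transpose S = S"
    and inner_symmetric_part: "v \<bullet> (S *v v) = v \<bullet> (A *v v)"
proof -
  show "transpose S = S" by (simp add: S_def transpose_def vec_eq_iff)
  show "v \<bullet> (S *v v) = v \<bullet> (A *v v)"
    using inner_matrix_transpose[of v "transpose A" v]
    by (simp add: S_def scaleR_matrix_vector_assoc[symmetric] matrix_vector_mult_add_rdistrib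
        inner_add_right inner_commute transpose_transpose)
qed

text \<open>The skew part of \<open>A\<close> does not contribute to the quadratic form. In this
  form \<open>lam_As A\<close> acts as the one-sided growth rate in the norm estimates for linear
  differential equations.\<close>

lemma lam_As_bound: "v \<bullet> (A *v v) \<le> lam_As A * (v \<bullet> v)"
  using inner_le_largest_eigenvalue[OF transpose_symmetric_part, of v A]
  by (simp only: lam_As_def inner_symmetric_part)

text \<open>Evaluated at an eigenvector of the symmetric part. It allows a bound on the singular
  value of \<open>A\<close>, as contained in \<open>Gamma_fun\<close>, to be read as a bound on the
  growth rate.\<close>

lemma lam_As_le_largest_singular_value: "lam_As A \<le> largest_singular_value A"
proof -
  obtain v where v: "v \<noteq> 0" "((1 / 2) *\<^sub>R (A + transpose A)) *v v = lam_As A *s v"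
    using largest_eigenvalue_is_eigenvalue[OF transpose_symmetric_part]
    by (auto simp: is_eigenvalue_def lam_As_def)
  have "lam_As A * (v \<bullet> v) = v \<bullet> (A *v v)"
    using inner_symmetric_part[of v A] v by (simp add: scalar_mult_eq_scaleR)
  also have "\<dots> \<le> norm v * (largest_singular_value A * norm v)"
    by (meson norm_le_largest_singular_value mult_left_mono norm_cauchy_schwarz norm_ge_zero order_trans)
  finally have "lam_As A * (v \<bullet> v) \<le> largest_singular_value A * (v \<bullet> v)"
    by (simp add: dot_square_norm power2_eq_square mult.left_commute)
  thus ?thesis using v by simp
qed

section \<open>Linear differential equations and the matrix exponential\<close>

text \<open>An integrated differential inequality that tolerates finitely many bad points: the
  trajectories need not be differentiable at the update times.\<close>

lemma diff_le_integral_except_finite: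
  fixes f :: "real \<Rightarrow> real"
  assumes "finite S" "a \<le> b" "continuous_on {a..b} f"
    and deriv: "\<And>s. s \<in> {a<..<b} - S \<Longrightarrow> (f has_real_derivative f' s) (at s)"
    and le: "\<And>s. s \<in> {a<..<b} - S \<Longrightarrow> f' s \<le> g s"
    and g: "g integrable_on {a..b}"
  shows "f b - f a \<le> integral {a..b} g"
proof -
  \<comment> \<open>At the exceptional points and the endpoints the derivative is replaced by
    \<open>g\<close>, so that the comparison of integrands holds everywhere.\<close>
  define f'' where "f'' s = (if s \<in> {a<..<b} - S then f' s else g s)" for s
  have "(f'' has_integral (f b - f a)) {a..b}"
    by (rule fundamental_theorem_of_calculus_interior_strong[OF assms(1,2) _ assms(3)])
      (use deriv in \<open>auto simp: f''_def has_real_derivative_iff_has_vector_derivative[symmetric]\<close>)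
  moreover have "(g has_integral integral {a..b} g) {a..b}" using g by blast
  ultimately show ?thesis by (rule has_integral_le) (use le in \<open>auto simp: f''_def\<close>)
qed

text \<open>In the proof the norm is regularised to \<open>sqrt (\<bar>y\<bar>\<^sup>2 + \<epsilon>\<^sup>2)\<close>, which is differentiable.\<close>

lemma norm_linear_ode_le:
  fixes A :: "real^'d^'d"
  assumes l0: "0 \<le> l" and l: "\<And>v. v \<bullet> (A *v v) \<le> l * (v \<bullet> v)"
    and S: "finite S" and at: "a \<le> t" and cont: "continuous_on {a..t} y"
    and deriv: "\<And>s. s \<in> {a<..<t} - S \<Longrightarrow> (y has_vector_derivative A *v y s + b s) (at s)"
    and le: "\<And>s. s \<in> {a<..<t} - S \<Longrightarrow> norm (b s) \<le> \<beta> s"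
    and int: "(\<lambda>s. exp (l * (t - s)) * \<beta> s) integrable_on {a..t}"
  shows "norm (y t) \<le> exp (l * (t - a)) * norm (y a)
           + integral {a..t} (\<lambda>s. exp (l * (t - s)) * \<beta> s)"
proof -
  let ?I = "integral {a..t} (\<lambda>s. exp (l * (t - s)) * \<beta> s)"
  have bnd: "norm (y t) \<le> exp (l * (t - a)) * (norm (y a) + \<epsilon>) + ?I" if e: "\<epsilon> > 0" for \<epsilon>
  proof -
    define \<psi> where "\<psi> s = sqrt (y s \<bullet> y s + \<epsilon>\<^sup>2)" for s
    have pos: "y s \<bullet> y s + \<epsilon>\<^sup>2 > 0" for s using e by (simp add: add_nonneg_pos)
    have psi_pos: "\<psi> s > 0" for s using pos by (simp add: \<psi>_def)
    have psi_sq: "\<psi> s * \<psi> s = y s \<bullet> y s + \<epsilon>\<^sup>2" for s using pos[of s] by (simp add: \<psi>_def)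
    have psi_ge: "norm (y s) \<le> \<psi> s" for s
      unfolding \<psi>_def norm_eq_sqrt_inner by simp
    have psi_le: "\<psi> s \<le> norm (y s) + \<epsilon>" for s
      unfolding \<psi>_def using e by (intro real_le_lsqrt) (auto simp: power2_sum dot_square_norm)
    let ?f = "\<lambda>s. exp (l * (t - s)) * \<psi> s"
    let ?f' = "\<lambda>s. exp (l * (t - s)) * ((y s \<bullet> (A *v y s + b s)) / \<psi> s - l * \<psi> s)"
    have "?f t - ?f a \<le> ?I"
    proof (rule diff_le_integral_except_finite[OF S at, where f' = ?f'])
      show "continuous_on {a..t} ?f" unfolding \<psi>_def by (intro continuous_intros cont)
      show "(?f has_real_derivative ?f' s) (at s)" if "s \<in> {a<..<t} - S" for s
      proof -
        have d: "((\<lambda>s. y s \<bullet> y s + \<epsilon>\<^sup>2) has_real_derivative 2 * (y s \<bullet> (A *v y s + b s))) (at s)"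
          using deriv[OF that] unfolding has_vector_derivative_def has_field_derivative_def
          by (auto intro!: derivative_eq_intros simp: inner_commute fun_eq_iff inner_add_right algebra_simps)
        have "(\<psi> has_real_derivative (y s \<bullet> (A *v y s + b s)) / \<psi> s) (at s)"
          unfolding \<psi>_def using DERIV_chain2[OF DERIV_real_sqrt[OF pos[of s]] d]
          by (simp add: field_simps)
        thus ?thesis by (auto intro!: derivative_eq_intros simp: algebra_simps)
      qed
      show "?f' s \<le> exp (l * (t - s)) * \<beta> s" if s: "s \<in> {a<..<t} - S" for s
      proof -
        have "y s \<bullet> (A *v y s + b s) \<le> l * (y s \<bullet> y s) + norm (y s) * norm (b s)"
          using l[of "y s"] norm_cauchy_schwarz[of "y s" "b s"] by (simp add: inner_add_right)
        \<comment> \<open>Here \<open>l \<ge> 0\<close> enters: the regularised square exceeds the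
          true one.\<close>
        also have "l * (y s \<bullet> y s) \<le> l * (\<psi> s * \<psi> s)"
          using l0 psi_sq[of s] by (intro mult_left_mono) auto
        also have "norm (y s) * norm (b s) \<le> \<psi> s * \<beta> s"
          using psi_ge le[OF s] by (intro mult_mono) (auto intro: less_imp_le psi_pos)
        finally have "(y s \<bullet> (A *v y s + b s)) / \<psi> s \<le> l * \<psi> s + \<beta> s"
          using psi_pos[of s] by (simp add: divide_le_eq algebra_simps)
        thus ?thesis by simp
      qed
    qed (rule int)
    hence "\<psi> t \<le> exp (l * (t - a)) * \<psi> a + ?I" by simp
    also have "exp (l * (t - a)) * \<psi> a \<le> exp (l * (t - a)) * (norm (y a) + \<epsilon>)"
      using psi_le by simp
    finally show ?thesis using psi_ge[of t] by linarith
  qed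
  show ?thesis
  proof (rule field_le_epsilon)
    fix e :: real assume "e > 0"
    thus "norm (y t) \<le> exp (l * (t - a)) * norm (y a) + ?I + e"
      using bnd[of "e / exp (l * (t - a))"] by (simp add: algebra_simps)
  qed
qed

lemma linear_ode_unique:
  fixes A :: "real^'d^'d"
  assumes S: "finite S" and at: "a \<le> t"
    and y: "continuous_on {a..t} y" "\<And>s. s \<in> {a<..<t} - S \<Longrightarrow> (y has_vector_derivative A *v y s) (at s)"
    and z: "continuous_on {a..t} z" "\<And>s. s \<in> {a<..<t} - S \<Longrightarrow> (z has_vector_derivative A *v z s) (at s)"
    and eq: "y a = z a"
  shows "y t = z t"
proof -
  \<comment> \<open>The norm estimate requires a nonnegative rate, while the sign of
    \<open>lam_As A\<close> is arbitrary here.\<close>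
  let ?l = "max 0 (lam_As A)"
  have "norm (y t - z t) \<le> exp (?l * (t - a)) * norm (y a - z a)
           + integral {a..t} (\<lambda>s. exp (?l * (t - s)) * 0)"
  proof (rule norm_linear_ode_le[OF _ _ S at, where y = "\<lambda>s. y s - z s" and A = A and b = "\<lambda>_. 0"])
    show "v \<bullet> (A *v v) \<le> ?l * (v \<bullet> v)" for v
      using lam_As_bound[of v A] by (smt (verit) inner_ge_zero mult_right_mono)
    show "((\<lambda>s. y s - z s) has_vector_derivative A *v (y s - z s) + 0) (at s)" if "s \<in> {a<..<t} - S" for s
      using has_vector_derivative_diff[OF y(2)[OF that] z(2)[OF that]]
      by (simp add: matrix_vector_mult_diff_distrib)
  qed (auto intro!: continuous_intros y z)
  thus ?thesis using eq by simp
qed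

section \<open>The matrix exponential as an entrywise power series\<close>

lemma has_vector_derivative_vecI:
  fixes f :: "real \<Rightarrow> real^'n"
  assumes "\<And>i. ((\<lambda>t. f t $ i) has_real_derivative f' $ i) (at x within S)"
  shows "(f has_vector_derivative f') (at x within S)"
  unfolding has_vector_derivative_def
proof (subst has_derivative_componentwise_within, rule ballI)
  fix b :: "real^'n" assume "b \<in> Basis"
  then obtain i where "b = axis i 1" by (auto simp: Basis_vec_def)
  moreover have "((\<lambda>t. f t $ i) has_derivative (\<lambda>h. h * f' $ i)) (at x within S)"
    using assms[of i] by (simp add: has_field_derivative_def mult_commute_abs)
  ultimately show "((\<lambda>t. f t \<bullet> b) has_derivative (\<lambda>h. h *\<^sub>R f' \<bullet> b)) (at x within S)"
    by (simp add: inner_axis)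
qed

text \<open>The sum of all absolute entries dominates every row sum, so each multiplication by
  \<open>M\<close> costs at most one such factor. This crude bound majorises the exponential series
  entry by entry.\<close>

lemma matrix_power_entry_le:
  fixes M :: "real^'d^'d"
  shows "\<bar>(((**) M ^^ k) (mat 1)) $ i $ j\<bar> \<le> (\<Sum>i\<in>UNIV. \<Sum>j\<in>UNIV. \<bar>M $ i $ j\<bar>) ^ k"
proof (induction k arbitrary: i)
  case 0
  thus ?case by (simp add: mat_def)
next
  case (Suc k)
  let ?C = "\<Sum>i\<in>UNIV. \<Sum>j\<in>UNIV. \<bar>M $ i $ j\<bar>" and ?P = "((**) M ^^ k) (mat 1)"
  have "\<bar>(((**) M ^^ Suc k) (mat 1)) $ i $ j\<bar> = \<bar>\<Sum>l\<in>UNIV. M $ i $ l * ?P $ l $ j\<bar>"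
    by (simp add: matrix_matrix_mult_def)
  also have "\<dots> \<le> (\<Sum>l\<in>UNIV. \<bar>M $ i $ l\<bar> * ?C ^ k)"
    by (rule order_trans[OF sum_abs]) (auto intro!: sum_mono mult_left_mono Suc simp: abs_mult)
  also have "\<dots> = (\<Sum>l\<in>UNIV. \<bar>M $ i $ l\<bar>) * ?C ^ k" by (simp add: sum_distrib_right)
  also have "\<dots> \<le> ?C * ?C ^ k"
    by (intro mult_right_mono zero_le_power sum_nonneg) 
      (auto intro!: member_le_sum[of i UNIV "\<lambda>i. \<Sum>l\<in>UNIV. \<bar>M $ i $ l\<bar>"] sum_nonneg)
  finally show ?case by simp
qed

text \<open>Turns each entry of the matrix exponential into a real power series in \<open>t\<close>,
  to which termwise differentiation applies.\<close>

lemma mat_exp_entry: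
  fixes M :: "real^'d^'d"
  defines "c \<equiv> \<lambda>i j k. (((**) M ^^ k) (mat 1)) $ i $ j / fact k"
  shows mat_exp_coeff_summable: "summable (\<lambda>k. c i j k * t ^ k)"
    and mat_exp_nth: "mat_exp (t *\<^sub>R M) $ i $ j = (\<Sum>k. c i j k * t ^ k)"
proof -
  have summ: "summable (\<lambda>k. c i j k * t ^ k)" for i j t
  proof (rule summable_comparison_test'[where N = 0])
    let ?C = "\<Sum>i\<in>UNIV. \<Sum>j\<in>UNIV. \<bar>M $ i $ j\<bar>"
    show "summable (\<lambda>k. (1 / fact k) * (?C * \<bar>t\<bar>) ^ k)"
      using summable_exp[of "?C * \<bar>t\<bar>"] by (simp add: inverse_eq_divide)
    show "norm (c i j k * t ^ k) \<le> (1 / fact k) * (?C * \<bar>t\<bar>) ^ k" for k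
      using matrix_power_entry_le[of k M i j]
      by (auto simp: c_def abs_mult power_abs power_mult_distrib intro!: divide_right_mono mult_right_mono)
  qed
  have pow: "((**) (t *\<^sub>R M) ^^ k) (mat 1) = t ^ k *\<^sub>R ((**) M ^^ k) (mat 1)" for k
    by (induction k) (auto simp: matrix_matrix_mult_def vec_eq_iff sum_distrib_left ac_simps)
  have "(\<lambda>k. (1 / fact k) *\<^sub>R ((**) (t *\<^sub>R M) ^^ k) (mat 1)) sums (\<chi> i j. \<Sum>k. c i j k * t ^ k)"
    unfolding sums_def
  proof (intro vec_tendstoI)
    fix i j
    have "(\<lambda>n. \<Sum>k<n. c i j k * t ^ k) \<longlonglongrightarrow> (\<Sum>k. c i j k * t ^ k)"
      using summ[of i j t] by (simp add: summable_LIMSEQ)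
    thus "(\<lambda>n. (\<Sum>k<n. (1 / fact k) *\<^sub>R ((**) (t *\<^sub>R M) ^^ k) (mat 1)) $ i $ j)
            \<longlonglongrightarrow> (\<chi> i j. \<Sum>k. c i j k * t ^ k) $ i $ j"
      by (simp add: pow c_def ac_simps)
  qed
  thus "mat_exp (t *\<^sub>R M) $ i $ j = (\<Sum>k. c i j k * t ^ k)"
    unfolding mat_exp_def by (simp add: sums_unique[symmetric])
  show "summable (\<lambda>k. c i j k * t ^ k)" by (rule summ)
qed

lemma mat_exp_0: "mat_exp (0 :: real^'d^'d) = mat 1"
proof -
  have "mat_exp (0 *\<^sub>R (0 :: real^'d^'d)) = mat 1"
    unfolding vec_eq_iff by (simp only: mat_exp_nth powser_zero) (simp add: mat_def)
  thus ?thesis by simp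
qed

lemma mat_exp_nth_has_derivative:
  fixes M :: "real^'d^'d"
  shows "((\<lambda>t. mat_exp (t *\<^sub>R M) $ i $ j) has_real_derivative (M ** mat_exp (t *\<^sub>R M)) $ i $ j) (at t)"
proof -
  define c where "c = (\<lambda>i j k. (((**) M ^^ k) (mat 1)) $ i $ j / fact k)"
  have s: "summable (\<lambda>k. c i j k * t ^ k)" for i j t
    unfolding c_def by (rule mat_exp_coeff_summable)
  have e: "mat_exp (t *\<^sub>R M) $ i $ j = (\<Sum>k. c i j k * t ^ k)" for i j t
    unfolding c_def by (rule mat_exp_nth)
  \<comment> \<open>The factor \<open>k + 1\<close> produced by differentiation cancels against the
    factorial, and one factor \<open>M\<close> splits off the power on the left.\<close>
  have "diffs (c i j) k * t ^ k = (\<Sum>l\<in>UNIV. M $ i $ l * (c l j k * t ^ k))" for k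
    by (simp add: diffs_def c_def matrix_matrix_mult_def sum_divide_distrib sum_distrib_left
        sum_distrib_right field_simps del: of_nat_Suc)
  hence "(\<Sum>k. diffs (c i j) k * t ^ k) = (\<Sum>k. \<Sum>l\<in>UNIV. M $ i $ l * (c l j k * t ^ k))"
    by simp
  also have "\<dots> = (\<Sum>l\<in>UNIV. \<Sum>k. M $ i $ l * (c l j k * t ^ k))"
    by (rule suminf_sum) (intro summable_mult s)
  also have "\<dots> = (M ** mat_exp (t *\<^sub>R M)) $ i $ j"
    using s by (simp add: matrix_matrix_mult_def e suminf_mult)
  finally show ?thesis
    using termdiffs_strong_converges_everywhere[OF s[of i j], of t] by (simp add: e)
qed

lemma mat_exp_has_vector_derivative:
  fixes M :: "real^'d^'d"
  shows "((\<lambda>t. mat_exp (t *\<^sub>R M) *v v) has_vector_derivative M *v (mat_exp (t *\<^sub>R M) *v v)) (at t within S)"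
proof (rule has_vector_derivative_at_within, rule has_vector_derivative_vecI)
  fix i
  show "((\<lambda>t. (mat_exp (t *\<^sub>R M) *v v) $ i) has_real_derivative
          (M *v (mat_exp (t *\<^sub>R M) *v v)) $ i) (at t)"
    unfolding matrix_vector_mul_assoc unfolding matrix_vector_mult_def vec_lambda_beta
    by (intro DERIV_sum DERIV_cmult_right mat_exp_nth_has_derivative)
qed

lemma continuous_on_mat_exp: "continuous_on S (\<lambda>t. mat_exp (t *\<^sub>R M) *v v)"
  by (rule continuous_on_vector_derivative) (rule mat_exp_has_vector_derivative)

lemma free_response_mat_exp: "free_response A (\<lambda>t. mat_exp (t *\<^sub>R A) *v v)"
  by (simp add: free_response_def mat_exp_has_vector_derivative)

text \<open>As functions of \<open>s\<close> both sides solve the same linear equation with the same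
  value at \<open>s = 0\<close>. The sign condition on \<open>s\<close> reflects that uniqueness is
  available forwards in time.\<close>

lemma mat_exp_add:
  assumes "0 \<le> s"
  shows "mat_exp ((r + s) *\<^sub>R M) *v v = mat_exp (s *\<^sub>R M) *v (mat_exp (r *\<^sub>R M) *v v)"
proof -
  let ?y = "\<lambda>s. mat_exp ((r + s) *\<^sub>R M) *v v"
    and ?z = "\<lambda>s. mat_exp (s *\<^sub>R M) *v (mat_exp (r *\<^sub>R M) *v v)"
  have "((\<lambda>t. mat_exp (t *\<^sub>R M) *v v) \<circ> (\<lambda>s. r + s) has_vector_derivative
      1 *\<^sub>R (M *v (mat_exp ((r + s) *\<^sub>R M) *v v))) (at s)" for s
    by (rule vector_diff_chain_at)
      (auto intro!: derivative_eq_intros mat_exp_has_vector_derivative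
        simp: has_real_derivative_iff_has_vector_derivative[symmetric])
  hence y: "(?y has_vector_derivative M *v ?y s) (at s)" for s
    by (simp add: o_def)
  have cont: "continuous_on {0..s} ?y"
    by (rule continuous_on_vector_derivative) (rule has_vector_derivative_at_within[OF y])
  show ?thesis
    by (rule linear_ode_unique[OF finite.emptyI assms cont y continuous_on_mat_exp mat_exp_has_vector_derivative])
      (simp add: mat_exp_0)
qed

lemma integral_exp_reverse:
  assumes "a \<le> (t::real)" 
  shows "((\<lambda>s. exp (l * (t - s))) has_integral (if l = 0 then t - a else (exp (l * (t - a)) - 1) / l)) {a..t}"
proof (cases "l = 0")
  case True
  thus ?thesis using has_integral_const_real[of "1::real" a t] assms by simp
next
  case False
  have "((\<lambda>s. exp (l * (t - s))) has_integral (- exp (l * (t - t)) / l - - exp (l * (t - a)) / l)) {a..t}"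
    by (rule fundamental_theorem_of_calculus[OF assms])
      (use False in \<open>auto intro!: derivative_eq_intros simp: has_real_derivative_iff_has_vector_derivative[symmetric]\<close>)
  thus ?thesis using False by (simp add: diff_divide_distrib)
qed

text \<open>The difference starts at 0 and solves the linear equation with constant forcing
  \<open>A *v v\<close>, so the norm estimate leaves the integral of an exponential. This is the
  source of the quotient in \<open>Delta_kappa\<close>, including its limit at rate 0.\<close>

lemma norm_mat_exp_diff_le:
  assumes l0: "0 \<le> lam_As A" and r: "0 \<le> r" "r \<le> h"
  shows "norm (mat_exp (r *\<^sub>R A) *v v - v) \<le> largest_singular_value A * norm v
    * (if lam_As A = 0 then h else (exp (lam_As A * h) - 1) / lam_As A)"
proof -
  let ?l = "lam_As A" and ?g = "largest_singular_value A * norm v"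
  let ?J = "\<lambda>r. if ?l = 0 then r else (exp (?l * r) - 1) / ?l"
  have int: "((\<lambda>s. exp (?l * (r - s)) * ?g) has_integral (?J r * ?g)) {0..r}"
    using has_integral_mult_left[OF integral_exp_reverse[of 0 r ?l], of ?g] r by (cases "?l = 0") auto
  have "norm (mat_exp (r *\<^sub>R A) *v v - v) \<le> exp (?l * (r - 0)) * norm (mat_exp (0 *\<^sub>R A) *v v - v)
           + integral {0..r} (\<lambda>s. exp (?l * (r - s)) * ?g)"
  proof (rule norm_linear_ode_le[OF l0 lam_As_bound, of "{}" 0 r _ "\<lambda>s. A *v v"])
    show "((\<lambda>s. mat_exp (s *\<^sub>R A) *v v - v) has_vector_derivative
        A *v (mat_exp (s *\<^sub>R A) *v v - v) + A *v v) (at s)" for s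
      using has_vector_derivative_diff[OF mat_exp_has_vector_derivative[of A v s UNIV] has_vector_derivative_const]
      by (simp add: matrix_vector_mult_diff_distrib)
  qed (use r int in \<open>auto intro!: continuous_intros continuous_on_mat_exp norm_le_largest_singular_value\<close>)
  also have "\<dots> = ?J r * ?g" by (simp only: integral_unique[OF int]) (simp add: mat_exp_0)
  also have "\<dots> \<le> ?J h * ?g"
  proof (rule mult_right_mono)
    have "exp (?l * r) \<le> exp (?l * h)" using r l0 by (simp add: mult_left_mono)
    thus "?J r \<le> ?J h" using r l0 by (simp add: divide_right_mono)
  qed (simp add: largest_singular_value_nonneg)
  finally show ?thesis by (simp only: mult.commute)
qed

section \<open>Consequences of marginal stability\<close>

text \<open>A negative rate would make every free response decay, contrary to the second half of
  marginal stability. The sign is what allows \<open>norm_linear_ode_le\<close> to be used with the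
  rate \<open>lam_As A\<close> itself.\<close>

lemma marginally_stable_lam_As_nonneg:
  assumes "marginally_stable A"
  shows "0 \<le> lam_As A"
proof (rule ccontr)
  assume neg: "\<not> 0 \<le> lam_As A"
  let ?l = "lam_As A"
  have "(y \<longlongrightarrow> 0) at_top" if y: "free_response A y" for y
  proof -
    have bound: "norm (y t) \<le> exp (?l * t) * norm (y 0)" if t: "t \<ge> 0" for t
    proof -
      \<comment> \<open>The norm estimate for nonnegative rates does not apply, so the decay is
        derived from this nonincreasing weighted square.\<close>
      let ?f = "\<lambda>s. exp (- 2 * ?l * s) * (y s \<bullet> y s)"
      have "?f t - ?f 0 \<le> integral {0..t} (\<lambda>_. 0)"
      proof (rule diff_le_integral_except_finite[of "{}", where
            f' = "\<lambda>s. exp (- 2 * ?l * s) * (2 * (y s \<bullet> (A *v y s) - ?l * (y s \<bullet> y s)))"])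
        have "continuous_on {0..} y"
          by (rule continuous_on_vector_derivative[where f' = "\<lambda>t. A *v y t"]) (use y in \<open>auto simp: free_response_def\<close>)
        hence "continuous_on {0..t} y" by (rule continuous_on_subset) auto
        thus "continuous_on {0..t} ?f" by (intro continuous_intros)
        fix s assume s: "s \<in> {0<..<t} - {}"
        have "(y has_vector_derivative A *v y s) (at s within {0..})"
          using y s by (auto simp: free_response_def)
        moreover have "at s within {0..} = at s"
          using s by (intro at_within_interior) auto
        ultimately have "(y has_derivative (\<lambda>h. h *\<^sub>R (A *v y s))) (at s)"
          by (simp add: has_vector_derivative_def)
        hence "((\<lambda>s. y s \<bullet> y s) has_real_derivative 2 * (y s \<bullet> (A *v y s))) (at s)"
          unfolding has_field_derivative_def
          by (auto intro!: derivative_eq_intros simp: inner_commute fun_eq_iff algebra_simps)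
        thus "(?f has_real_derivative exp (- 2 * ?l * s) * (2 * (y s \<bullet> (A *v y s) - ?l * (y s \<bullet> y s)))) (at s)"
          by (auto intro!: derivative_eq_intros simp: algebra_simps)
        show "exp (- 2 * ?l * s) * (2 * (y s \<bullet> (A *v y s) - ?l * (y s \<bullet> y s))) \<le> 0"
          using lam_As_bound[of "y s" A] by (intro mult_nonneg_nonpos) auto
      qed (use t in auto)
      hence "?f t \<le> y 0 \<bullet> y 0" by simp
      hence "exp (2 * ?l * t) * ?f t \<le> exp (2 * ?l * t) * (y 0 \<bullet> y 0)" by (intro mult_left_mono) auto
      hence "(norm (y t))\<^sup>2 \<le> (exp (?l * t) * norm (y 0))\<^sup>2"
        by (simp add: dot_square_norm power_mult_distrib mult.assoc[symmetric]
            flip: exp_add exp_double)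
      thus ?thesis by (rule power2_le_imp_le) simp
    qed
    have "((\<lambda>t. exp (?l * t) * norm (y 0)) \<longlongrightarrow> 0) at_top"
    proof -
      have "filterlim (\<lambda>t. ?l * t) at_bot at_top"
        using neg by (intro filterlim_tendsto_neg_mult_at_bot[OF tendsto_const]) (auto intro: filterlim_ident)
      hence "((\<lambda>t. exp (?l * t)) \<longlongrightarrow> 0) at_top"
        by (rule filterlim_compose[OF exp_at_bot])
      thus ?thesis by (rule tendsto_mult_left_zero)
    qed
    moreover have "\<forall>\<^sub>F t in at_top. norm (y t) \<le> exp (?l * t) * norm (y 0)"
      using eventually_ge_at_top[of 0] by eventually_elim (rule bound)
    ultimately show ?thesis by (rule Lim_null_comparison[rotated])
  qed
  thus False using assms by (auto simp: marginally_stable_def)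
qed

text \<open>The columns of the exponential are free responses from the basis vectors, hence bounded.
  Without an upper bound the suprema in \<open>Delta_kappa\<close> and \<open>Delta_bar\<close>
  would not dominate the values they range over.\<close>

lemma marginally_stable_mat_exp_bounded:
  fixes A :: "real^'d^'d"
  assumes "marginally_stable A"
  shows bdd_onorm_mat_exp: "bdd_above ((\<lambda>s. onorm ((*v) (mat_exp (s *\<^sub>R A)))) ` {0..})"
    and bdd_row_sum_norm_mat_exp: "bdd_above ((\<lambda>s. (row_sum_norm (mat_exp (s *\<^sub>R A)))\<^sup>2) ` {0..})"
proof -
  have "\<exists>C. \<forall>s\<ge>0. norm (mat_exp (s *\<^sub>R A) *v axis j 1) \<le> C" for j
    using assms free_response_mat_exp[of A "axis j 1"]
    unfolding marginally_stable_def bounded_iff by fastforce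
  then obtain C where C: "\<And>s j. s \<ge> 0 \<Longrightarrow> norm (mat_exp (s *\<^sub>R A) *v axis j 1) \<le> C j" by metis
  have entry: "\<bar>mat_exp (s *\<^sub>R A) $ i $ j\<bar> \<le> C j" if "s \<ge> 0" for s i j
    using C[OF that, of j] component_le_norm_cart[of "mat_exp (s *\<^sub>R A) *v axis j 1" i]
    by (simp add: matrix_vector_mult_basis column_def)
  have C0: "0 \<le> C j" for j using entry[of 0 undefined j] by simp
  have "onorm ((*v) (mat_exp (s *\<^sub>R A))) \<le> (\<Sum>j\<in>UNIV. C j)" if s: "s \<ge> 0" for s
  proof (rule onorm_bound)
    fix x :: "real^'d"
    have "norm (mat_exp (s *\<^sub>R A) *v x) = norm (\<Sum>j\<in>UNIV. x $ j *\<^sub>R (mat_exp (s *\<^sub>R A) *v axis j 1))"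
      by (simp add: matrix_mult_sum[of _ x] matrix_vector_mult_basis scalar_mult_eq_scaleR)
    also have "\<dots> \<le> (\<Sum>j\<in>UNIV. C j * norm x)"
    proof (rule order_trans[OF norm_sum], rule sum_mono)
      fix j
      show "norm (x $ j *\<^sub>R (mat_exp (s *\<^sub>R A) *v axis j 1)) \<le> C j * norm x"
        using mult_mono[OF component_le_norm_cart[of x j] C[OF s, of j]] by (simp add: mult.commute)
    qed
    finally show "norm (mat_exp (s *\<^sub>R A) *v x) \<le> (\<Sum>j\<in>UNIV. C j) * norm x"
      by (simp add: sum_distrib_right)
  qed (simp add: sum_nonneg C0)
  thus "bdd_above ((\<lambda>s. onorm ((*v) (mat_exp (s *\<^sub>R A)))) ` {0..})" by (intro bdd_aboveI2) auto
  have "(row_sum_norm (mat_exp (s *\<^sub>R A)))\<^sup>2 \<le> (\<Sum>j\<in>UNIV. C j)\<^sup>2" if s: "s \<ge> 0" for s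
  proof (rule power_mono)
    show "row_sum_norm (mat_exp (s *\<^sub>R A)) \<le> (\<Sum>j\<in>UNIV. C j)"
      unfolding row_sum_norm_def by (auto intro!: sum_mono entry s)
    show "0 \<le> row_sum_norm (mat_exp (s *\<^sub>R A))"
      unfolding row_sum_norm_def by (auto simp: Max_ge_iff intro!: sum_nonneg)
  qed
  thus "bdd_above ((\<lambda>s. (row_sum_norm (mat_exp (s *\<^sub>R A)))\<^sup>2) ` {0..})" by (intro bdd_aboveI2) auto
qed

lemma row_sum_norm_mat_exp_SUP_ge_1:
  assumes "marginally_stable (A :: real^'d^'d)"
  shows "1 \<le> (SUP s\<in>{0..}. (row_sum_norm (mat_exp (s *\<^sub>R A)))\<^sup>2)"
proof -
  have "range (\<lambda>i::'d. \<Sum>j\<in>UNIV. \<bar>(mat 1 :: real^'d^'d) $ i $ j\<bar>) = {1}"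
    by (auto simp: mat_def if_distrib[of abs] cong: if_cong)
  hence "row_sum_norm (mat 1 :: real^'d^'d) = 1" by (simp add: row_sum_norm_def)
  hence "1 = (row_sum_norm (mat_exp (0 *\<^sub>R A)))\<^sup>2" by (simp add: mat_exp_0)
  also have "\<dots> \<le> (SUP s\<in>{0..}. (row_sum_norm (mat_exp (s *\<^sub>R A)))\<^sup>2)"
    by (rule cSUP_upper[OF _ bdd_row_sum_norm_mat_exp[OF assms]]) simp
  finally show ?thesis .
qed

section \<open>Graph Laplacians and Kronecker products\<close>

lemma inner_stack: "stack f \<bullet> stack g = (\<Sum>i\<in>UNIV. f i \<bullet> g i)"
  by (simp add: stack_def inner_vec_def UNIV_Times_UNIV[symmetric] sum.cartesian_product
      case_prod_beta del: UNIV_Times_UNIV)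

lemma norm_stack: "(norm (stack f))\<^sup>2 = (\<Sum>i\<in>UNIV. (norm (f i))\<^sup>2)"
  by (simp add: inner_stack dot_square_norm[symmetric])

lemma stack_diff: "stack f - stack g = stack (\<lambda>i. f i - g i)"
  by (simp add: stack_def vec_eq_iff)

text \<open>The dictionary between the Kronecker matrices in the constants and the sums over
  neighbouring agents in the dynamics.\<close>

lemma kron_mult_stack: "kron M N *v stack f = stack (\<lambda>i. \<Sum>j\<in>UNIV. M $ i $ j *\<^sub>R (N *v f j))"
  by (simp add: vec_eq_iff kron_def stack_def matrix_vector_mult_def UNIV_Times_UNIV[symmetric]
      sum.cartesian_product case_prod_beta sum_distrib_left mult.assoc del: UNIV_Times_UNIV)

lemma transpose_incidence_mult:
  fixes D :: "real^'e^'n"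
  assumes "D = (\<chi> i e. (if i = tgt e then 1 else 0) - (if i = src e then 1 else 0))"
  shows "(transpose D *v z) $ e = z $ tgt e - z $ src e"
proof -
  have "(transpose D *v z) $ e = (\<Sum>i\<in>UNIV. (if i = tgt e then z $ i else 0) - (if i = src e then z $ i else 0))"
    unfolding assms matrix_vector_mult_def transpose_def by (auto intro!: sum.cong)
  thus ?thesis by (simp add: sum_subtractf)
qed

text \<open>Sends each edge at \<open>i\<close> to its opposite endpoint, which is a bijection onto
  the neighbours of \<open>i\<close> because the graph is simple and the columns of \<open>D\<close>
  enumerate its edges once.\<close>

lemma laplacian_mult:
  fixes D :: "real^'e^'n"
  assumes g: "simple_graph adj" and D: "incidence_matrix adj D"
  shows "((D ** transpose D) *v z) $ i = (\<Sum>j | adj i j. z $ i - z $ j)"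
proof -
  obtain src tgt where bij: "bij_betw (\<lambda>e. {src e, tgt e}) UNIV {{i, j} | i j. adj i j}"
    and Deq: "D = (\<chi> i e. (if i = tgt e then 1 else 0) - (if i = src e then 1 else 0))"
    using D by (auto simp: incidence_matrix_def)
  have sym: "adj b a" if "adj a b" for a b using g that by (auto simp: simple_graph_def dest: sympD)
  have irr: "\<not> adj a a" for a using g by (auto simp: simple_graph_def dest: irreflpD)
  have edge: "adj (src e) (tgt e)" for e
  proof -
    obtain a b where "{src e, tgt e} = {a, b}" "adj a b" using bij_betw_apply[OF bij UNIV_I, of e] by blast
    thus ?thesis using sym by (auto simp: doubleton_eq_iff)
  qed
  hence ne: "src e \<noteq> tgt e" for e using irr by metis
  define other where "other e = (if src e = i then tgt e else src e)" for e
  have ends: "{src e, tgt e} = {i, other e}" if "i \<in> {src e, tgt e}" for e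
    using that by (auto simp: other_def)
  have "bij_betw other {e. i \<in> {src e, tgt e}} {j. adj i j}"
  proof (rule bij_betwI')
    fix e e' assume "e \<in> {e. i \<in> {src e, tgt e}}" "e' \<in> {e. i \<in> {src e, tgt e}}"
    thus "(other e = other e') = (e = e')"
      using bij ends[of e] ends[of e'] by (auto simp: bij_betw_def inj_on_def)
  next
    fix e assume "e \<in> {e. i \<in> {src e, tgt e}}"
    thus "other e \<in> {j. adj i j}" using edge[of e] sym by (auto simp: other_def)
  next
    fix j assume "j \<in> {j. adj i j}"
    hence "{i, j} \<in> (\<lambda>e. {src e, tgt e}) ` UNIV" and "i \<noteq> j" using bij irr by (auto simp: bij_betw_def)
    then obtain e where "{i, j} = {src e, tgt e}" by auto
    hence "i \<in> {src e, tgt e}" "j = other e" using \<open>i \<noteq> j\<close> by (auto simp: other_def doubleton_eq_iff)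
    thus "\<exists>e\<in>{e. i \<in> {src e, tgt e}}. j = other e" by blast
  qed
  hence "(\<Sum>j | adj i j. z $ i - z $ j) = (\<Sum>e | i \<in> {src e, tgt e}. z $ i - z $ other e)"
    by (rule sum.reindex_bij_betw[symmetric])
  also have "\<dots> = (\<Sum>e\<in>UNIV. if i \<in> {src e, tgt e} then z $ i - z $ other e else 0)"
    by (simp add: sum.If_cases)
  \<comment> \<open>The entry of \<open>D\<close> is 1 at the target and -1 at the source, so either
    orientation contributes the difference from \<open>i\<close> to the other end; edges away from
    \<open>i\<close> contribute 0.\<close>
  also have "\<dots> = (\<Sum>e\<in>UNIV. D $ i $ e * (z $ tgt e - z $ src e))"
    using ne by (intro sum.cong) (auto simp: Deq other_def)
  also have "\<dots> = (D *v (transpose D *v z)) $ i"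
    unfolding matrix_vector_mult_def[of D] vec_lambda_beta transpose_incidence_mult[OF Deq] ..
  finally show ?thesis by (simp only: matrix_vector_mul_assoc)
qed

lemma laplacian_sum_scaleR:
  fixes f :: "'n::finite \<Rightarrow> real^'d" and D :: "real^'e^'n"
  assumes "simple_graph adj" "incidence_matrix adj D"
  shows "(\<Sum>j\<in>UNIV. (D ** transpose D) $ i $ j *\<^sub>R f j) = (\<Sum>j | adj i j. f i - f j)"
proof (subst vec_eq_iff, rule allI)
  fix p
  show "(\<Sum>j\<in>UNIV. (D ** transpose D) $ i $ j *\<^sub>R f j) $ p = (\<Sum>j | adj i j. f i - f j) $ p"
    using laplacian_mult[OF assms, of "\<chi> j. f j $ p" i] by (simp add: matrix_vector_mult_def)
qed

lemma laplacian_sum_const: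
  fixes c :: "real^'d" and D :: "real^'e^'n"
  assumes "simple_graph adj" "incidence_matrix adj D"
  shows "(\<Sum>j\<in>UNIV. (D ** transpose D) $ i $ j *\<^sub>R c) = 0"
  using laplacian_sum_scaleR[OF assms, of i "\<lambda>_. c"] by simp

lemma transpose_gram: "transpose (D ** transpose D) = D ** transpose (D :: real^'e^'n)"
  by (simp add: matrix_transpose_mul)

lemma inner_gram: "x \<bullet> ((D ** transpose D) *v x) = (norm (transpose D *v x))\<^sup>2"
  for D :: "real^'e^'n"
  by (metis inner_matrix_transpose matrix_vector_mul_assoc power2_norm_eq_inner)

text \<open>The largest eigenvalue is some \<open>lam k\<close> and hence at most the last one. The
  norm bound splits the Laplacian into \<open>D\<close> and its transpose, each of norm at most the
  square root of that value.\<close>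

lemma gram_largest_eigenvalue:
  fixes D :: "real^'e^'n"
  assumes lam: "eigenvalues_increasing (D ** transpose D) lam"
  shows laplacian_lam_nonneg: "0 \<le> lam CARD('n)"
    and laplacian_inner_le: "x \<bullet> ((D ** transpose D) *v x) \<le> lam CARD('n) * (x \<bullet> x)"
    and laplacian_norm_le: "norm ((D ** transpose D) *v x) \<le> lam CARD('n) * norm x"
proof -
  let ?L = "D ** transpose D" and ?l = "lam CARD('n)"
  obtain k where k: "k \<in> {1..CARD('n)}" "largest_eigenvalue ?L = lam k"
    using largest_eigenvalue_is_eigenvalue[OF transpose_gram] is_eigenvalue_iff_eigenvalues_increasing[OF lam]
    by blast
  have "lam k \<le> ?l"
    using k lam by (auto simp: eigenvalues_increasing_def intro: mono_onD)
  hence le: "x \<bullet> (?L *v x) \<le> ?l * (x \<bullet> x)" for x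
    using inner_le_largest_eigenvalue[OF transpose_gram, of x D] k
    by (smt (verit) inner_ge_zero mult_right_mono)
  obtain y :: "real^'n" where y: "y \<noteq> 0" using nonzero_Basis nonempty_Basis by blast
  have "0 \<le> ?l * (y \<bullet> y)" using le[of y] by (metis inner_gram order_trans zero_le_power2)
  thus l0: "0 \<le> ?l" using y by (metis inner_gt_zero_iff mult_neg_pos not_le)
  show "x \<bullet> (?L *v x) \<le> ?l * (x \<bullet> x)" by (rule le)
  have DT: "norm (transpose D *v x) \<le> sqrt ?l * norm x" for x
  proof (rule power2_le_imp_le)
    have "(norm (transpose D *v x))\<^sup>2 \<le> ?l * (norm x)\<^sup>2"
      using le[of x] by (simp only: inner_gram dot_square_norm)
    thus "(norm (transpose D *v x))\<^sup>2 \<le> (sqrt ?l * norm x)\<^sup>2"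
      using l0 by (simp add: power_mult_distrib)
  qed (use l0 in simp)
  have "norm (?L *v x) = norm (D *v (transpose D *v x))" by (simp only: matrix_vector_mul_assoc)
  also have "\<dots> \<le> sqrt ?l * norm (transpose D *v x)"
    using norm_transpose_le[OF DT] unfolding transpose_transpose .
  also have "\<dots> \<le> sqrt ?l * (sqrt ?l * norm x)" using DT l0 by (intro mult_left_mono) auto
  finally show "norm (?L *v x) \<le> ?l * norm x" using l0 by (simp add: mult.assoc[symmetric])
qed

text \<open>The hypothesis equates \<open>z\<close> at the two ends of each edge, and connectedness
  carries this along paths.\<close>

lemma laplacian_kernel:
  fixes D :: "real^'e^'n"
  assumes D: "incidence_matrix adj D" and conn: "connected_graph adj"
    and z: "transpose D *v z = 0"
  shows "z $ i = z $ j"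
proof -
  obtain src tgt where bij: "bij_betw (\<lambda>e. {src e, tgt e}) UNIV {{i, j} | i j. adj i j}"
    and Deq: "D = (\<chi> i e. (if i = tgt e then 1 else 0) - (if i = src e then 1 else 0))"
    using D by (auto simp: incidence_matrix_def)
  have eq: "z $ tgt e = z $ src e" for e
    using transpose_incidence_mult[OF Deq, of z e] z by simp
  have step: "z $ a = z $ b" if "adj a b" for a b
  proof -
    have "{a, b} \<in> (\<lambda>e. {src e, tgt e}) ` UNIV" using bij that by (auto simp: bij_betw_def)
    then obtain e where "{a, b} = {src e, tgt e}" by auto
    thus ?thesis using eq[of e] by (auto simp: doubleton_eq_iff)
  qed
  have "rtranclp adj i j" using conn by (simp add: connected_graph_def)
  thus ?thesis by induction (auto dest: step)
qed

text \<open>The least eigenvalue on the zero-sum vectors, found as an extremal eigenvalue of the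
  negated Laplacian, equals some \<open>lam k\<close>. It remains to exclude
  \<open>k = 1\<close>.\<close>

lemma laplacian_inner_ge:
  fixes D :: "real^'e^'n"
  assumes g: "simple_graph adj" and conn: "connected_graph adj" and D: "incidence_matrix adj D"
    and lam: "eigenvalues_increasing (D ** transpose D) lam" and pos: "0 < lam 2"
    and x: "(\<Sum>i\<in>UNIV. x $ i) = 0"
  shows "lam 2 * (x \<bullet> x) \<le> x \<bullet> ((D ** transpose D) *v x)"
proof (cases "x = 0")
  case False
  let ?L = "D ** transpose D" and ?S = "{x :: real^'n. (\<Sum>i\<in>UNIV. x $ i) = 0}"
  note ev = is_eigenvalue_iff_eigenvalues_increasing[OF lam]
  have L1: "?L *v vec 1 = 0" by (simp add: vec_eq_iff laplacian_mult[OF g D])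
  have inv: "(- ?L) *v x \<in> ?S" for x
  proof -
    have "(\<Sum>i\<in>UNIV. (?L *v x) $ i) = vec 1 \<bullet> (?L *v x)" by (simp add: inner_vec_def)
    also have "\<dots> = 0" using symmetric_inner[OF transpose_gram, of "vec 1" D x] L1 by simp
    finally show ?thesis
      by (simp add: matrix_vector_mult_def sum_negf)
  qed
  have "subspace ?S"
    by (auto simp: subspace_def sum.distrib sum_distrib_left[symmetric])
  moreover have "transpose (- ?L) = - ?L"
    using transpose_gram[of D] by (simp add: transpose_def vec_eq_iff)
  ultimately obtain c v where v: "v \<in> ?S" "v \<noteq> 0" "(- ?L) *v v = c *\<^sub>R v"
    and le: "\<And>x. x \<in> ?S \<Longrightarrow> x \<bullet> ((- ?L) *v x) \<le> c * (x \<bullet> x)"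
    using x False inv by (metis (mono_tags, lifting) symmetric_extremal_eigenvector[of "- ?L" ?S x] mem_Collect_eq)
  have neg: "(- ?L) *v w = - (?L *v w)" for w
    by (simp add: matrix_vector_mult_def vec_eq_iff sum_negf)
  have Lv: "?L *v v = (- c) *\<^sub>R v" using v(3) unfolding neg by (metis minus_equation_iff scaleR_minus_left)
  have "is_eigenvalue ?L (- c)" unfolding is_eigenvalue_def scalar_mult_eq_scaleR using Lv v(2) by blast
  then obtain k where k: "k \<in> {1..CARD('n)}" "- c = lam k" using ev by blast
  \<comment> \<open>A kernel vector is constant by connectedness, and a constant vector with zero
    sum vanishes.\<close>
  have nz: "lam k \<noteq> 0"
  proof
    assume "lam k = 0"
    hence "transpose D *v v = 0" using inner_gram[of v D] Lv k by simp
    hence const: "v $ i = v $ undefined" for i by (rule laplacian_kernel[OF D conn])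
    have "real CARD('n) * v $ undefined = (\<Sum>i\<in>(UNIV :: 'n set). v $ undefined)" by simp
    also have "\<dots> = (\<Sum>i\<in>UNIV. v $ i)" by (intro sum.cong refl const[symmetric])
    finally have "v $ undefined = 0" using v(1) by simp
    hence "v $ i = 0" for i using const[of i] by simp
    thus False using v(2) by (simp add: vec_eq_iff)
  qed
  have "is_eigenvalue ?L 0"
    unfolding is_eigenvalue_def using L1 by (intro exI[of _ "vec 1"]) (simp add: vec_eq_iff)
  then obtain m where m: "m \<in> {1..CARD('n)}" "lam m = 0" using ev by force
  have mono: "mono_on {1..CARD('n)} lam" using lam by (simp add: eigenvalues_increasing_def)
  \<comment> \<open>Since 0 is an eigenvalue, \<open>lam 1 \<le> 0\<close>; semidefiniteness gives
    \<open>lam k \<ge> 0\<close>. So \<open>k = 1\<close> would force \<open>lam k = 0\<close>,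
    which was just excluded.\<close>
  have k2: "2 \<le> k"
  proof (rule ccontr)
    assume "\<not> 2 \<le> k"
    hence k1: "k = 1" using k by simp
    have "lam 1 \<le> 0" using mono_onD[OF mono, of 1 m] m by simp
    moreover have "0 \<le> lam k * (v \<bullet> v)"
      using inner_gram[of v D] Lv k by (metis inner_scaleR_right zero_le_power2)
    hence "0 \<le> lam k" using v(2) by (metis inner_gt_zero_iff mult_neg_pos not_le)
    ultimately show False using nz k1 by simp
  qed
  hence "lam 2 \<le> - c" using mono_onD[OF mono, of 2 k] k by simp
  hence "lam 2 * (x \<bullet> x) \<le> - c * (x \<bullet> x)" by (rule mult_right_mono) simp
  also have "\<dots> \<le> x \<bullet> (?L *v x)" using le[of x] x unfolding neg by simp
  finally show ?thesis .
qed simp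

text \<open>Factoring the inner matrix decouples the block form into one scalar Laplacian form per
  coordinate \<open>p\<close>. The scalar spectral bounds then transfer to stacked vectors.\<close>

lemma block_quadratic_form:
  fixes R :: "real^'d^'m" and L :: "real^'n^'n" and f :: "'n \<Rightarrow> real^'d"
  shows "(\<Sum>i\<in>UNIV. f i \<bullet> (\<Sum>j\<in>UNIV. L $ i $ j *\<^sub>R ((transpose R ** R) *v f j)))
    = (\<Sum>p\<in>UNIV. (\<chi> i. (R *v f i) $ p) \<bullet> (L *v (\<chi> i. (R *v f i) $ p)))"
proof -
  have "f i \<bullet> ((transpose R ** R) *v f j) = (R *v f i) \<bullet> (R *v f j)" for i j
    using inner_matrix_transpose[of "f i" "transpose R" "R *v f j"]
    by (simp add: matrix_vector_mul_assoc[symmetric] transpose_transpose)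
  hence "(\<Sum>i\<in>UNIV. f i \<bullet> (\<Sum>j\<in>UNIV. L $ i $ j *\<^sub>R ((transpose R ** R) *v f j)))
      = (\<Sum>i\<in>UNIV. \<Sum>j\<in>UNIV. L $ i $ j * (\<Sum>p\<in>UNIV. (R *v f i) $ p * (R *v f j) $ p))"
    by (simp add: inner_sum_right inner_vec_def[of "R *v _"])
  also have "\<dots> = (\<Sum>i\<in>UNIV. \<Sum>j\<in>UNIV. \<Sum>p\<in>UNIV. (R *v f i) $ p * (L $ i $ j * (R *v f j) $ p))"
    by (simp add: sum_distrib_left mult.left_commute)
  also have "\<dots> = (\<Sum>i\<in>UNIV. \<Sum>p\<in>UNIV. \<Sum>j\<in>UNIV. (R *v f i) $ p * (L $ i $ j * (R *v f j) $ p))"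
    by (intro sum.cong refl sum.swap)
  also have "\<dots> = (\<Sum>p\<in>UNIV. \<Sum>i\<in>UNIV. \<Sum>j\<in>UNIV. (R *v f i) $ p * (L $ i $ j * (R *v f j) $ p))"
    by (rule sum.swap)
  finally show ?thesis by (simp add: inner_vec_def matrix_vector_mult_def[of L] sum_distrib_left)
qed

lemma sum_component_inner:
  fixes g :: "'n::finite \<Rightarrow> real^'m"
  shows "(\<Sum>p\<in>UNIV. (\<chi> i. g i $ p) \<bullet> (\<chi> i. g i $ p)) = (\<Sum>i\<in>UNIV. (norm (g i))\<^sup>2)"
proof -
  have "(\<Sum>p\<in>UNIV. (\<chi> i. g i $ p) \<bullet> (\<chi> i. g i $ p)) = (\<Sum>p\<in>UNIV. \<Sum>i\<in>UNIV. g i $ p * g i $ p)"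
    by (simp add: inner_vec_def)
  also have "\<dots> = (\<Sum>i\<in>UNIV. \<Sum>p\<in>UNIV. g i $ p * g i $ p)" by (rule sum.swap)
  finally show ?thesis by (simp add: inner_vec_def power2_norm_eq_inner)
qed

lemma laplacian_block_inner_le:
  fixes D :: "real^'e^'n" and R :: "real^'d^'m" and f :: "'n \<Rightarrow> real^'d"
  assumes lam: "eigenvalues_increasing (D ** transpose D) lam"
    and R: "\<And>v. norm (R *v v) \<le> s * norm v"
  shows "(\<Sum>i\<in>UNIV. f i \<bullet> (\<Sum>j\<in>UNIV. (D ** transpose D) $ i $ j *\<^sub>R ((transpose R ** R) *v f j)))
    \<le> lam CARD('n) * s\<^sup>2 * (\<Sum>i\<in>UNIV. (norm (f i))\<^sup>2)" (is "?lhs \<le> _")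
proof -
  have "?lhs \<le> (\<Sum>p\<in>UNIV. lam CARD('n) * ((\<chi> i. (R *v f i) $ p) \<bullet> (\<chi> i. (R *v f i) $ p)))"
    unfolding block_quadratic_form by (intro sum_mono laplacian_inner_le[OF lam])
  also have "\<dots> = lam CARD('n) * (\<Sum>i\<in>UNIV. (norm (R *v f i))\<^sup>2)"
    by (simp only: sum_distrib_left[symmetric] sum_component_inner)
  also have "\<dots> \<le> lam CARD('n) * (\<Sum>i\<in>UNIV. (s * norm (f i))\<^sup>2)"
    using R by (intro mult_left_mono laplacian_lam_nonneg[OF lam] sum_mono power_mono) auto
  finally show ?thesis by (simp add: power_mult_distrib sum_distrib_left mult.assoc)
qed

lemma laplacian_block_inner_ge:
  fixes D :: "real^'e^'n" and R :: "real^'d^'m" and f :: "'n \<Rightarrow> real^'d"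
  assumes g: "simple_graph adj" and conn: "connected_graph adj" and D: "incidence_matrix adj D"
    and lam: "eigenvalues_increasing (D ** transpose D) lam" and pos: "0 < lam 2"
    and f: "(\<Sum>i\<in>UNIV. f i) = 0"
  shows "lam 2 * (\<Sum>i\<in>UNIV. (norm (R *v f i))\<^sup>2)
    \<le> (\<Sum>i\<in>UNIV. f i \<bullet> (\<Sum>j\<in>UNIV. (D ** transpose D) $ i $ j *\<^sub>R ((transpose R ** R) *v f j)))"
proof -
  have "(\<Sum>i\<in>UNIV. R *v f i) = 0"
    using f by (metis matrix_vector_mult_0_right vec.sum)
  hence "(\<Sum>i\<in>UNIV. (R *v f i) $ p) = 0" for p by (metis sum_component zero_index)
  hence "(\<Sum>p\<in>UNIV. lam 2 * ((\<chi> i. (R *v f i) $ p) \<bullet> (\<chi> i. (R *v f i) $ p)))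
      \<le> (\<Sum>p\<in>UNIV. (\<chi> i. (R *v f i) $ p) \<bullet> ((D ** transpose D) *v (\<chi> i. (R *v f i) $ p)))"
    by (intro sum_mono laplacian_inner_ge[OF g conn D lam pos]) simp
  thus ?thesis
    by (simp only: block_quadratic_form sum_distrib_left[symmetric] sum_component_inner)
qed

lemma laplacian_block_norm_le:
  fixes D :: "real^'e^'n" and M :: "real^'d^'k" and f :: "'n \<Rightarrow> real^'d"
  assumes lam: "eigenvalues_increasing (D ** transpose D) lam"
    and M: "\<And>v. norm (M *v v) \<le> s * norm v"
  shows "(\<Sum>i\<in>UNIV. (norm (\<Sum>j\<in>UNIV. (D ** transpose D) $ i $ j *\<^sub>R (M *v f j)))\<^sup>2)
    \<le> (lam CARD('n))\<^sup>2 * s\<^sup>2 * (\<Sum>i\<in>UNIV. (norm (f i))\<^sup>2)" (is "?lhs \<le> _")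
proof -
  let ?L = "D ** transpose D" and ?y = "\<lambda>p. \<chi> i. (M *v f i) $ p"
  have "?lhs = (\<Sum>p\<in>UNIV. (?L *v ?y p) \<bullet> (?L *v ?y p))"
    unfolding sum_component_inner[symmetric] matrix_vector_mult_def[of ?L] by simp
  also have "\<dots> \<le> (\<Sum>p\<in>UNIV. (lam CARD('n))\<^sup>2 * (?y p \<bullet> ?y p))"
    using laplacian_norm_le[OF lam]
    by (intro sum_mono) (simp add: dot_square_norm power_mult_distrib[symmetric] power_mono)
  also have "\<dots> = (lam CARD('n))\<^sup>2 * (\<Sum>i\<in>UNIV. (norm (M *v f i))\<^sup>2)"
    by (simp only: sum_distrib_left[symmetric] sum_component_inner)
  also have "\<dots> \<le> (lam CARD('n))\<^sup>2 * (\<Sum>i\<in>UNIV. (s * norm (f i))\<^sup>2)"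
    using M by (intro mult_left_mono sum_mono power_mono) auto
  finally show ?thesis by (simp add: power_mult_distrib sum_distrib_left mult.assoc)
qed

section \<open>Inequalities and sampled signals\<close>

lemma mat_vector_mult: "mat c *v v = c *\<^sub>R (v :: real^'n)"
  by (simp add: vec_eq_iff mat_def matrix_vector_mult_def if_distrib[where f="\<lambda>x. x * v $ _"] cong: if_cong)

lemma young_inequality:
  fixes a b e :: real
  assumes "e > 0"
  shows "2 * (a * b) \<le> a\<^sup>2 / e + e * b\<^sup>2"
proof -
  have "0 \<le> (a - e * b)\<^sup>2 / e" using assms by simp
  also have "\<dots> = a\<^sup>2 / e + e * b\<^sup>2 - 2 * (a * b)"
    using assms by (simp add: power2_diff power_mult_distrib field_simps power2_eq_square)
  finally show ?thesis by simp
qed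

lemma weighted_square_add_le:
  fixes a b e :: real
  assumes "e > 0"
  shows "(a + b)\<^sup>2 \<le> (1 + 1 / e) * a\<^sup>2 + (1 + e) * b\<^sup>2"
  using young_inequality[OF assms, of a b] by (simp add: power2_sum algebra_simps)

text \<open>Cauchy-Schwarz against the constant 1, obtained by integrating the squared deviation of
  \<open>f\<close> from its mean \<open>c\<close>.\<close>

lemma square_integral_le:
  fixes f :: "real \<Rightarrow> real"
  assumes ab: "a < b" and f: "f integrable_on {a..b}" and f2: "(\<lambda>s. (f s)\<^sup>2) integrable_on {a..b}"
  shows "(integral {a..b} f)\<^sup>2 \<le> (b - a) * integral {a..b} (\<lambda>s. (f s)\<^sup>2)"
proof -
  define I J c where "I = integral {a..b} f" and "J = integral {a..b} (\<lambda>s. (f s)\<^sup>2)" and "c = I / (b - a)"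
  have "((\<lambda>s. (f s)\<^sup>2 - 2 * c * f s + c\<^sup>2) has_integral (J - 2 * c * I + (b - a) * c\<^sup>2)) {a..b}"
    using has_integral_add[OF has_integral_diff[OF integrable_integral[OF f2]
        has_integral_mult_right[OF integrable_integral[OF f], of "2 * c"]] has_integral_const_real[of "c\<^sup>2" a b]] ab
    by (simp add: I_def J_def)
  moreover have "0 \<le> (f s)\<^sup>2 - 2 * c * f s + c\<^sup>2" for s
    using zero_le_power2[of "f s - c"] by (simp add: power2_diff mult.commute mult.left_commute)
  ultimately have "0 \<le> J - 2 * c * I + (b - a) * c\<^sup>2" by (rule has_integral_nonneg) 
  also have "\<dots> = J - I\<^sup>2 / (b - a)" proof -
    have "(b - a) * c\<^sup>2 = c * I" "c * I = I\<^sup>2 / (b - a)" using ab by (simp_all add: c_def power2_eq_square)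
    thus ?thesis by simp
  qed
  finally show ?thesis using ab by (simp add: field_simps I_def J_def)
qed

lemma integrable_bounded_borel:
  fixes f :: "real \<Rightarrow> real"
  assumes "f \<in> borel_measurable borel" "\<And>s. s \<in> {a..b} \<Longrightarrow> \<bar>f s\<bar> \<le> C"
  shows "f integrable_on {a..b}"
proof (rule measurable_bounded_by_integrable_imp_integrable_real)
  show "f \<in> borel_measurable (lebesgue_on {a..b})"
    using assms(1) by (intro measurable_restrict_space1) (simp add: measurable_completion)
qed (use assms(2) in \<open>auto intro: integrable_const_ivl\<close>)

text \<open>Put \<open>x = l T\<close>. From \<open>x e\<^sup>x < 1\<close> follows \<open>x < 3/5\<close>, and there \<open>e\<^bsup>2x\<^esup> \<le> 1 + 4x\<close> by convexity.\<close>

lemma exp_step_bound: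
  fixes l T :: real
  assumes l: "0 \<le> l" and T: "0 < T" and le: "l * T * exp (l * T) < 1"
  shows "(if l = 0 then T else (exp (2 * l * T) - 1) / (2 * l)) \<le> 2 * T"
proof (cases "l = 0")
  case False
  define x where "x = l * T"
  have x0: "0 < x" using l T False by (simp add: x_def)
  have expl: "1 + y + y\<^sup>2 / 2 \<le> exp y" if "0 \<le> y" for y :: real
    using exp_lower_Taylor_quadratic[OF that] .
  have x1: "x < 3 / 5"
  proof (rule ccontr)
    assume "\<not> x < 3 / 5"
    hence ge: "3 / 5 \<le> x" by simp
    have "1 \<le> 3 / 5 * (1 + 3 / 5 + (3 / 5)\<^sup>2 / 2 :: real)" by (simp add: power2_eq_square)
    also have "\<dots> \<le> 3 / 5 * exp (3 / 5)" using expl[of "3 / 5"] by simp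
    also have "\<dots> \<le> x * exp x" using ge by (intro mult_mono) auto
    finally show False using le by (simp add: x_def)
  qed
  have conv: "exp (2 * x) \<le> 1 + 4 * x"
  proof -
    have e: "exp (6 / 5 :: real) \<le> 17 / 5"
    proof -
      \<comment> \<open>The bound \<open>1 + y \<le> exp y\<close> at \<open>y = - 3/100\<close>,
        raised to the 40th power, is just sharp enough.\<close>
      have "5 / 17 \<le> (1 + - (3 / 100) :: real) ^ 40" by (simp add: power_divide)
      also have "\<dots> \<le> exp (- (3 / 100)) ^ 40"
        by (intro power_mono exp_ge_add_one_self) simp
      also have "\<dots> = exp (- (6 / 5))" by (simp add: exp_of_nat_mult[symmetric])
      finally have "exp (- (6 / 5) :: real) \<ge> 5 / 17" .
      thus ?thesis by (simp add: exp_minus field_simps)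
    qed
    \<comment> \<open>The chord of \<open>exp\<close> from 0 to 6/5: with 17/5 as upper bound at the
      right end its slope is 2, which gives \<open>1 + 4 * x\<close> at
      \<open>2 * x\<close>.\<close>
    have "exp ((1 - x / (3/5)) *\<^sub>R 0 + (x / (3/5)) *\<^sub>R (6 / 5)) \<le> (1 - x / (3/5)) * exp 0 + (x / (3/5)) * exp (6 / 5 :: real)"
      by (rule convex_onD[OF exp_convex]) (use x0 x1 in auto)
    also have "\<dots> \<le> (1 - x / (3/5)) * exp 0 + (x / (3/5)) * (17 / 5)"
      using e x0 by (intro add_left_mono mult_left_mono) auto
    finally show ?thesis by (simp add: field_simps)
  qed
  have "(exp (2 * x) - 1) / (2 * l) \<le> 4 * x / (2 * l)"
    using conv l False by (intro divide_right_mono) auto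
  also have "\<dots> = 2 * T" using False by (simp add: x_def)
  finally show ?thesis using False by (simp add: x_def mult.assoc)
qed (use T in simp)

text \<open>Instantiated by the update times of a single agent. Unboundedness excludes accumulation,
  so every instant from \<open>T 0\<close> on has a unique index.\<close>

locale sampling_times =
  fixes T :: "nat \<Rightarrow> real"
  assumes strict_mono: "strict_mono T" and unbounded: "\<And>b. \<exists>k. b < T k"
begin

lemma index_unique: "T k \<le> t \<Longrightarrow> t < T (Suc k) \<Longrightarrow> T l \<le> t \<Longrightarrow> t < T (Suc l) \<Longrightarrow> k = l"
  using strict_mono by (meson less_le_trans linorder_neqE_nat not_less_eq order_le_less_trans strict_mono_less)

lemma hold_eq: "T k \<le> t \<Longrightarrow> t < T (Suc k) \<Longrightarrow> hold T y t = y k"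
  unfolding hold_def using index_unique by (intro arg_cong[where f=y] the_equality) blast+

lemma index_exists:
  assumes "T 0 \<le> t"
  obtains k where "T k \<le> t" "t < T (Suc k)"
proof -
  obtain m where m: "t < T m" using unbounded by blast
  define k where "k = (LEAST k. t < T k)"
  have k: "t < T k" unfolding k_def using m by (rule LeastI)
  have "k \<noteq> 0" using k assms by (metis not_le)
  then obtain j where j: "k = Suc j" using not0_implies_Suc by blast
  hence "\<not> t < T j" using not_less_Least[of j "\<lambda>k. t < T k"] by (simp add: k_def)
  thus ?thesis using that[of j] k j by simp
qed

lemma finite_times: "finite (range T \<inter> {..b})"
proof -
  obtain m where "b < T m" using unbounded by blast
  hence "range T \<inter> {..b} \<subseteq> T ` {..m}"
    using strict_mono by (auto simp: strict_mono_less) (metis atMost_iff image_eqI less_le_trans linear not_le strict_mono_less_eq)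
  thus ?thesis using finite_surj by blast
qed

lemma hold_bounded:
  fixes y :: "nat \<Rightarrow> 'v::real_normed_vector"
  obtains C where "\<And>t. T 0 \<le> t \<Longrightarrow> t \<le> b \<Longrightarrow> norm (hold T y t) \<le> C"
proof -
  obtain m where m: "b < T m" using unbounded by blast
  have "norm (hold T y t) \<le> (\<Sum>k\<le>m. norm (y k))" if t: "T 0 \<le> t" "t \<le> b" for t
  proof -
    obtain k where k: "T k \<le> t" "t < T (Suc k)" using t(1) by (rule index_exists)
    hence "T k < T m" using m t by simp
    hence "k < m" using strict_mono by (simp add: strict_mono_less)
    thus ?thesis using hold_eq[OF k, of y] by (auto intro: member_le_sum)
  qed
  thus ?thesis using that by blast
qed

text \<open>The active index is a measurable function with countably many values. Together with
  local boundedness this makes the held signals integrable without splitting at the jumps.\<close>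

lemma hold_measurable [measurable]:
  fixes y :: "nat \<Rightarrow> 'v::topological_space"
  shows "hold T y \<in> borel_measurable borel"
proof -
  have "(\<lambda>t. THE k. T k \<le> t \<and> t < T (Suc k)) \<in> measurable borel (count_space UNIV)"
    by (rule measurable_THE[where I = UNIV]) (auto intro: index_unique)
  moreover have "y \<in> measurable (count_space UNIV) borel" by simp
  ultimately have "y \<circ> (\<lambda>t. THE k. T k \<le> t \<and> t < T (Suc k)) \<in> borel_measurable borel"
    by (rule measurable_comp)
  moreover have "hold T y = y \<circ> (\<lambda>t. THE k. T k \<le> t \<and> t < T (Suc k))"
    by (simp add: hold_def fun_eq_iff)
  ultimately show ?thesis by simp
qed

lemma isCont_hold:
  fixes y :: "nat \<Rightarrow> 'v::topological_space"
  assumes "T 0 \<le> t" "t \<notin> range T"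
  shows "isCont (hold T y) t"
proof -
  obtain k where k: "T k \<le> t" "t < T (Suc k)" using assms by (auto elim: index_exists)
  hence "T k < t" using assms(2) by (metis order_le_less rangeI)
  hence "\<forall>\<^sub>F s in nhds t. s \<in> {T k<..<T (Suc k)}" using k by (intro eventually_nhds_in_open) auto
  hence "\<forall>\<^sub>F s in nhds t. hold T y s = y k" by eventually_elim (auto intro: hold_eq)
  thus ?thesis by (subst isCont_cong) auto
qed

end

section \<open>The dissipation inequality\<close>

context
  fixes A :: "real^'d^'d" and B :: "real^'m^'d" and P :: "real^'d^'d"
    and adj :: "'n::finite \<Rightarrow> 'n \<Rightarrow> bool" and D :: "real^'e^'n" and lam :: "nat \<Rightarrow> real"
    and \<mu> lam0 \<eta> \<gamma> :: real
  assumes graph: "simple_graph adj" "connected_graph adj"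
    and D: "incidence_matrix adj D"
    and lam: "eigenvalues_increasing (D ** transpose D) lam"
    and P: "positive_definite P" and lambda: "0 < lam0" "lam0 \<le> lam 2"
    and riccati: "P ** A + transpose A ** P - (2 * lam0) *\<^sub>R (P ** B ** transpose B ** P)
                    = - ((2 * \<mu>) *\<^sub>R mat 1)"
    and eta: "\<eta> > 0" and gamma: "\<gamma> > 0"
begin

text \<open>On a stack of equal vectors the Kronecker term vanishes and only the shift remains, so
  its absolute value is a lower bound for the norm.\<close>

lemma sigma_ge: "2 * (\<mu> - largest_eigenvalue P / (2 * \<eta>)) \<le> sigma D B P \<mu> \<eta>"
proof -
  let ?c = "2 * (\<mu> - largest_eigenvalue P / (2 * \<eta>))"
  let ?M = "kron (D ** transpose D) (P ** B ** transpose B ** P) - mat ?c"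
  obtain v :: "real^'d" where v: "v \<noteq> 0" using nonzero_Basis nonempty_Basis by blast
  let ?u = "stack (\<lambda>_::'n. v)"
  have "(norm ?u)\<^sup>2 > 0" using v by (simp add: norm_stack)
  hence u: "norm ?u > 0" by (metis norm_ge_zero order_le_less zero_less_power2)
  have "kron (D ** transpose D) (P ** B ** transpose B ** P) *v ?u = 0"
    unfolding kron_mult_stack laplacian_sum_const[OF graph(1) D] by (simp add: stack_def vec_eq_iff)
  hence "?M *v ?u = - (?c *\<^sub>R ?u)"
    by (simp only: matrix_vector_mult_diff_rdistrib mat_vector_mult) simp
  hence "\<bar>?c\<bar> * norm ?u \<le> sigma D B P \<mu> \<eta> * norm ?u"
    using norm_le_largest_singular_value[of ?M ?u] by (simp only: sigma_def norm_minus_cancel norm_scaleR)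
  hence "\<bar>?c\<bar> \<le> sigma D B P \<mu> \<eta>" using u by simp
  thus ?thesis by linarith
qed

text \<open>Combines \<open>\<gamma> + 1 / \<gamma> \<ge> 2\<close> with the lower bound on
  \<open>sigma\<close>. The comparison later turns positivity of \<open>Gamma_fun\<close> into a
  smallness condition on the window length.\<close>

lemma common_coeff_ge:
  "\<mu> - largest_eigenvalue P / (2 * \<eta>) - sigma D B P \<mu> \<eta> / (2 * \<gamma>)
     \<le> common_coeff B P D (lam CARD('n)) \<mu> \<gamma> \<eta>"
proof -
  let ?s = "sigma D B P \<mu> \<eta>"
  have s0: "0 \<le> ?s" by (simp add: sigma_def largest_singular_value_nonneg)
  have "2 \<le> 1 / \<gamma> + \<gamma>" using young_inequality[OF gamma, of 1 1] by simp
  hence "?s * 2 \<le> ?s * (1 / \<gamma> + \<gamma>)" using s0 by (rule mult_left_mono)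
  hence "?s \<le> ?s / (2 * \<gamma>) + \<gamma> * ?s / 2" by (simp add: algebra_simps)
  moreover have "0 \<le> lam CARD('n) * (largest_singular_value (P ** B))\<^sup>2"
    using laplacian_lam_nonneg[OF lam] by simp
  ultimately show ?thesis using sigma_ge unfolding common_coeff_def by (simp add: algebra_simps)
qed

text \<open>A purely algebraic estimate at one instant: \<open>d\<close> stands for the
  disagreement, \<open>q\<close> for its held value and \<open>w\<close> for the
  disturbance.\<close>

lemma lyapunov_rate:
  fixes d q w :: "'n \<Rightarrow> real^'d"
  assumes d: "(\<Sum>i\<in>UNIV. d i) = 0"
  shows "(\<Sum>i\<in>UNIV. d i \<bullet> (P *v (A *v d i
              - (\<Sum>j\<in>UNIV. (D ** transpose D) $ i $ j *\<^sub>R ((B ** transpose B ** P) *v q j)) + w i)))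
    \<le> - (\<mu> - largest_eigenvalue P / (2 * \<eta>) - sigma D B P \<mu> \<eta> / (2 * \<gamma>)) * (\<Sum>i\<in>UNIV. (norm (q i))\<^sup>2)
      + common_coeff B P D (lam CARD('n)) \<mu> \<gamma> \<eta> * (\<Sum>i\<in>UNIV. (norm (d i - q i))\<^sup>2)
      + 1 / 2 * largest_eigenvalue P * \<eta> * (\<Sum>i\<in>UNIV. (norm (w i))\<^sup>2)"
proof -
  let ?L = "D ** transpose D" and ?lP = "largest_eigenvalue P" and ?s = "sigma D B P \<mu> \<eta>"
  define c where "c = \<mu> - ?lP / (2 * \<eta>)"
  define R where "R = transpose B ** P"
  define Q where "Q = P ** B ** transpose B ** P"
  define G where "G = kron ?L Q"
  have Psym: "transpose P = P" using P by (simp add: positive_definite_def)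
  have Q: "Q = transpose R ** R"
    by (simp add: Q_def R_def matrix_transpose_mul Psym transpose_transpose matrix_mul_assoc)
  have form: "(\<Sum>i\<in>UNIV. u i \<bullet> (\<Sum>j\<in>UNIV. ?L $ i $ j *\<^sub>R (Q *v v j))) = stack u \<bullet> (G *v stack v)" for u v
    by (simp add: G_def kron_mult_stack inner_stack)
  \<comment> \<open>The quadratic form of the Riccati equation; its two terms in \<open>A\<close>
    agree because \<open>P\<close> is symmetric.\<close>
  have PA: "v \<bullet> (P *v (A *v v)) = lam0 * (norm (R *v v))\<^sup>2 - \<mu> * (norm v)\<^sup>2" for v
  proof -
    have 1: "v \<bullet> ((transpose A ** P) *v v) = v \<bullet> ((P ** A) *v v)"
    proof -
      have "v \<bullet> (transpose A *v (P *v v)) = (A *v v) \<bullet> (P *v v)"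
        using inner_matrix_transpose[of v "transpose A" "P *v v"] unfolding transpose_transpose .
      also have "\<dots> = (P *v (A *v v)) \<bullet> v" by (rule symmetric_inner[OF Psym])
      finally show ?thesis unfolding matrix_vector_mul_assoc by (simp only: inner_commute)
    qed
    have 2: "v \<bullet> (Q *v v) = (norm (R *v v))\<^sup>2"
      using inner_matrix_transpose[of v "transpose R" "R *v v"]
      unfolding Q transpose_transpose by (simp only: matrix_vector_mul_assoc[symmetric] power2_norm_eq_inner)
    have "v \<bullet> ((P ** A + transpose A ** P - (2 * lam0) *\<^sub>R Q) *v v) = v \<bullet> ((- ((2 * \<mu>) *\<^sub>R mat 1)) *v v)"
      using riccati by (simp only: Q_def)
    also have "(- ((2 * \<mu>) *\<^sub>R mat 1)) = (mat (- 2 * \<mu>) :: real^'d^'d)" by (simp add: mat_def vec_eq_iff)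
    finally have "2 * (v \<bullet> ((P ** A) *v v)) - 2 * lam0 * (norm (R *v v))\<^sup>2 = - 2 * \<mu> * (norm v)\<^sup>2"
      by (simp only: mat_vector_mult matrix_vector_mult_diff_rdistrib matrix_vector_mult_add_rdistrib
          scaleR_matrix_vector_assoc[symmetric] inner_diff_right inner_add_right inner_scaleR_right 1 2
          power2_norm_eq_inner)
    thus ?thesis by (simp add: matrix_vector_mul_assoc)
  qed
  \<comment> \<open>Young's inequality in the metric of \<open>P\<close>, from the nonnegative form
    at \<open>v - \<eta> *\<^sub>R u\<close>.\<close>
  have Pw: "v \<bullet> (P *v u) \<le> ?lP / (2 * \<eta>) * (norm v)\<^sup>2 + 1 / 2 * ?lP * \<eta> * (norm u)\<^sup>2" for u v
  proof -
    let ?z = "v - \<eta> *\<^sub>R u"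
    have "0 \<le> ?z \<bullet> (P *v ?z)"
      using P by (cases "?z = 0") (auto simp: positive_definite_def intro: less_imp_le)
    also have "\<dots> = v \<bullet> (P *v v) - 2 * \<eta> * (v \<bullet> (P *v u)) + \<eta>\<^sup>2 * (u \<bullet> (P *v u))"
      using symmetric_inner[OF Psym, of u v]
      by (simp add: matrix_vector_mult_diff_distrib matrix_vector_mult_scaleR inner_diff_left inner_diff_right
          inner_commute power2_eq_square algebra_simps)
    also have "\<dots> \<le> ?lP * (norm v)\<^sup>2 - 2 * \<eta> * (v \<bullet> (P *v u)) + \<eta>\<^sup>2 * (?lP * (norm u)\<^sup>2)"
      using inner_le_largest_eigenvalue[OF Psym, of v]
        mult_left_mono[OF inner_le_largest_eigenvalue[OF Psym, of u], of "\<eta>\<^sup>2"]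
      by (simp add: power2_norm_eq_inner)
    finally have "2 * \<eta> * (v \<bullet> (P *v u)) \<le> ?lP * (norm v)\<^sup>2 + \<eta>\<^sup>2 * (?lP * (norm u)\<^sup>2)" by simp
    thus ?thesis using eta by (simp add: field_simps power2_eq_square)
  qed
  define z p where "z = stack d" and "p = stack q"
  have norms: "(\<Sum>i\<in>UNIV. (norm (d i))\<^sup>2) = (norm z)\<^sup>2" "(\<Sum>i\<in>UNIV. (norm (q i))\<^sup>2) = (norm p)\<^sup>2"
    "(\<Sum>i\<in>UNIV. (norm (d i - q i))\<^sup>2) = (norm (z - p))\<^sup>2"
    by (simp_all add: z_def p_def norm_stack[symmetric] stack_diff)
  \<comment> \<open>The zero-sum hypothesis on \<open>d\<close> enters here, through the second
    Laplacian eigenvalue.\<close>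
  have lower: "lam0 * (\<Sum>i\<in>UNIV. (norm (R *v d i))\<^sup>2) \<le> z \<bullet> (G *v z)"
  proof -
    have "lam0 * (\<Sum>i\<in>UNIV. (norm (R *v d i))\<^sup>2) \<le> lam 2 * (\<Sum>i\<in>UNIV. (norm (R *v d i))\<^sup>2)"
      using lambda by (intro mult_right_mono) (auto intro: sum_nonneg)
    also have "\<dots> \<le> z \<bullet> (G *v z)"
      using laplacian_block_inner_ge[OF graph D lam _ d, of R] lambda form[of d d] unfolding Q z_def by linarith
    finally show ?thesis .
  qed
  have RB: "norm (R *v v) \<le> largest_singular_value (P ** B) * norm v" for v
  proof -
    have "R = transpose (P ** B)" by (simp add: R_def matrix_transpose_mul Psym)
    thus ?thesis using norm_transpose_le[OF norm_le_largest_singular_value] by metis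
  qed
  have upper: "(z - p) \<bullet> (G *v (z - p)) \<le> lam CARD('n) * (largest_singular_value (P ** B))\<^sup>2 * (norm (z - p))\<^sup>2"
    using laplacian_block_inner_le[OF lam RB, of "\<lambda>i. d i - q i"] form[of "\<lambda>i. d i - q i" "\<lambda>i. d i - q i"]
    unfolding Q[symmetric] norms by (simp add: z_def p_def stack_diff)
  have cross: "p \<bullet> ((G - mat (2 * c)) *v (z - p)) \<le> ?s / (2 * \<gamma>) * (norm p)\<^sup>2 + \<gamma> * ?s / 2 * (norm (z - p))\<^sup>2"
  proof -
    have s: "?s = largest_singular_value (G - mat (2 * c))" by (simp add: sigma_def G_def Q_def c_def)
    have "p \<bullet> ((G - mat (2 * c)) *v (z - p)) \<le> norm p * norm ((G - mat (2 * c)) *v (z - p))"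
      by (rule norm_cauchy_schwarz)
    also have "\<dots> \<le> norm p * (?s * norm (z - p))"
      unfolding s by (intro mult_left_mono norm_le_largest_singular_value) simp
    also have "\<dots> = ?s / 2 * (2 * (norm p * norm (z - p)))" by simp
    also have "\<dots> \<le> ?s / 2 * ((norm p)\<^sup>2 / \<gamma> + \<gamma> * (norm (z - p))\<^sup>2)"
      unfolding s by (intro mult_left_mono young_inequality gamma) (simp add: largest_singular_value_nonneg)
    finally show ?thesis by (simp add: algebra_simps)
  qed
  have "(\<Sum>i\<in>UNIV. d i \<bullet> (P *v (A *v d i - (\<Sum>j\<in>UNIV. ?L $ i $ j *\<^sub>R ((B ** transpose B ** P) *v q j)) + w i)))
      = (\<Sum>i\<in>UNIV. d i \<bullet> (P *v (A *v d i))) - (\<Sum>i\<in>UNIV. d i \<bullet> (\<Sum>j\<in>UNIV. ?L $ i $ j *\<^sub>R (Q *v q j)))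
        + (\<Sum>i\<in>UNIV. d i \<bullet> (P *v w i))"
    by (simp add: sum.distrib sum_subtractf matrix_vector_right_distrib matrix_vector_mult_diff_distrib
        inner_add_right inner_diff_right vec.sum matrix_vector_mult_scaleR Q_def matrix_vector_mul_assoc matrix_mul_assoc)
  also have "\<dots> \<le> (z \<bullet> (G *v z) - \<mu> * (norm z)\<^sup>2) - z \<bullet> (G *v p)
       + (?lP / (2 * \<eta>) * (norm z)\<^sup>2 + 1 / 2 * ?lP * \<eta> * (\<Sum>i\<in>UNIV. (norm (w i))\<^sup>2))"
  proof (intro add_mono diff_mono)
    show "(\<Sum>i\<in>UNIV. d i \<bullet> (P *v (A *v d i))) \<le> z \<bullet> (G *v z) - \<mu> * (norm z)\<^sup>2"
      using lower by (simp add: PA sum_subtractf sum_distrib_left[symmetric] norms)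
    show "z \<bullet> (G *v p) \<le> (\<Sum>i\<in>UNIV. d i \<bullet> (\<Sum>j\<in>UNIV. ?L $ i $ j *\<^sub>R (Q *v q j)))"
      unfolding form z_def p_def by simp
    have "(\<Sum>i\<in>UNIV. d i \<bullet> (P *v w i))
        \<le> (\<Sum>i\<in>UNIV. ?lP / (2 * \<eta>) * (norm (d i))\<^sup>2 + 1 / 2 * ?lP * \<eta> * (norm (w i))\<^sup>2)"
      by (rule sum_mono) (rule Pw)
    thus "(\<Sum>i\<in>UNIV. d i \<bullet> (P *v w i)) \<le> ?lP / (2 * \<eta>) * (norm z)\<^sup>2 + 1 / 2 * ?lP * \<eta> * (\<Sum>i\<in>UNIV. (norm (w i))\<^sup>2)"
      unfolding norms[symmetric] sum_distrib_left sum.distrib .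
  qed
  \<comment> \<open>Expanding \<open>z\<close> as \<open>p + (z - p)\<close> turns the negative
    square into two squares and a mixed term. The mixed term joins \<open>G\<close>, which explains
    the shift by \<open>mat (2 * c)\<close> in \<open>sigma\<close>.\<close>
  also have "\<dots> = - c * (norm p)\<^sup>2 + p \<bullet> ((G - mat (2 * c)) *v (z - p)) + (z - p) \<bullet> (G *v (z - p)) - c * (norm (z - p))\<^sup>2
      + 1 / 2 * ?lP * \<eta> * (\<Sum>i\<in>UNIV. (norm (w i))\<^sup>2)"
  proof -
    have c: "\<mu> * N - ?lP / (2 * \<eta>) * N = c * N" for N by (simp add: c_def algebra_simps)
    have "(norm z)\<^sup>2 = (norm p)\<^sup>2 + 2 * (p \<bullet> (z - p)) + (norm (z - p))\<^sup>2"
      by (simp add: power2_norm_eq_inner inner_diff_left inner_diff_right inner_commute)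
    hence "c * (norm z)\<^sup>2 = c * (norm p)\<^sup>2 + 2 * c * (p \<bullet> (z - p)) + c * (norm (z - p))\<^sup>2"
      by (simp only: distrib_left mult.assoc mult.left_commute)
    moreover have "z \<bullet> (G *v z) - z \<bullet> (G *v p) = p \<bullet> (G *v (z - p)) + (z - p) \<bullet> (G *v (z - p))"
      by (simp add: matrix_vector_mult_diff_distrib inner_diff_left inner_diff_right)
    moreover have "p \<bullet> ((G - mat (2 * c)) *v (z - p)) = p \<bullet> (G *v (z - p)) - 2 * c * (p \<bullet> (z - p))"
      by (simp add: matrix_vector_mult_diff_rdistrib mat_vector_mult inner_diff_right)
    ultimately show ?thesis using c[of "(norm z)\<^sup>2"] by linarith
  qed
  also have "\<dots> \<le> - (c - ?s / (2 * \<gamma>)) * (norm p)\<^sup>2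
      + (\<gamma> * ?s / 2 - c + lam CARD('n) * (largest_singular_value (P ** B))\<^sup>2) * (norm (z - p))\<^sup>2
      + 1 / 2 * ?lP * \<eta> * (\<Sum>i\<in>UNIV. (norm (w i))\<^sup>2)"
    using cross upper by (simp only: minus_diff_eq left_diff_distrib distrib_right)
  also have "\<gamma> * ?s / 2 - c + lam CARD('n) * (largest_singular_value (P ** B))\<^sup>2 = common_coeff B P D (lam CARD('n)) \<mu> \<gamma> \<eta>"
    by (simp add: c_def common_coeff_def)
  finally show ?thesis unfolding norms c_def .
qed

end

section \<open>The closed loop\<close>

lemma weighted_integrable:
  fixes g :: "real \<Rightarrow> real"
  assumes c: "0 \<le> c" and g: "g \<in> borel_measurable borel" "\<And>s. s \<in> {a..b} \<Longrightarrow> \<bar>g s\<bar> \<le> C"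
  shows "(\<lambda>s. exp (c * (b - s)) * g s) integrable_on {a..b}"
proof (rule integrable_bounded_borel)
  show "(\<lambda>s. exp (c * (b - s)) * g s) \<in> borel_measurable borel" using g(1) by measurable
  fix s assume s: "s \<in> {a..b}"
  have "exp (c * (b - s)) \<le> exp (c * (b - a))" using s c by (simp add: mult_left_mono)
  thus "\<bar>exp (c * (b - s)) * g s\<bar> \<le> exp (c * (b - a)) * C"
    using g(2)[OF s] by (simp add: abs_mult mult_mono)
qed

locale sampled_network =
  fixes A :: "real^'d^'d" and B :: "real^'m^'d" and K :: "real^'d^'m" and P :: "real^'d^'d"
    and adj :: "'n::finite \<Rightarrow> 'n \<Rightarrow> bool" and D :: "real^'e^'n" and lam :: "nat \<Rightarrow> real"
    and ts del :: "'n \<Rightarrow> nat \<Rightarrow> real" and err :: "'n \<Rightarrow> nat \<Rightarrow> real^'d"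
    and x :: "'n \<Rightarrow> real \<Rightarrow> real^'d"
    and h \<tau> \<Delta>e \<mu> lam0 :: real
  assumes n: "CARD('n) \<ge> 2"
    and graph: "simple_graph adj" "connected_graph adj"
    and D: "incidence_matrix adj D"
    and lam: "eigenvalues_increasing (D ** transpose D) lam"
    and A: "marginally_stable A"
    and P: "positive_definite P" and K: "K = transpose B ** P"
    and lambda: "0 < lam0" "lam0 \<le> lam 2"
    and riccati: "P ** A + transpose A ** P - (2 * lam0) *\<^sub>R (P ** B ** transpose B ** P)
                    = - ((2 * \<mu>) *\<^sub>R mat 1)"
    and params: "h > 0" "\<tau> \<ge> 0"
    and sampling_start: "\<And>i. 0 \<le> ts i 0"
    and sampling_strict: "\<And>i k. ts i k < ts i (Suc k)"
    and sampling_gap: "\<And>i. \<exists>\<epsilon>>0. \<forall>k. \<epsilon> \<le> ts i (Suc k) - ts i k"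
    and sampling_period: "\<And>i k. ts i (Suc k) - ts i k \<le> h"
    and delay_nonneg: "\<And>i k. 0 \<le> del i k"
    and delay_gap: "\<And>i k. del i k < ts i (Suc k) - ts i k"
    and delay_bound: "\<And>i k. del i k \<le> \<tau>"
    and error_bound: "\<And>t. t \<ge> start_time ts del \<Longrightarrow> norm (held_error ts del err t) \<le> \<Delta>e"
    and trajectory: "closed_loop_trajectory A B adj K ts del err x"
begin

abbreviation "L \<equiv> D ** transpose D"
abbreviation "upd \<equiv> update_time ts del"
abbreviation "t0 \<equiv> start_time ts del"
abbreviation "win \<equiv> h + \<tau>"
abbreviation "l \<equiv> lam_As A"
abbreviation "\<delta> \<equiv> disagreement A x"

definition mean_state :: "real \<Rightarrow> real^'d" where
  "mean_state t = (1 / real CARD('n)) *\<^sub>R (mat_exp (t *\<^sub>R A) *v (\<Sum>j\<in>UNIV. x j 0))"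

definition \<delta>h :: "'n \<Rightarrow> real \<Rightarrow> real^'d" where
  "\<delta>h i = hold (upd i) (\<lambda>k. \<delta> i (ts i k))"

text \<open>What the broadcast state contains besides \<open>\<delta>h\<close>: the held mean minus
  the measurement error.\<close>

definition offset :: "'n \<Rightarrow> real \<Rightarrow> real^'d" where
  "offset i = hold (upd i) (\<lambda>k. mean_state (ts i k) - err i k)"

text \<open>Written with \<open>B ** transpose B ** P\<close> to match the singular value in
  \<open>Gamma_fun\<close>, whereas \<open>disturbance\<close> is written with \<open>B ** K\<close>
  to match \<open>Delta\<close>; the two matrices agree.\<close>

definition coupling :: "'n \<Rightarrow> real \<Rightarrow> real^'d" where
  "coupling i t = (\<Sum>j\<in>UNIV. L $ i $ j *\<^sub>R ((B ** transpose B ** P) *v \<delta>h j t))"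

definition disturbance :: "'n \<Rightarrow> real \<Rightarrow> real^'d" where
  "disturbance i t = - (\<Sum>j\<in>UNIV. L $ i $ j *\<^sub>R ((B ** K) *v offset j t))"

definition held_sq :: "real \<Rightarrow> real" where
  "held_sq t = (\<Sum>i\<in>UNIV. (norm (\<delta>h i t))\<^sup>2)"

lemma \<delta>_mean: "\<delta> i t = x i t - mean_state t"
  by (simp add: disagreement_def mean_state_def)

lemma l_nonneg: "0 \<le> l"
  using A by (rule marginally_stable_lam_As_nonneg)

lemma ts_strict_mono: "strict_mono (ts i)"
  by (simp add: strict_mono_Suc_iff sampling_strict)

lemma ts_nonneg: "0 \<le> ts i k"
  using sampling_start[of i] ts_strict_mono[of i] by (meson le0 order_trans strict_mono_less_eq)

text \<open>A delay shorter than the next sampling gap keeps updates in order, and the uniform gap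
  makes the instants grow at least linearly.\<close>

lemma sampling_times_upd: "sampling_times (upd i)"
proof
  show "strict_mono (upd i)"
    unfolding strict_mono_Suc_iff update_time_def
  proof
    fix k show "ts i k + del i k < ts i (Suc k) + del i (Suc k)"
      using delay_gap[of i k] delay_nonneg[of i "Suc k"] by linarith
  qed
next
  fix b
  obtain \<epsilon> where e: "\<epsilon> > 0" "\<And>k. \<epsilon> \<le> ts i (Suc k) - ts i k" using sampling_gap by blast
  have ge: "real k * \<epsilon> \<le> ts i k" for k
  proof (induction k)
    case (Suc k)
    thus ?case using e(2)[of k] by (simp add: algebra_simps)
  qed (simp add: sampling_start)
  obtain k where "b < real k * \<epsilon>" using reals_Archimedean3[OF e(1)] by blast
  hence "b < upd i k" using ge[of k] delay_nonneg[of i k] by (simp add: update_time_def)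
  thus "\<exists>k. b < upd i k" ..
qed

lemma upd_0_le: "upd i 0 \<le> t0"
  unfolding start_time_def by (intro Max_ge) auto

lemma t0_nonneg: "0 \<le> t0"
proof -
  have "0 \<le> upd undefined 0" by (simp add: update_time_def ts_nonneg delay_nonneg)
  thus ?thesis using upd_0_le order_trans by blast
qed

text \<open>Two age bounds for the sample in use. The bound by \<open>win\<close> controls the
  sampling error; the bound by \<open>2 * h\<close>, which uses that a delay is shorter than the
  next gap, controls the spread of the held means.\<close>

lemma index_obtain:
  assumes "t0 \<le> t"
  obtains k where "\<And>y. hold (upd i) y t = (y k :: 'v)" "ts i k \<le> t" "t - win < ts i k" "t - 2 * h < ts i k"
proof -
  interpret sampling_times "upd i" by (rule sampling_times_upd)
  have "upd i 0 \<le> t" using upd_0_le[of i] assms by linarith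
  then obtain k where k: "upd i k \<le> t" "t < upd i (Suc k)" by (rule index_exists)
  show ?thesis
  proof
    show "hold (upd i) y t = y k" for y :: "nat \<Rightarrow> 'v" using k by (rule hold_eq)
    show "ts i k \<le> t" using k(1) delay_nonneg[of i k] by (simp add: update_time_def)
    show "t - win < ts i k"
      using k(2) delay_bound[of i "Suc k"] sampling_period[of i k] by (simp add: update_time_def)
    show "t - 2 * h < ts i k"
      using k(2) delay_gap[of i "Suc k"] sampling_period[of i k] sampling_period[of i "Suc k"]
      by (simp add: update_time_def)
  qed
qed

definition jumps :: "real set" where "jumps = (\<Union>i. range (upd i))"

lemma finite_jumps: "finite (jumps \<inter> {..b})"
proof -
  have "jumps \<inter> {..b} = (\<Union>i. range (upd i) \<inter> {..b})" by (auto simp: jumps_def)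
  moreover have "finite (\<Union>i. range (upd i) \<inter> {..b})"
    by (intro finite_UN_I finite_class.finite_UNIV sampling_times.finite_times[OF sampling_times_upd])
  ultimately show ?thesis by simp
qed

lemma \<delta>h_measurable [measurable]: "\<delta>h i \<in> borel_measurable borel"
  unfolding \<delta>h_def by (rule sampling_times.hold_measurable[OF sampling_times_upd])

lemma offset_measurable [measurable]: "offset i \<in> borel_measurable borel"
  unfolding offset_def by (rule sampling_times.hold_measurable[OF sampling_times_upd])

lemma matrix_vector_measurable [measurable (raw)]:
  fixes M :: "real^'c^'r"
  assumes "f \<in> borel_measurable N" shows "(\<lambda>t. M *v f t) \<in> borel_measurable N"
proof (rule measurable_compose[OF assms])
  show "(*v) M \<in> borel_measurable borel"
    by (intro borel_measurable_continuous_onI linear_continuous_on matrix_vector_mul_bounded_linear)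
qed

lemma coupling_measurable [measurable]: "coupling i \<in> borel_measurable borel"
  unfolding coupling_def by measurable

lemma disturbance_measurable [measurable]: "disturbance i \<in> borel_measurable borel"
  unfolding disturbance_def by measurable

lemma held_sq_measurable [measurable]: "held_sq \<in> borel_measurable borel"
  unfolding held_sq_def by measurable

lemma held_sq_nonneg: "0 \<le> held_sq t"
  by (simp add: held_sq_def sum_nonneg)

lemma held_disagreement_inner: "held_disagreement A ts del x t \<bullet> held_disagreement A ts del x t = held_sq t"
  unfolding held_disagreement_def inner_stack held_sq_def \<delta>h_def by (simp only: dot_square_norm)

lemma held_sq_bounded: obtains C where "\<And>t. t \<in> {t0..b} \<Longrightarrow> held_sq t \<le> C"
proof -
  have "\<exists>C. \<forall>t. t0 \<le> t \<and> t \<le> b \<longrightarrow> norm (\<delta>h i t) \<le> C" for i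
  proof -
    obtain C where "\<And>t. upd i 0 \<le> t \<Longrightarrow> t \<le> b \<Longrightarrow> norm (\<delta>h i t) \<le> C"
      unfolding \<delta>h_def
      using sampling_times.hold_bounded[OF sampling_times_upd[of i], of b "\<lambda>k. \<delta> i (ts i k)"]
      by metis
    thus ?thesis using upd_0_le[of i] by (meson order_trans)
  qed
  then obtain C where C: "\<And>i t. t0 \<le> t \<Longrightarrow> t \<le> b \<Longrightarrow> norm (\<delta>h i t) \<le> C i" by metis
  have "held_sq t \<le> (\<Sum>i\<in>UNIV. (C i)\<^sup>2)" if "t \<in> {t0..b}" for t
    unfolding held_sq_def using C that by (intro sum_mono power_mono) auto
  thus ?thesis using that by blast
qed

lemma held_sq_integrable: "t0 \<le> a \<Longrightarrow> held_sq integrable_on {a..b}"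
proof -
  assume a: "t0 \<le> a"
  obtain C where "\<And>t. t \<in> {t0..b} \<Longrightarrow> held_sq t \<le> C" using held_sq_bounded by blast
  thus ?thesis using a held_sq_nonneg
    by (intro integrable_bounded_borel[where C = C]) auto
qed

lemma isCont_held_sq: "t0 \<le> t \<Longrightarrow> t \<notin> jumps \<Longrightarrow> isCont held_sq t"
proof -
  assume t: "t0 \<le> t" "t \<notin> jumps"
  have "isCont (\<delta>h i) t" for i
    unfolding \<delta>h_def using t upd_0_le[of i]
    by (intro sampling_times.isCont_hold[OF sampling_times_upd]) (auto simp: jumps_def)
  thus ?thesis unfolding held_sq_def by (intro continuous_intros)
qed

lemma coupling_sq_le:
  "(\<Sum>i\<in>UNIV. (norm (coupling i t))\<^sup>2)
     \<le> (lam CARD('n))\<^sup>2 * (largest_singular_value (B ** transpose B ** P))\<^sup>2 * held_sq t"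
  unfolding coupling_def held_sq_def
  by (rule laplacian_block_norm_le[OF lam norm_le_largest_singular_value])

text \<open>Factor the exponential at time \<open>q\<close> through time \<open>p\<close>: the step
  of length at most \<open>h\<close> gives the quotient, and the part up to \<open>p\<close> gives
  the supremum. Dividing by the root of the number of agents makes the squares over all agents add
  up to that of \<open>Delta_kappa\<close>.\<close>

lemma mean_state_diff_le:
  assumes "0 \<le> p" "p \<le> q" "q \<le> p + h"
  shows "norm (mean_state q - mean_state p) \<le> Delta_kappa A x h / sqrt (real CARD('n))"
proof -
  let ?v = "\<Sum>j\<in>UNIV. x j 0" and ?E = "\<lambda>t. mat_exp (t *\<^sub>R A)" and ?n = "real CARD('n)"
  let ?M = "SUP s\<in>{0..}. onorm ((*v) (mat_exp (s *\<^sub>R A)))"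
  let ?c = "if l = 0 then h else (exp (l * h) - 1) / l"
  have c0: "0 \<le> ?c" using l_nonneg params by simp
  have "?E q *v ?v = ?E (q - p) *v (?E p *v ?v)" using mat_exp_add[of "q - p" p A ?v] assms by simp
  hence "norm (?E q *v ?v - ?E p *v ?v) \<le> largest_singular_value A * norm (?E p *v ?v) * ?c"
    using norm_mat_exp_diff_le[OF l_nonneg, of "q - p" h "?E p *v ?v"] assms by simp
  also have "norm (?E p *v ?v) \<le> onorm ((*v) (?E p)) * norm ?v"
    by (rule onorm) (rule matrix_vector_mul_bounded_linear)
  also have "onorm ((*v) (?E p)) \<le> ?M"
    using assms(1) by (intro cSUP_upper bdd_onorm_mat_exp A) simp
  finally have "norm (?E q *v ?v - ?E p *v ?v) \<le> largest_singular_value A * (?M * norm ?v) * ?c"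
    using c0 by (simp add: mult_left_mono mult_right_mono largest_singular_value_nonneg)
  moreover have "mean_state q - mean_state p = (1 / ?n) *\<^sub>R (?E q *v ?v - ?E p *v ?v)"
    by (simp add: mean_state_def scaleR_diff_right)
  ultimately have "norm (mean_state q - mean_state p) \<le> (1 / ?n) * (largest_singular_value A * (?M * norm ?v) * ?c)"
    by (simp add: divide_right_mono)
  also have "\<dots> = Delta_kappa A x h / sqrt ?n"
    by (simp add: Delta_kappa_def field_simps flip: real_sqrt_mult)
  finally show ?thesis .
qed

text \<open>The deviation of the held means is measured from the mean at the reference time \<open>s = max 0 (t - h)\<close>:
  all samples in use at time \<open>t\<close> were taken during \<open>(t - 2h, t]\<close>, so within \<open>h\<close> of \<open>s\<close>.
  The reference is common to all agents, so the Laplacian annihilates it.\<close>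

lemma disturbance_sq_le:
  assumes t: "t0 \<le> t"
  shows "(\<Sum>i\<in>UNIV. (norm (disturbance i t))\<^sup>2) \<le> (Delta A B K D x \<Delta>e h)\<^sup>2"
proof -
  let ?n = "real CARD('n)" and ?s = "max 0 (t - h)"
  define c where "c j = hold (upd j) (\<lambda>k. mean_state (ts j k)) t - mean_state ?s" for j
  define e where "e j = hold (upd j) (err j) t" for j
  have off: "offset j t = c j - e j + mean_state ?s" and c: "norm (c j) \<le> Delta_kappa A x h / sqrt ?n" for j
  proof -
    obtain k where k: "\<And>y. hold (upd j) y t = (y k :: real^'d)" "ts j k \<le> t" "t - 2 * h < ts j k"
      using index_obtain[OF t] by blast
    show "offset j t = c j - e j + mean_state ?s" by (simp add: offset_def c_def e_def k(1))
    show "norm (c j) \<le> Delta_kappa A x h / sqrt ?n"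
    proof (cases "?s \<le> ts j k")
      case True
      thus ?thesis using mean_state_diff_le[of ?s "ts j k"] k by (simp add: c_def)
    next
      case False
      thus ?thesis using mean_state_diff_le[of "ts j k" ?s] k ts_nonneg[of j k]
        by (simp add: c_def norm_minus_commute)
    qed
  qed
  have "stack (\<lambda>i. disturbance i t) = - (kron L (B ** K) *v (stack c - stack e))"
  proof -
    have "(\<Sum>j\<in>UNIV. L $ i $ j *\<^sub>R ((B ** K) *v offset j t))
        = (\<Sum>j\<in>UNIV. L $ i $ j *\<^sub>R ((B ** K) *v (c j - e j)))" for i
      using laplacian_sum_const[OF graph(1) D, of i "(B ** K) *v mean_state ?s"]
      by (simp add: off matrix_vector_right_distrib scaleR_add_right sum.distrib)
    thus ?thesis by (simp add: disturbance_def stack_diff kron_mult_stack) (simp add: stack_def vec_eq_iff)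
  qed
  hence "norm (stack (\<lambda>i. disturbance i t)) = norm (kron L (B ** K) *v (stack c - stack e))" by simp
  also have "\<dots> \<le> onorm ((*v) (kron L (B ** K))) * norm (stack c - stack e)"
    by (rule onorm) (rule matrix_vector_mul_bounded_linear)
  also have "\<dots> \<le> Delta A B K D x \<Delta>e h"
    unfolding Delta_def
  proof (rule mult_left_mono)
    have "(norm (stack c))\<^sup>2 \<le> (\<Sum>i\<in>(UNIV::'n set). (Delta_kappa A x h / sqrt ?n)\<^sup>2)"
      unfolding norm_stack using c by (intro sum_mono power_mono) auto
    also have "\<dots> = (Delta_kappa A x h)\<^sup>2" by (simp add: power_divide)
    finally have "norm (stack c) \<le> Delta_kappa A x h"
    proof (rule power2_le_imp_le)
      show "0 \<le> Delta_kappa A x h"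
        using order_trans[OF norm_ge_zero c[of undefined]] by (simp add: zero_le_divide_iff)
    qed
    moreover have "norm (stack e) \<le> \<Delta>e"
      using error_bound[OF t] by (simp add: held_error_def e_def[abs_def])
    ultimately show "norm (stack c - stack e) \<le> Delta_kappa A x h + \<Delta>e"
      using norm_triangle_ineq4[of "stack c" "stack e"] by linarith
  qed (rule onorm_pos_le[OF matrix_vector_mul_bounded_linear])
  finally have "(norm (stack (\<lambda>i. disturbance i t)))\<^sup>2 \<le> (Delta A B K D x \<Delta>e h)\<^sup>2"
    by (intro power_mono) auto
  thus ?thesis by (simp only: norm_stack)
qed

lemma continuous_on_x: "continuous_on {0..} (x i)"
  using trajectory by (simp add: closed_loop_trajectory_def)

lemma continuous_on_mean_state: "continuous_on S mean_state"
  unfolding mean_state_def by (intro continuous_intros continuous_on_mat_exp)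

lemma continuous_on_\<delta>: "continuous_on {0..} (\<delta> i)"
  unfolding \<delta>_mean by (intro continuous_intros continuous_on_x continuous_on_mean_state)

lemma mean_state_deriv: "(mean_state has_vector_derivative A *v mean_state t) (at t)"
  unfolding mean_state_def matrix_vector_mult_scaleR
  by (intro bounded_linear.has_vector_derivative[OF bounded_linear_scaleR_right] mat_exp_has_vector_derivative)

lemma x_deriv:
  assumes "0 < t" "t \<notin> jumps"
  shows "(x i has_vector_derivative A *v x i t + B *v control_input adj K ts del err x i t) (at t)"
proof -
  have "(x i has_vector_derivative A *v x i t + B *v control_input adj K ts del err x i t) (at t within {0..})"
  proof -
    have "\<forall>j k. t \<noteq> upd j k" using assms(2) by (auto simp: jumps_def)
    thus ?thesis using trajectory assms(1) by (simp add: closed_loop_trajectory_def)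
  qed
  moreover have "at t within {0..} = at t" using assms by (intro at_within_interior) auto
  ultimately show ?thesis by simp
qed

text \<open>Past \<open>t0\<close> every agent has broadcast, so the zero convention in
  \<open>control_input\<close> is inactive. The mean solves the free equation and drops out.\<close>

lemma \<delta>_deriv:
  assumes "t0 < t" "t \<notin> jumps"
  shows "(\<delta> i has_vector_derivative A *v \<delta> i t - coupling i t + disturbance i t) (at t)"
proof -
  have t: "t0 \<le> t" "0 < t" using assms t0_nonneg by auto
  let ?b = "\<lambda>i. broadcast_state ts del err x i t"
  have b: "?b i = \<delta>h i t + offset i t" for i
  proof -
    obtain k where "\<And>y. hold (upd i) y t = (y k :: real^'d)" using index_obtain[OF t(1)] by blast
    thus ?thesis by (simp add: broadcast_state_def \<delta>h_def offset_def \<delta>_mean)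
  qed
  have "upd j 0 \<le> t" for j using upd_0_le[of j] t by linarith
  hence "control_input adj K ts del err x i t = K *v (- (\<Sum>j | adj i j. ?b i - ?b j))"
    by (simp add: control_input_def sum_negf[symmetric])
  also have "\<dots> = K *v (- (\<Sum>j\<in>UNIV. L $ i $ j *\<^sub>R ?b j))"
    by (simp only: laplacian_sum_scaleR[OF graph(1) D])
  also have "B *v \<dots> = - (\<Sum>j\<in>UNIV. L $ i $ j *\<^sub>R ((B ** K) *v ?b j))"
    by (simp add: vec.neg vec.sum matrix_vector_mult_scaleR matrix_vector_mul_assoc)
  also have "\<dots> = - coupling i t + disturbance i t"
  proof -
    have BK: "B ** transpose B ** P = B ** K" by (simp add: K matrix_mul_assoc)
    show ?thesis
      unfolding b coupling_def disturbance_def BK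
      by (simp add: matrix_vector_right_distrib scaleR_add_right sum.distrib)
  qed
  finally have u: "B *v control_input adj K ts del err x i t = - coupling i t + disturbance i t" .
  show ?thesis
    using has_vector_derivative_diff[OF x_deriv[OF t(2) assms(2), of i] mean_state_deriv[of t]]
    unfolding u \<delta>_mean[abs_def] by (simp add: matrix_vector_mult_diff_distrib algebra_simps)
qed

text \<open>The pairwise terms are antisymmetric. This includes the start-up phase, because the zero
  convention treats \<open>i\<close> and \<open>j\<close> alike.\<close>

lemma sum_control_input: "(\<Sum>i\<in>UNIV. control_input adj K ts del err x i t) = 0"
proof -
  define b where "b i j = (if adj i j then if upd i 0 \<le> t \<and> upd j 0 \<le> t
      then broadcast_state ts del err x j t - broadcast_state ts del err x i t else 0 else 0)" for i j
  have sym: "adj i j = adj j i" for i j using graph(1) by (auto simp: simple_graph_def dest: sympD)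
  have "b i j = - b j i" for i j by (auto simp: b_def sym[of i j])
  hence "(\<Sum>i\<in>UNIV. \<Sum>j\<in>UNIV. b i j) = (\<Sum>i\<in>UNIV. \<Sum>j\<in>UNIV. - b j i)"
    by (intro sum.cong refl) blast
  also have "\<dots> = - (\<Sum>i\<in>UNIV. \<Sum>j\<in>UNIV. b i j)"
    unfolding sum_negf by (subst sum.swap) (rule refl)
  finally have "(\<Sum>i\<in>UNIV. \<Sum>j\<in>UNIV. b i j) = 0"
    by (simp add: eq_neg_iff_add_eq_0 flip: scaleR_2)
  moreover have "control_input adj K ts del err x i t = K *v (\<Sum>j\<in>UNIV. b i j)" for i
    unfolding control_input_def b_def by (simp add: sum.If_cases)
  ultimately show ?thesis by (simp flip: vec.sum)
qed

text \<open>The inputs cancel in the total state, which therefore follows the free response from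
  time 0 by uniqueness.\<close>

lemma sum_\<delta>:
  assumes "0 \<le> t"
  shows "(\<Sum>i\<in>UNIV. \<delta> i t) = 0"
proof -
  let ?v = "\<Sum>j\<in>UNIV. x j 0"
  have "(\<Sum>i\<in>UNIV. x i t) = mat_exp (t *\<^sub>R A) *v ?v"
  proof (rule linear_ode_unique[OF finite_jumps assms])
    show "continuous_on {0..t} (\<lambda>t. \<Sum>i\<in>UNIV. x i t)"
      by (intro continuous_intros continuous_on_subset[OF continuous_on_x]) auto
    fix s assume s: "s \<in> {0<..<t} - jumps \<inter> {..t}"
    have "((\<lambda>s. \<Sum>i\<in>UNIV. x i s) has_vector_derivative
        (\<Sum>i\<in>UNIV. A *v x i s + B *v control_input adj K ts del err x i s)) (at s)"
      using s by (intro has_vector_derivative_sum x_deriv) auto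
    also have "(\<Sum>i\<in>UNIV. A *v x i s + B *v control_input adj K ts del err x i s) = A *v (\<Sum>i\<in>UNIV. x i s)"
      using sum_control_input[of s] by (simp add: sum.distrib flip: vec.sum)
    finally show "((\<lambda>s. \<Sum>i\<in>UNIV. x i s) has_vector_derivative A *v (\<Sum>i\<in>UNIV. x i s)) (at s)" .
  qed (auto simp: mat_exp_0 intro: continuous_on_mat_exp mat_exp_has_vector_derivative)
  thus ?thesis by (simp add: \<delta>_mean mean_state_def sum_subtractf sum_constant_scaleR del: sum_constant)
qed

end

section \<open>The sampling error over one window\<close>

context sampled_network
begin

lemma win_pos: "0 < win"
  using params by simp

lemma coupling_bounded: obtains C where "\<And>i t. t \<in> {t0..b} \<Longrightarrow> norm (coupling i t) \<le> C"
proof -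
  let ?k = "(lam CARD('n))\<^sup>2 * (largest_singular_value (B ** transpose B ** P))\<^sup>2"
  obtain C where C: "\<And>t. t \<in> {t0..b} \<Longrightarrow> held_sq t \<le> C" using held_sq_bounded by blast
  have "norm (coupling i t) \<le> sqrt (?k * C)" if "t \<in> {t0..b}" for i t
  proof (rule real_le_rsqrt)
    have "(norm (coupling i t))\<^sup>2 \<le> (\<Sum>i\<in>UNIV. (norm (coupling i t))\<^sup>2)"
      by (rule member_le_sum[of i UNIV "\<lambda>i. (norm (coupling i t))\<^sup>2"]) auto
    also have "\<dots> \<le> ?k * held_sq t" by (rule coupling_sq_le)
    also have "\<dots> \<le> ?k * C" using C[OF that] by (intro mult_left_mono) auto
    finally show "(norm (coupling i t))\<^sup>2 \<le> ?k * C" .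
  qed
  thus ?thesis using that by blast
qed

lemma disturbance_le: "t0 \<le> t \<Longrightarrow> norm (disturbance i t) \<le> \<bar>Delta A B K D x \<Delta>e h\<bar>"
proof (rule power2_le_imp_le)
  assume t: "t0 \<le> t"
  have "(norm (disturbance i t))\<^sup>2 \<le> (\<Sum>i\<in>UNIV. (norm (disturbance i t))\<^sup>2)"
    by (rule member_le_sum[of i UNIV "\<lambda>i. (norm (disturbance i t))\<^sup>2"]) auto
  also note disturbance_sq_le[OF t]
  finally show "(norm (disturbance i t))\<^sup>2 \<le> \<bar>Delta A B K D x \<Delta>e h\<bar>\<^sup>2" by simp
qed simp

lemma weighted_integrables:
  assumes "t0 \<le> a" "0 \<le> c"
  shows "(\<lambda>s. exp (c * (t - s)) * norm (coupling i s)) integrable_on {a..t}"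
    "(\<lambda>s. exp (c * (t - s)) * norm (disturbance i s)) integrable_on {a..t}"
    "(\<lambda>s. exp (c * (t - s)) * (norm (coupling i s))\<^sup>2) integrable_on {a..t}"
    "(\<lambda>s. exp (c * (t - s)) * (norm (disturbance i s))\<^sup>2) integrable_on {a..t}"
proof -
  obtain C where C: "\<And>i s. s \<in> {t0..t} \<Longrightarrow> norm (coupling i s) \<le> C" using coupling_bounded by blast
  show "(\<lambda>s. exp (c * (t - s)) * norm (coupling i s)) integrable_on {a..t}"
    using assms C by (intro weighted_integrable[where C = C]) auto
  show "(\<lambda>s. exp (c * (t - s)) * norm (disturbance i s)) integrable_on {a..t}"
    using assms disturbance_le
    by (intro weighted_integrable[where C = "\<bar>Delta A B K D x \<Delta>e h\<bar>"]) auto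
  show "(\<lambda>s. exp (c * (t - s)) * (norm (coupling i s))\<^sup>2) integrable_on {a..t}"
    using assms C by (intro weighted_integrable[where C = "C\<^sup>2"]) (auto intro!: power_mono)
  show "(\<lambda>s. exp (c * (t - s)) * (norm (disturbance i s))\<^sup>2) integrable_on {a..t}"
  proof (rule weighted_integrable[OF assms(2), where C = "\<bar>Delta A B K D x \<Delta>e h\<bar>\<^sup>2"])
    fix s assume "s \<in> {a..t}"
    hence "norm (disturbance i s) \<le> \<bar>Delta A B K D x \<Delta>e h\<bar>" using assms(1) by (intro disturbance_le) auto
    thus "\<bar>(norm (disturbance i s))\<^sup>2\<bar> \<le> \<bar>Delta A B K D x \<Delta>e h\<bar>\<^sup>2"
      using power_mono[OF _ norm_ge_zero, of "disturbance i s" "\<bar>Delta A B K D x \<Delta>e h\<bar>" 2] by simp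
  qed measurable
qed

text \<open>The deviation from the sampled value starts at 0 at the sampling instant and is driven
  by the sampled value itself, the coupling and the disturbance. Starting at \<open>t0 + win\<close>
  keeps the whole window in the region where \<open>\<delta>_deriv\<close> holds.\<close>

lemma sampling_error_le:
  assumes t: "t0 + win \<le> t"
  shows "norm (\<delta> i t - \<delta>h i t) \<le> integral {t - win..t} (\<lambda>s. exp (l * (t - s))) * (largest_singular_value A * norm (\<delta>h i t))
    + integral {t - win..t} (\<lambda>s. exp (l * (t - s)) * norm (coupling i s))
    + integral {t - win..t} (\<lambda>s. exp (l * (t - s)) * norm (disturbance i s))"
proof -
  have t0: "t0 \<le> t - win" "t0 \<le> t" using t win_pos by auto
  obtain k where k: "\<And>y. hold (upd i) y t = (y k :: real^'d)" "ts i k \<le> t" "t - win < ts i k"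
    using index_obtain[OF t0(2)] by blast
  let ?a = "ts i k" and ?g = "largest_singular_value A * norm (\<delta>h i t)"
  have dh: "\<delta>h i t = \<delta> i ?a" by (simp add: \<delta>h_def k(1))
  define \<beta> where "\<beta> s = ?g + (norm (coupling i s) + norm (disturbance i s))" for s
  have beta0: "0 \<le> \<beta> s" for s by (simp add: \<beta>_def largest_singular_value_nonneg)
  note exp_int = integrable_integral[OF has_integral_integrable[OF integral_exp_reverse[of "t - win" t l]]]
  note I = weighted_integrables[OF t0(1) l_nonneg, of t i]
  have big: "((\<lambda>s. exp (l * (t - s)) * \<beta> s) has_integral
      integral {t - win..t} (\<lambda>s. exp (l * (t - s))) * ?g
      + (integral {t - win..t} (\<lambda>s. exp (l * (t - s)) * norm (coupling i s))
      + integral {t - win..t} (\<lambda>s. exp (l * (t - s)) * norm (disturbance i s)))) {t - win..t}"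
    unfolding \<beta>_def distrib_left
    using win_pos by (intro has_integral_add has_integral_mult_left exp_int integrable_integral I) auto
  have small: "(\<lambda>s. exp (l * (t - s)) * \<beta> s) integrable_on {?a..t}"
    using k by (intro integrable_on_subinterval[OF has_integral_integrable[OF big]]) auto
  have "norm (\<delta> i t - \<delta> i ?a) \<le> exp (l * (t - ?a)) * norm (\<delta> i ?a - \<delta> i ?a)
           + integral {?a..t} (\<lambda>s. exp (l * (t - s)) * \<beta> s)"
  proof (rule norm_linear_ode_le[OF l_nonneg lam_As_bound finite_jumps[of t] k(2) _ _ _ small,
        where b = "\<lambda>s. A *v \<delta> i ?a + (disturbance i s - coupling i s)"])
    show "continuous_on {?a..t} (\<lambda>s. \<delta> i s - \<delta> i ?a)"
      using ts_nonneg[of i k] by (intro continuous_intros continuous_on_subset[OF continuous_on_\<delta>]) auto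
    fix s assume s: "s \<in> {?a<..<t} - jumps \<inter> {..t}"
    have "t0 < s" "s \<notin> jumps" using s k t0 by auto
    thus "((\<lambda>s. \<delta> i s - \<delta> i ?a) has_vector_derivative
        A *v (\<delta> i s - \<delta> i ?a) + (A *v \<delta> i ?a + (disturbance i s - coupling i s))) (at s)"
      using has_vector_derivative_diff[OF \<delta>_deriv has_vector_derivative_const, of s i "\<delta> i ?a"]
      by (simp add: matrix_vector_mult_diff_distrib algebra_simps)
    have "norm (A *v \<delta> i ?a + (disturbance i s - coupling i s))
        \<le> norm (A *v \<delta> i ?a) + (norm (disturbance i s) + norm (coupling i s))"
      by (meson add_left_mono norm_triangle_ineq norm_triangle_ineq4 order_trans)
    thus "norm (A *v \<delta> i ?a + (disturbance i s - coupling i s)) \<le> \<beta> s"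
      using norm_le_largest_singular_value[of A "\<delta> i ?a"] by (simp add: \<beta>_def dh)
  qed
  \<comment> \<open>The integrand is nonnegative, so the integral may be enlarged to a window that
    is the same for all agents.\<close>
  also have "\<dots> \<le> integral {t - win..t} (\<lambda>s. exp (l * (t - s)) * \<beta> s)"
    using k beta0 by (auto intro!: integral_subset_le small has_integral_integrable[OF big])
  also note integral_unique[OF big]
  finally show ?thesis by (simp add: dh)
qed

lemma exp_integral_le: "integral {t - win..t} (\<lambda>s. exp (l * (t - s))) \<le> win * exp (l * win)"
proof -
  have "integral {t - win..t} (\<lambda>s. exp (l * (t - s))) \<le> integral {t - win..t} (\<lambda>s. exp (l * win))"
  proof (rule integral_le)
    fix s assume "s \<in> {t - win..t}"
    thus "exp (l * (t - s)) \<le> exp (l * win)" using l_nonneg by (auto intro: mult_left_mono)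
  qed (use win_pos in \<open>auto intro!: has_integral_integrable[OF integral_exp_reverse]\<close>)
  thus ?thesis using win_pos by simp
qed

lemma sampling_error_sq_le:
  assumes t: "t0 + win \<le> t" and ab: "0 < \<alpha>" "0 < \<beta>" and small: "l * win * exp (l * win) < 1"
  shows "(\<Sum>i\<in>UNIV. (norm (\<delta> i t - \<delta>h i t))\<^sup>2) \<le>
    (1 + \<alpha>) * ((1 + 1 / \<beta>) * (largest_singular_value A)\<^sup>2 * (win\<^sup>2 * exp (2 * l * win)) * held_sq t
      + (1 + \<beta>) * ((lam CARD('n))\<^sup>2 * (largest_singular_value (B ** transpose B ** P))\<^sup>2)
          * (win * exp (2 * l * win)) * integral {t - win..t} held_sq)
    + (1 + 1 / \<alpha>) * (2 * win\<^sup>2 * (Delta A B K D x \<Delta>e h)\<^sup>2)"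
proof -
  let ?S = "{t - win..t}" and ?\<Delta> = "Delta A B K D x \<Delta>e h"
  let ?k = "(lam CARD('n))\<^sup>2 * (largest_singular_value (B ** transpose B ** P))\<^sup>2"
  have t0: "t0 \<le> t - win" using t by simp
  define I1 where "I1 i = integral ?S (\<lambda>s. exp (l * (t - s))) * (largest_singular_value A * norm (\<delta>h i t))" for i
  define I2 where "I2 i = integral ?S (\<lambda>s. exp (l * (t - s)) * norm (coupling i s))" for i
  define I3 where "I3 i = integral ?S (\<lambda>s. exp (l * (t - s)) * norm (disturbance i s))" for i
  have sq: "(exp (l * (t - s)) * y)\<^sup>2 = exp (2 * l * (t - s)) * y\<^sup>2" for s y :: real
    by (simp add: power_mult_distrib mult.assoc flip: exp_double)
  have l2: "0 \<le> 2 * l" using l_nonneg by simp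
  note W = weighted_integrables[OF t0 l_nonneg, of t] weighted_integrables[OF t0 l2, of t]
  have "(\<Sum>i\<in>UNIV. (I1 i)\<^sup>2) \<le> (\<Sum>i\<in>UNIV. (win * exp (l * win))\<^sup>2 * ((largest_singular_value A)\<^sup>2 * (norm (\<delta>h i t))\<^sup>2))"
    unfolding I1_def power_mult_distrib[of "integral _ _"] power_mult_distrib[of "largest_singular_value A"]
    by (intro sum_mono mult_right_mono power_mono exp_integral_le Henstock_Kurzweil_Integration.integral_nonneg
        has_integral_integrable[OF integral_exp_reverse]) (use win_pos in auto)
  also have "\<dots> = (win * exp (l * win))\<^sup>2 * ((largest_singular_value A)\<^sup>2 * held_sq t)"
    by (simp only: held_sq_def sum_distrib_left)
  also have "(win * exp (l * win))\<^sup>2 = win\<^sup>2 * exp (2 * l * win)"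
    by (simp only: power_mult_distrib mult.assoc exp_double)
  also have "win\<^sup>2 * exp (2 * l * win) * ((largest_singular_value A)\<^sup>2 * held_sq t)
      = (largest_singular_value A)\<^sup>2 * (win\<^sup>2 * exp (2 * l * win)) * held_sq t"
    by (simp only: mult_ac)
  finally have I1: "(\<Sum>i\<in>UNIV. (I1 i)\<^sup>2) \<le> (largest_singular_value A)\<^sup>2 * (win\<^sup>2 * exp (2 * l * win)) * held_sq t" .
  have cs2: "(I2 i)\<^sup>2 \<le> win * integral ?S (\<lambda>s. exp (2 * l * (t - s)) * (norm (coupling i s))\<^sup>2)" for i
    using square_integral_le[of "t - win" t "\<lambda>s. exp (l * (t - s)) * norm (coupling i s)"] W win_pos
    unfolding I2_def sq by simp
  have cs3: "(I3 i)\<^sup>2 \<le> win * integral ?S (\<lambda>s. exp (2 * l * (t - s)) * (norm (disturbance i s))\<^sup>2)" for i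
    using square_integral_le[of "t - win" t "\<lambda>s. exp (l * (t - s)) * norm (disturbance i s)"] W win_pos
    unfolding I3_def sq by simp
  have "(\<Sum>i\<in>UNIV. (I2 i)\<^sup>2) \<le> (\<Sum>i\<in>UNIV. win * integral ?S (\<lambda>s. exp (2 * l * (t - s)) * (norm (coupling i s))\<^sup>2))"
    by (rule sum_mono) (rule cs2)
  also have "\<dots> = win * integral ?S (\<lambda>s. \<Sum>i\<in>UNIV. exp (2 * l * (t - s)) * (norm (coupling i s))\<^sup>2)"
    using W by (subst integral_sum) (auto simp: sum_distrib_left)
  \<comment> \<open>Bounding the exponential by its largest value leaves exactly the integral that
    the Krasovskii term absorbs.\<close>
  also have "\<dots> \<le> win * integral ?S (\<lambda>s. exp (2 * l * win) * ?k * held_sq s)"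
  proof (intro mult_left_mono integral_le integrable_sum W integrable_on_mult_right held_sq_integrable t0)
    fix s assume s: "s \<in> ?S"
    have "exp (2 * l * (t - s)) * (\<Sum>i\<in>UNIV. (norm (coupling i s))\<^sup>2) \<le> exp (2 * l * win) * (?k * held_sq s)"
      using s l2 held_sq_nonneg by (intro mult_mono coupling_sq_le) (auto intro: mult_left_mono sum_nonneg)
    thus "(\<Sum>i\<in>UNIV. exp (2 * l * (t - s)) * (norm (coupling i s))\<^sup>2) \<le> exp (2 * l * win) * ?k * held_sq s"
      by (simp add: sum_distrib_left mult.assoc)
  qed (use win_pos in auto)
  finally have I2: "(\<Sum>i\<in>UNIV. (I2 i)\<^sup>2) \<le> ?k * (win * exp (2 * l * win)) * integral ?S held_sq"
    by (simp add: mult_ac)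
  have "(\<Sum>i\<in>UNIV. (I3 i)\<^sup>2) \<le> (\<Sum>i\<in>UNIV. win * integral ?S (\<lambda>s. exp (2 * l * (t - s)) * (norm (disturbance i s))\<^sup>2))"
    by (rule sum_mono) (rule cs3)
  also have "\<dots> = win * integral ?S (\<lambda>s. \<Sum>i\<in>UNIV. exp (2 * l * (t - s)) * (norm (disturbance i s))\<^sup>2)"
    using W by (subst integral_sum) (auto simp: sum_distrib_left)
  \<comment> \<open>Here the exponential stays under the integral: its mean over the window is
    needed, not its maximum.\<close>
  also have "\<dots> \<le> win * integral ?S (\<lambda>s. exp (2 * l * (t - s)) * ?\<Delta>\<^sup>2)"
  proof (intro mult_left_mono integral_le integrable_sum W integrable_on_mult_left has_integral_integrable[OF integral_exp_reverse])
    fix s assume s: "s \<in> ?S"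
    have "exp (2 * l * (t - s)) * (\<Sum>i\<in>UNIV. (norm (disturbance i s))\<^sup>2) \<le> exp (2 * l * (t - s)) * ?\<Delta>\<^sup>2"
      using s t0 by (intro mult_left_mono disturbance_sq_le) auto
    thus "(\<Sum>i\<in>UNIV. exp (2 * l * (t - s)) * (norm (disturbance i s))\<^sup>2) \<le> exp (2 * l * (t - s)) * ?\<Delta>\<^sup>2"
      by (simp add: sum_distrib_left)
  qed (use win_pos in auto)
  also have "\<dots> = win * (integral ?S (\<lambda>s. exp (2 * l * (t - s))) * ?\<Delta>\<^sup>2)" by simp
  also have "\<dots> \<le> win * (2 * win * ?\<Delta>\<^sup>2)"
  proof (intro mult_left_mono mult_right_mono)
    have "integral ?S (\<lambda>s. exp (2 * l * (t - s))) = (if l = 0 then win else (exp (2 * l * win) - 1) / (2 * l))"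
      using integral_unique[OF integral_exp_reverse[of "t - win" t "2 * l"]] win_pos by simp
    thus "integral ?S (\<lambda>s. exp (2 * l * (t - s))) \<le> 2 * win"
      using exp_step_bound[OF l_nonneg win_pos small] by simp
  qed (use win_pos in auto)
  finally have I3: "(\<Sum>i\<in>UNIV. (I3 i)\<^sup>2) \<le> 2 * win\<^sup>2 * ?\<Delta>\<^sup>2" by (simp add: power2_eq_square mult_ac)
  have "(norm (\<delta> i t - \<delta>h i t))\<^sup>2 \<le> (1 + \<alpha>) * ((1 + 1 / \<beta>) * (I1 i)\<^sup>2 + (1 + \<beta>) * (I2 i)\<^sup>2) + (1 + 1 / \<alpha>) * (I3 i)\<^sup>2" for i
  proof -
    \<comment> \<open>The weight \<open>\<alpha>\<close> separates the disturbance from the rest,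
      and \<open>\<beta>\<close> then splits the rest, matching the coefficients in
      \<open>Delta_bar\<close> and \<open>Gamma_fun\<close>.\<close>
    have "(norm (\<delta> i t - \<delta>h i t))\<^sup>2 \<le> (I3 i + (I1 i + I2 i))\<^sup>2"
      using sampling_error_le[OF t, of i] by (intro power_mono) (auto simp: I1_def I2_def I3_def)
    also have "\<dots> \<le> (1 + 1 / \<alpha>) * (I3 i)\<^sup>2 + (1 + \<alpha>) * (I1 i + I2 i)\<^sup>2"
      by (rule weighted_square_add_le[OF ab(1)])
    also have "\<dots> \<le> (1 + 1 / \<alpha>) * (I3 i)\<^sup>2 + (1 + \<alpha>) * ((1 + 1 / \<beta>) * (I1 i)\<^sup>2 + (1 + \<beta>) * (I2 i)\<^sup>2)"
      using ab by (intro add_left_mono mult_left_mono weighted_square_add_le) auto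
    finally show ?thesis by simp
  qed
  hence "(\<Sum>i\<in>UNIV. (norm (\<delta> i t - \<delta>h i t))\<^sup>2) \<le>
      (\<Sum>i\<in>UNIV. (1 + \<alpha>) * ((1 + 1 / \<beta>) * (I1 i)\<^sup>2 + (1 + \<beta>) * (I2 i)\<^sup>2) + (1 + 1 / \<alpha>) * (I3 i)\<^sup>2)"
    by (rule sum_mono)
  also have "\<dots> = (1 + \<alpha>) * ((1 + 1 / \<beta>) * (\<Sum>i\<in>UNIV. (I1 i)\<^sup>2) + (1 + \<beta>) * (\<Sum>i\<in>UNIV. (I2 i)\<^sup>2))
      + (1 + 1 / \<alpha>) * (\<Sum>i\<in>UNIV. (I3 i)\<^sup>2)"
    by (simp only: sum.distrib sum_distrib_left[symmetric])
  also have "\<dots> \<le> (1 + \<alpha>) * ((1 + 1 / \<beta>) * ((largest_singular_value A)\<^sup>2 * (win\<^sup>2 * exp (2 * l * win)) * held_sq t)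
      + (1 + \<beta>) * (?k * (win * exp (2 * l * win)) * integral ?S held_sq)) + (1 + 1 / \<alpha>) * (2 * win\<^sup>2 * ?\<Delta>\<^sup>2)"
    using ab by (intro add_mono mult_left_mono I1 I2 I3) auto
  finally show ?thesis by (simp only: mult.assoc)
qed

end

lemma largest_eigenvalue_pos:
  assumes "positive_definite P"
  shows "0 < largest_eigenvalue P"
proof -
  obtain v :: "real^'a" where v: "v \<noteq> 0" using nonzero_Basis nonempty_Basis by blast
  have "0 < v \<bullet> (P *v v)" using assms v by (simp add: positive_definite_def)
  also have "\<dots> \<le> largest_eigenvalue P * (v \<bullet> v)"
    using assms by (intro inner_le_largest_eigenvalue) (simp add: positive_definite_def)
  finally show ?thesis using v by (metis inner_gt_zero_iff zero_less_mult_pos2)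
qed

section \<open>The Lyapunov-Krasovskii functional\<close>

context sampled_network
begin

definition lyap :: "real \<Rightarrow> real" where
  "lyap t = 1 / 2 * (\<Sum>i\<in>UNIV. \<delta> i t \<bullet> (P *v \<delta> i t))"

lemma lyap_nonneg: "0 \<le> lyap t"
proof -
  have "0 \<le> v \<bullet> (P *v v)" for v
    using P by (cases "v = 0") (auto simp: positive_definite_def intro: less_imp_le)
  thus ?thesis by (simp add: lyap_def sum_nonneg)
qed

lemma continuous_on_lyap: "continuous_on {0..} lyap"
  unfolding lyap_def
  by (intro continuous_intros continuous_on_\<delta> bounded_linear.continuous_on[OF matrix_vector_mul_bounded_linear])

lemma lyap_deriv:
  assumes "t0 < t" "t \<notin> jumps"
  shows "(lyap has_real_derivative
    (\<Sum>i\<in>UNIV. \<delta> i t \<bullet> (P *v (A *v \<delta> i t - coupling i t + disturbance i t)))) (at t)"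
proof -
  let ?d = "\<lambda>i. A *v \<delta> i t - coupling i t + disturbance i t"
  have sym: "transpose P = P" using P by (simp add: positive_definite_def)
  have "((\<lambda>t. \<delta> i t \<bullet> (P *v \<delta> i t)) has_real_derivative 2 * (\<delta> i t \<bullet> (P *v ?d i))) (at t)" for i
  proof -
    have d: "(\<delta> i has_derivative (\<lambda>h. h *\<^sub>R ?d i)) (at t)"
      using \<delta>_deriv[OF assms] by (simp add: has_vector_derivative_def)
    have "((\<lambda>t. \<delta> i t \<bullet> (P *v \<delta> i t)) has_derivative
        (\<lambda>h. \<delta> i t \<bullet> (P *v (h *\<^sub>R ?d i)) + (h *\<^sub>R ?d i) \<bullet> (P *v \<delta> i t))) (at t)"
      by (rule has_derivative_inner[OF d bounded_linear.has_derivative[OF matrix_vector_mul_bounded_linear d]])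
    moreover have "?d i \<bullet> (P *v \<delta> i t) = \<delta> i t \<bullet> (P *v ?d i)"
      by (metis symmetric_inner[OF sym] inner_commute)
    hence "\<delta> i t \<bullet> (P *v (h *\<^sub>R ?d i)) + (h *\<^sub>R ?d i) \<bullet> (P *v \<delta> i t) = 2 * (\<delta> i t \<bullet> (P *v ?d i)) * h" for h
      by (simp add: matrix_vector_mult_scaleR)
    ultimately show ?thesis by (simp add: has_field_derivative_def)
  qed
  hence "((\<lambda>t. 1 / 2 * (\<Sum>i\<in>UNIV. \<delta> i t \<bullet> (P *v \<delta> i t))) has_real_derivative
      1 / 2 * (\<Sum>i\<in>UNIV. 2 * (\<delta> i t \<bullet> (P *v ?d i)))) (at t)"
    by (intro DERIV_cmult DERIV_sum)
  thus ?thesis by (simp add: lyap_def[abs_def] flip: sum_distrib_left)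
qed

definition held_int :: "real \<Rightarrow> real" where
  "held_int t = integral {t0..t} held_sq"

lemma held_int_diff: "t0 \<le> a \<Longrightarrow> a \<le> b \<Longrightarrow> held_int b - held_int a = integral {a..b} held_sq"
  unfolding held_int_def
  using Henstock_Kurzweil_Integration.integral_combine[OF _ _ held_sq_integrable[OF order_refl], of a b] by simp

lemma held_int_mono: "t0 \<le> a \<Longrightarrow> a \<le> b \<Longrightarrow> held_int a \<le> held_int b"
  using held_int_diff[of a b] Henstock_Kurzweil_Integration.integral_nonneg[OF held_sq_integrable[of a b]]
  by (simp add: held_sq_nonneg)

lemma continuous_on_held_int: "continuous_on {t0..b} held_int"
  unfolding held_int_def by (rule indefinite_integral_continuous_1) (rule held_sq_integrable[OF order_refl])

lemma held_int_deriv: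
  assumes "t0 < t" "t \<notin> jumps"
  shows "(held_int has_real_derivative held_sq t) (at t)"
proof -
  have "((\<lambda>u. integral {t0..u} held_sq) has_vector_derivative held_sq t) (at t within {t0..t+1} - {})"
    using assms
    by (intro integral_has_vector_derivative_continuous_at[OF held_sq_integrable[OF order_refl] _ finite.emptyI]
        continuous_at_imp_continuous_at_within[OF isCont_held_sq]) simp_all
  moreover have "at t within {t0..t+1} = at t" using assms by (intro at_within_interior) auto
  ultimately show ?thesis by (simp add: held_int_def[abs_def] has_real_derivative_iff_has_vector_derivative)
qed

text \<open>The derivative of this term trades the integral of \<open>held_sq\<close> over the last window
  for its current value.\<close>

definition history :: "real \<Rightarrow> real" where
  "history t = win * held_int t - (integral {t0..t} held_int - integral {t0..t - win} held_int)"

text \<open>Once a full window lies past \<open>t0\<close>, \<open>history t\<close> is the integral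
  over that window of \<open>held_int t - held_int s\<close>, and \<open>held_int\<close> is
  increasing.\<close>

lemma history_nonneg:
  assumes "t0 + win \<le> t"
  shows "0 \<le> history t"
proof -
  have int: "held_int integrable_on {a..b}" if "t0 \<le> a" for a b
    using that by (intro integrable_continuous_real continuous_on_subset[OF continuous_on_held_int[of b]]) auto
  have "integral {t0..t} held_int - integral {t0..t - win} held_int = integral {t - win..t} held_int"
    using Henstock_Kurzweil_Integration.integral_combine[OF _ _ int[OF order_refl], of "t - win" t] assms win_pos by simp
  also have "\<dots> \<le> integral {t - win..t} (\<lambda>_. held_int t)"
    using assms by (intro integral_le int held_int_mono) auto
  finally show ?thesis using win_pos by (simp add: history_def)
qed

lemma integral_held_int_deriv:
  assumes "t0 < t"
  shows "((\<lambda>u. integral {t0..u} held_int) has_real_derivative held_int t) (at t)"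
proof -
  have "((\<lambda>u. integral {t0..u} held_int) has_real_derivative held_int t) (at t within {t0..t+1})"
    using assms by (intro integral_has_real_derivative continuous_on_held_int) auto
  moreover have "at t within {t0..t+1} = at t" using assms by (intro at_within_interior) auto
  ultimately show ?thesis by simp
qed

lemma history_deriv:
  assumes "t0 + win < t" "t \<notin> jumps"
  shows "(history has_real_derivative win * held_sq t - integral {t - win..t} held_sq) (at t)"
proof -
  have t: "t0 < t" "t0 < t - win" using assms win_pos by auto
  have "((\<lambda>u. integral {t0..u - win} held_int) has_real_derivative held_int (t - win) * 1) (at t)"
    by (rule DERIV_chain2[where f = "\<lambda>u. integral {t0..u} held_int" and g = "\<lambda>u. u - win",
          OF integral_held_int_deriv[OF t(2)]]) (auto intro!: derivative_eq_intros)
  hence "(history has_real_derivative win * held_sq t - (held_int t - held_int (t - win) * 1)) (at t)"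
    unfolding history_def
    by (intro DERIV_diff DERIV_cmult held_int_deriv integral_held_int_deriv t assms)
  thus ?thesis using held_int_diff[of "t - win" t] t win_pos by simp
qed

lemma continuous_on_history: "t0 + win \<le> a \<Longrightarrow> continuous_on {a..b} history"
proof -
  assume a: "t0 + win \<le> a"
  have c: "continuous_on {t0..c} (\<lambda>u. integral {t0..u} held_int)" for c
    by (intro indefinite_integral_continuous_1 integrable_continuous_real continuous_on_held_int)
  have "continuous_on {a..b} (\<lambda>u. integral {t0..u - win} held_int)"
    by (rule continuous_on_compose2[OF c[of b], of _ "\<lambda>u. u - win"]) (use a win_pos in \<open>auto intro!: continuous_intros\<close>)
  thus ?thesis unfolding history_def using a win_pos
    by (intro continuous_intros continuous_on_subset[OF c[of b]] continuous_on_subset[OF continuous_on_held_int[of b]]) auto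
qed

text \<open>If \<open>held_sq\<close> stayed above \<open>\<rho>\<close> from some time on, the functional
  \<open>lyap + c * history\<close> would decrease at a rate bounded away from 0, although it is nonnegative.\<close>

lemma held_sq_below:
  assumes feas: "(\<alpha>, \<beta>, \<gamma>, \<eta>) \<in> feasible A B P D (lam CARD('n)) \<mu> h \<tau>"
    and \<rho>: "Delta_bar A B K P D (lam CARD('n)) x \<mu> \<Delta>e h \<tau> \<alpha> \<gamma> \<eta>
        < \<rho> * Gamma_fun A B P D (lam CARD('n)) \<mu> h \<tau> \<alpha> \<beta> \<gamma> \<eta>"
  shows "\<exists>t\<ge>t'. t0 \<le> t \<and> held_sq t \<le> \<rho>"
proof (rule ccontr)
  assume "\<not> ?thesis"
  hence above: "\<rho> < held_sq t" if "t' \<le> t" "t0 \<le> t" for t using that by force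
  let ?lP = "largest_eigenvalue P" and ?s = "sigma D B P \<mu> \<eta>"
    and ?\<Gamma> = "Gamma_fun A B P D (lam CARD('n)) \<mu> h \<tau> \<alpha> \<beta> \<gamma> \<eta>"
    and ?\<Delta>b = "Delta_bar A B K P D (lam CARD('n)) x \<mu> \<Delta>e h \<tau> \<alpha> \<gamma> \<eta>"
    and ?\<Delta> = "Delta A B K D x \<Delta>e h"
  define a where "a = common_coeff B P D (lam CARD('n)) \<mu> \<gamma> \<eta>"
  define g where "g = \<mu> - ?lP / (2 * \<eta>) - ?s / (2 * \<gamma>)"
  define X where "X = (largest_singular_value A)\<^sup>2"
  define Y where "Y = (lam CARD('n))\<^sup>2 * (largest_singular_value (B ** transpose B ** P))\<^sup>2"
  define E where "E = exp (2 * l * win)"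
  define M where "M = (SUP s\<in>{0..}. (row_sum_norm (mat_exp (s *\<^sub>R A)))\<^sup>2)"
  have pos: "\<alpha> > 0" "\<beta> > 0" "\<gamma> > 0" "\<eta> > 0" and g: "g > 0" and \<Gamma>: "?\<Gamma> > 0"
    using feas by (auto simp: feasible_def g_def)
  have ga: "g \<le> a" unfolding g_def a_def
    by (rule common_coeff_ge[OF graph D lam P lambda riccati pos(4,3)])
  have a: "a > 0" using ga g by linarith
  have XY: "0 \<le> X" "0 \<le> Y" and E0: "0 < E" by (simp_all add: X_def Y_def E_def)
  have \<Gamma>_eq: "?\<Gamma> = g - a * (1 + \<alpha>) * ((1 + 1 / \<beta>) * X + (1 + \<beta>) * (7 / 3) * Y) * win\<^sup>2 * E"
    by (simp add: Gamma_fun_def g_def a_def X_def Y_def E_def mult.assoc)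
  \<comment> \<open>Keeping only \<open>X\<close> of the bracket in \<open>\<Gamma>_eq\<close> and
    cancelling \<open>a\<close> yields \<open>X * win\<^sup>2 * E < 1\<close>. Since
    \<open>l\<close> is at most the singular value of \<open>A\<close>, the square of the claimed
    quantity is below 1.\<close>
  have small: "l * win * exp (l * win) < 1"
  proof -
    have "a * (X * win\<^sup>2 * E) \<le> a * ((1 + \<alpha>) * ((1 + 1 / \<beta>) * X + (1 + \<beta>) * (7 / 3) * Y) * win\<^sup>2 * E)"
    proof (intro mult_left_mono mult_right_mono)
      have "X \<le> (1 + 1 / \<beta>) * X" using XY pos by (simp add: algebra_simps)
      also have "\<dots> \<le> (1 + 1 / \<beta>) * X + (1 + \<beta>) * (7 / 3) * Y" using XY pos by simp
      also have "\<dots> = 1 * \<dots>" by simp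
      also have "\<dots> \<le> (1 + \<alpha>) * ((1 + 1 / \<beta>) * X + (1 + \<beta>) * (7 / 3) * Y)"
        using XY pos by (intro mult_right_mono) auto
      finally show "X \<le> (1 + \<alpha>) * ((1 + 1 / \<beta>) * X + (1 + \<beta>) * (7 / 3) * Y)" .
    qed (use a E0 in auto)
    also have "\<dots> < a * 1" using \<Gamma> ga unfolding \<Gamma>_eq by (simp add: mult.assoc)
    finally have "X * win\<^sup>2 * E < 1" using a by simp
    moreover have "(l * win * exp (l * win))\<^sup>2 \<le> X * win\<^sup>2 * E"
    proof -
      have "(l * win * exp (l * win))\<^sup>2 = l\<^sup>2 * win\<^sup>2 * E"
        by (simp only: power_mult_distrib E_def mult.assoc exp_double)
      also have "\<dots> \<le> X * win\<^sup>2 * E"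
        unfolding X_def using l_nonneg lam_As_le_largest_singular_value[of A] E0
        by (intro mult_right_mono power_mono) auto
      finally show ?thesis .
    qed
    ultimately have "(l * win * exp (l * win))\<^sup>2 < 1\<^sup>2" by simp
    thus ?thesis by (rule power2_less_imp_less) simp
  qed
  \<comment> \<open>The weight that makes \<open>c * history\<close> cancel the integral term of the
    sampling error.\<close>
  define c where "c = a * (1 + \<alpha>) * (1 + \<beta>) * Y * (win * E)"
  have c0: "0 \<le> c" using a pos XY E0 win_pos by (simp add: c_def)
  define \<kappa> where "\<kappa> = \<rho> * ?\<Gamma> - ?\<Delta>b"
  have \<kappa>: "\<kappa> > 0" using \<rho> by (simp add: \<kappa>_def)
  define U where "U t = lyap t + c * history t" for t
  define U' where "U' t = (\<Sum>i\<in>UNIV. \<delta> i t \<bullet> (P *v (A *v \<delta> i t - coupling i t + disturbance i t)))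
      + c * (win * held_sq t - integral {t - win..t} held_sq)" for t
  have U'_le: "U' t \<le> - \<kappa>" if t: "t0 + win < t" "t' \<le> t" for t
  proof -
    have tt: "t0 \<le> t" "t0 + win \<le> t" "0 \<le> t" using t win_pos t0_nonneg by auto
    let ?I = "integral {t - win..t} held_sq" and ?W = "\<Sum>i\<in>UNIV. (norm (disturbance i t))\<^sup>2"
    have "(\<Sum>i\<in>UNIV. \<delta> i t \<bullet> (P *v (A *v \<delta> i t - coupling i t + disturbance i t)))
        \<le> - g * held_sq t + a * (\<Sum>i\<in>UNIV. (norm (\<delta> i t - \<delta>h i t))\<^sup>2) + 1 / 2 * ?lP * \<eta> * ?W"
      unfolding g_def a_def held_sq_def coupling_def
      by (rule lyapunov_rate[OF graph D lam P lambda riccati pos(4,3) sum_\<delta>[OF tt(3)]])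
    moreover have "a * (\<Sum>i\<in>UNIV. (norm (\<delta> i t - \<delta>h i t))\<^sup>2) \<le>
        a * ((1 + \<alpha>) * ((1 + 1 / \<beta>) * X * (win\<^sup>2 * E) * held_sq t + (1 + \<beta>) * Y * (win * E) * ?I)
          + (1 + 1 / \<alpha>) * (2 * win\<^sup>2 * ?\<Delta>\<^sup>2))"
      unfolding X_def Y_def E_def using a
      by (intro mult_left_mono sampling_error_sq_le tt pos small) auto
    moreover have "1 / 2 * ?lP * \<eta> * ?W \<le> 1 / 2 * ?lP * \<eta> * ?\<Delta>\<^sup>2"
    proof (intro mult_left_mono disturbance_sq_le tt)
      show "0 \<le> 1 / 2 * ?lP * \<eta>" using pos largest_eigenvalue_pos[OF P] by simp
    qed
    moreover have "a * ((1 + 1 / \<alpha>) * (2 * win\<^sup>2 * ?\<Delta>\<^sup>2)) + 1 / 2 * ?lP * \<eta> * ?\<Delta>\<^sup>2 \<le> ?\<Delta>b"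
    proof -
      \<comment> \<open>Pays for the factor 2 in the disturbance part of the sampling error.\<close>
      have "2 \<le> M * real CARD('n)"
        using mult_mono[of 1 M 2 "real CARD('n)"] n row_sum_norm_mat_exp_SUP_ge_1[OF A] by (simp add: M_def)
      hence "a * (1 + 1 / \<alpha>) * (win\<^sup>2 * ?\<Delta>\<^sup>2) * 2 \<le> a * (1 + 1 / \<alpha>) * (win\<^sup>2 * ?\<Delta>\<^sup>2) * (M * real CARD('n))"
        using a pos by (intro mult_left_mono) auto
      thus ?thesis unfolding Delta_bar_def a_def[symmetric] M_def[symmetric] by (simp add: mult_ac)
    qed
    \<comment> \<open>The integrals cancel by the choice of \<open>c\<close>; the Krasovskii term
      returns the coupling as a multiple of the current \<open>held_sq t\<close>, with coefficient 1
      where \<open>Gamma_fun\<close> allows 7/3.\<close>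
    moreover have "a * ((1 + \<alpha>) * ((1 + 1 / \<beta>) * X * (win\<^sup>2 * E) * held_sq t + (1 + \<beta>) * Y * (win * E) * ?I))
        + c * (win * held_sq t - ?I) = a * (1 + \<alpha>) * ((1 + 1 / \<beta>) * X + (1 + \<beta>) * Y) * win\<^sup>2 * E * held_sq t"
      by (simp only: c_def power2_eq_square) algebra
    moreover have "a * (1 + \<alpha>) * ((1 + 1 / \<beta>) * X + (1 + \<beta>) * Y) * win\<^sup>2 * E * held_sq t
        \<le> (g - ?\<Gamma>) * held_sq t"
    proof -
      have "(1 + \<beta>) * Y \<le> (1 + \<beta>) * (7 / 3) * Y" using XY pos by (intro mult_right_mono) auto
      hence "a * (1 + \<alpha>) * ((1 + 1 / \<beta>) * X + (1 + \<beta>) * Y) * win\<^sup>2 * E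
          \<le> a * (1 + \<alpha>) * ((1 + 1 / \<beta>) * X + (1 + \<beta>) * (7 / 3) * Y) * win\<^sup>2 * E"
        using a pos E0
        by (intro mult_right_mono[OF mult_right_mono[OF mult_left_mono[OF add_left_mono]]]) auto
      thus ?thesis unfolding \<Gamma>_eq by (intro mult_right_mono held_sq_nonneg) simp
    qed
    moreover have "(g - ?\<Gamma>) * held_sq t = g * held_sq t - ?\<Gamma> * held_sq t" by (rule left_diff_distrib)
    moreover have "?\<Gamma> * \<rho> \<le> ?\<Gamma> * held_sq t" using above[OF t(2) tt(1)] \<Gamma> by (intro mult_left_mono) auto
    ultimately show ?thesis
      unfolding U'_def \<kappa>_def by (simp only: distrib_left[of a] mult.commute[of \<rho>])
  qed
  define t1 where "t1 = max t' (t0 + win) + 1"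
  \<comment> \<open>Long enough for a decrease at rate \<open>\<kappa>\<close> to bring
    \<open>U\<close> from \<open>U t1\<close> down to \<open>- \<kappa>\<close>.\<close>
  define t2 where "t2 = t1 + U t1 / \<kappa> + 1"
  have U0: "0 \<le> U t" if "t0 + win \<le> t" for t
    using that c0 by (simp add: U_def lyap_nonneg history_nonneg)
  have t1: "t0 + win < t1" "t' \<le> t1" by (auto simp: t1_def)
  have t12: "t1 \<le> t2" using U0[of t1] t1 \<kappa> by (simp add: t2_def)
  have "U t2 - U t1 \<le> integral {t1..t2} (\<lambda>_. - \<kappa>)"
  proof (rule diff_le_integral_except_finite[OF finite_jumps[of t2] t12, where f' = U'])
    show "continuous_on {t1..t2} U"
      unfolding U_def using t1 win_pos t0_nonneg
      by (intro continuous_intros continuous_on_history continuous_on_subset[OF continuous_on_lyap]) auto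
    fix s assume s: "s \<in> {t1<..<t2} - jumps \<inter> {..t2}"
    hence "t0 < s" "t0 + win < s" "t' \<le> s" "s \<notin> jumps" using t1 win_pos by auto
    thus "(U has_real_derivative U' s) (at s)" "U' s \<le> - \<kappa>"
      unfolding U_def U'_def by (auto intro!: DERIV_add DERIV_cmult lyap_deriv history_deriv simp: U'_le[unfolded U'_def])
  qed (rule integrable_const_ivl)
  also have "\<dots> = - (U t1 + \<kappa>)" using t12 \<kappa> by (simp add: t2_def field_simps)
  finally have "U t2 \<le> - \<kappa>" by simp
  thus False using U0[of t2] t1 t12 \<kappa> by simp
qed

end

section \<open>The infimum over feasible parameters\<close>

text \<open>Feasibility forces \<open>\<eta>\<close> to be at least the largest eigenvalue of
  \<open>P\<close> over \<open>2 * \<mu>\<close>, and \<open>Gamma_fun\<close> to be at most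
  \<open>\<mu>\<close>. The resulting bound is the same for all feasible parameters, so the infimum
  is bounded below, and positive unless \<open>Delta\<close> vanishes.\<close>

lemma feasible_Delta_bar_ge:
  fixes D :: "real^'e^'n" and x :: "'n::finite \<Rightarrow> real \<Rightarrow> real^'d"
  assumes P: "positive_definite P" and A: "marginally_stable A" and mu: "\<mu> > 0"
    and feas: "(\<alpha>, \<beta>, \<gamma>, \<eta>) \<in> feasible A B P D lamn \<mu> h \<tau>"
  shows "(largest_eigenvalue P)\<^sup>2 * (Delta A B K D x \<Delta>e h)\<^sup>2 / (4 * \<mu>\<^sup>2)
    \<le> Delta_bar A B K P D lamn x \<mu> \<Delta>e h \<tau> \<alpha> \<gamma> \<eta> / Gamma_fun A B P D lamn \<mu> h \<tau> \<alpha> \<beta> \<gamma> \<eta>"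
proof -
  let ?p = "largest_eigenvalue P" and ?\<Delta> = "Delta A B K D x \<Delta>e h" and ?s = "sigma D B P \<mu> \<eta>"
    and ?\<Gamma> = "Gamma_fun A B P D lamn \<mu> h \<tau> \<alpha> \<beta> \<gamma> \<eta>"
  have pos: "\<alpha> > 0" "\<beta> > 0" "\<gamma> > 0" "\<eta> > 0" and g: "\<mu> - ?p / (2 * \<eta>) - ?s / (2 * \<gamma>) > 0"
    and a: "common_coeff B P D lamn \<mu> \<gamma> \<eta> \<ge> 0" and \<Gamma>: "?\<Gamma> > 0"
    using feas by (auto simp: feasible_def)
  have s: "0 \<le> ?s / (2 * \<gamma>)" using pos by (simp add: sigma_def largest_singular_value_nonneg)
  have p: "0 < ?p" using P by (rule largest_eigenvalue_pos)
  have "?p / (2 * \<eta>) < \<mu>" using g s by linarith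
  hence eta: "?p / (2 * \<mu>) \<le> \<eta>" using pos mu by (simp add: field_simps)
  have "0 \<le> ?p / (2 * \<eta>)" using p pos by simp
  moreover have "0 \<le> common_coeff B P D lamn \<mu> \<gamma> \<eta> * (1 + \<alpha>)
       * ((1 + 1 / \<beta>) * (largest_singular_value A)\<^sup>2
          + (1 + \<beta>) * (7 / 3) * lamn\<^sup>2 * (largest_singular_value (B ** transpose B ** P))\<^sup>2)
       * (h + \<tau>)\<^sup>2 * exp (2 * lam_As A * (h + \<tau>))"
    using a pos by (intro mult_nonneg_nonneg add_nonneg_nonneg) auto
  ultimately have \<Gamma>\<mu>: "?\<Gamma> \<le> \<mu>" using s by (simp add: Gamma_fun_def)
  have "?p\<^sup>2 * ?\<Delta>\<^sup>2 / (4 * \<mu>) = 1 / 2 * ?p * (?p / (2 * \<mu>)) * ?\<Delta>\<^sup>2" by (simp add: power2_eq_square)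
  also have "\<dots> \<le> 1 / 2 * ?p * \<eta> * ?\<Delta>\<^sup>2" using eta p by (intro mult_right_mono mult_left_mono) auto
  also have "\<dots> \<le> Delta_bar A B K P D lamn x \<mu> \<Delta>e h \<tau> \<alpha> \<gamma> \<eta>"
    unfolding Delta_bar_def using a pos row_sum_norm_mat_exp_SUP_ge_1[OF A] by simp
  finally have ge: "?p\<^sup>2 * ?\<Delta>\<^sup>2 / (4 * \<mu>) \<le> Delta_bar A B K P D lamn x \<mu> \<Delta>e h \<tau> \<alpha> \<gamma> \<eta>" .
  have "0 \<le> Delta_bar A B K P D lamn x \<mu> \<Delta>e h \<tau> \<alpha> \<gamma> \<eta>"
    using mu by (intro order_trans[OF _ ge]) simp
  hence "?p\<^sup>2 * ?\<Delta>\<^sup>2 / (4 * \<mu>) / \<mu> \<le> Delta_bar A B K P D lamn x \<mu> \<Delta>e h \<tau> \<alpha> \<gamma> \<eta> / ?\<Gamma>"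
    using ge \<Gamma> \<Gamma>\<mu> by (rule frac_le)
  thus ?thesis by (simp add: power2_eq_square mult.assoc)
qed

text \<open>The case split reflects a degenerate infimum: if \<open>Delta\<close> is 0, so is the
  bound, and the decay argument reaches every level strictly above 0 but not 0 itself. Restricting
  \<open>t\<close> to the start time ensures that all held signals are defined.\<close>

theorem theorem4:
  fixes A :: "real^'d^'d" and B :: "real^'m^'d" and K :: "real^'d^'m" and P :: "real^'d^'d"
    and adj :: "'n::finite \<Rightarrow> 'n \<Rightarrow> bool" and D :: "real^'e^'n" and lam :: "nat \<Rightarrow> real"
    and ts del :: "'n \<Rightarrow> nat \<Rightarrow> real" and err :: "'n \<Rightarrow> nat \<Rightarrow> real^'d"
    and x :: "'n \<Rightarrow> real \<Rightarrow> real^'d"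
    and h \<tau> \<Delta>e \<mu> lam0 :: real
  assumes n: "CARD('n) \<ge> 2"
    and graph: "simple_graph adj" "connected_graph adj"
    and D: "incidence_matrix adj D"
    and lam: "eigenvalues_increasing (D ** transpose D) lam"
    and A: "marginally_stable A" and AB: "stabilizable A B"
    and P: "positive_definite P" and K: "K = transpose B ** P"
    and mu: "\<mu> > 0" and lambda: "0 < lam0" "lam0 \<le> lam 2"
    and riccati: "P ** A + transpose A ** P - (2 * lam0) *\<^sub>R (P ** B ** transpose B ** P)
                    = - ((2 * \<mu>) *\<^sub>R mat 1)"
    and params: "h > 0" "\<tau> \<ge> 0" "\<Delta>e \<ge> 0"
    and sampling_start: "\<And>i. 0 \<le> ts i 0"
    and sampling_strict: "\<And>i k. ts i k < ts i (Suc k)"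
    and sampling_gap: "\<And>i. \<exists>\<epsilon>>0. \<forall>k. \<epsilon> \<le> ts i (Suc k) - ts i k"
    and sampling_period: "\<And>i k. ts i (Suc k) - ts i k \<le> h"
    and delay_nonneg: "\<And>i k. 0 \<le> del i k"
    and delay_gap: "\<And>i k. del i k < ts i (Suc k) - ts i k"
    and delay_bound: "\<And>i k. del i k \<le> \<tau>"
    and error_bound: "\<And>t. t \<ge> start_time ts del \<Longrightarrow> norm (held_error ts del err t) \<le> \<Delta>e"
    and trajectory: "closed_loop_trajectory A B adj K ts del err x"
    and feasible: "feasible A B P D (lam CARD('n)) \<mu> h \<tau> \<noteq> {}"
  shows "\<forall>t' \<theta>. \<theta> > 1 \<longrightarrow>
    (Delta A B K D x \<Delta>e h \<noteq> 0 \<longrightarrow>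
      (\<exists>t\<ge>t'. t \<ge> start_time ts del \<and>
        held_disagreement A ts del x t \<bullet> held_disagreement A ts del x t
          \<le> ultimate_bound A B K P D (lam CARD('n)) x \<mu> \<Delta>e h \<tau> \<theta>)) \<and>
    (Delta A B K D x \<Delta>e h = 0 \<longrightarrow>
      (\<forall>\<epsilon>>0. \<exists>t\<ge>t'. t \<ge> start_time ts del \<and>
        held_disagreement A ts del x t \<bullet> held_disagreement A ts del x t
          \<le> ultimate_bound A B K P D (lam CARD('n)) x \<mu> \<Delta>e h \<tau> \<theta> + \<epsilon>))"
proof (intro allI impI)
  fix t' \<theta> :: real assume \<theta>: "1 < \<theta>"
  let ?\<Delta> = "Delta A B K D x \<Delta>e h" and ?F = "feasible A B P D (lam CARD('n)) \<mu> h \<tau>"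
    and ?ub = "ultimate_bound A B K P D (lam CARD('n)) x \<mu> \<Delta>e h \<tau> \<theta>"
  define r where "r = (\<lambda>(\<alpha>, \<beta>, \<gamma>, \<eta>). Delta_bar A B K P D (lam CARD('n)) x \<mu> \<Delta>e h \<tau> \<alpha> \<gamma> \<eta>
      / Gamma_fun A B P D (lam CARD('n)) \<mu> h \<tau> \<alpha> \<beta> \<gamma> \<eta>)"
  define b where "b = (largest_eigenvalue P)\<^sup>2 * ?\<Delta>\<^sup>2 / (4 * \<mu>\<^sup>2)"
  interpret sampled_network A B K P adj D lam ts del err x h \<tau> \<Delta>e \<mu> lam0
    by unfold_locales (fact assms)+
  have ub: "?ub = (INF p\<in>?F. \<theta> * r p)"
    unfolding ultimate_bound_def r_def by (intro INF_cong refl) (auto simp: split_beta)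
  have b0: "0 \<le> b" by (simp add: b_def)
  have b_le: "b \<le> r p" if "p \<in> ?F" for p
    using that feasible_Delta_bar_ge[OF P A mu] by (cases p) (auto simp: b_def r_def)
  have lower: "\<theta> * b \<le> ?ub"
    unfolding ub using feasible b_le \<theta> by (intro cINF_greatest mult_left_mono) auto
  have key: "\<exists>t\<ge>t'. t \<ge> start_time ts del \<and>
        held_disagreement A ts del x t \<bullet> held_disagreement A ts del x t \<le> \<rho>" if "p \<in> ?F" "r p < \<rho>" for p \<rho>
  proof -
    obtain \<alpha> \<beta> \<gamma> \<eta> where p: "p = (\<alpha>, \<beta>, \<gamma>, \<eta>)" by (cases p)
    have "0 < Gamma_fun A B P D (lam CARD('n)) \<mu> h \<tau> \<alpha> \<beta> \<gamma> \<eta>"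
      using that(1) by (simp add: p feasible_def)
    hence "Delta_bar A B K P D (lam CARD('n)) x \<mu> \<Delta>e h \<tau> \<alpha> \<gamma> \<eta>
        < \<rho> * Gamma_fun A B P D (lam CARD('n)) \<mu> h \<tau> \<alpha> \<beta> \<gamma> \<eta>"
      using that(2) by (simp add: p r_def divide_less_eq)
    from held_sq_below[OF that(1)[unfolded p] this] show ?thesis
      unfolding held_disagreement_inner by blast
  qed
  show "(?\<Delta> \<noteq> 0 \<longrightarrow> (\<exists>t\<ge>t'. t \<ge> start_time ts del \<and>
        held_disagreement A ts del x t \<bullet> held_disagreement A ts del x t \<le> ?ub)) \<and>
    (?\<Delta> = 0 \<longrightarrow> (\<forall>\<epsilon>>0. \<exists>t\<ge>t'. t \<ge> start_time ts del \<and>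
        held_disagreement A ts del x t \<bullet> held_disagreement A ts del x t \<le> ?ub + \<epsilon>))"
  proof (intro conjI impI allI)
    assume nz: "?\<Delta> \<noteq> 0"
    have "0 < b" using nz mu largest_eigenvalue_pos[OF P] by (simp add: b_def)
    hence "0 < ?ub" using lower \<theta> by (smt (verit) mult_pos_pos)
    \<comment> \<open>This is where \<open>\<theta> > 1\<close> is spent: as the infimum is
      positive, some feasible \<open>p\<close> has \<open>r p\<close> strictly below the bound, and
      the level \<open>?ub\<close> itself is admissible in \<open>key\<close>.\<close>
    hence "?ub < \<theta> * ?ub" using \<theta> by simp
    then obtain p where p: "p \<in> ?F" "\<theta> * r p < \<theta> * ?ub"
      using cInf_lessD[of "(\<lambda>p. \<theta> * r p) ` ?F" "\<theta> * ?ub"] feasible unfolding ub by auto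
    thus "\<exists>t\<ge>t'. t \<ge> start_time ts del \<and>
        held_disagreement A ts del x t \<bullet> held_disagreement A ts del x t \<le> ?ub"
      using \<theta> by (intro key[OF p(1)]) simp
  next
    fix \<epsilon> :: real assume z: "?\<Delta> = 0" and e: "0 < \<epsilon>"
    obtain p where p: "p \<in> ?F" using feasible by blast
    \<comment> \<open>Both summands of \<open>Delta_bar\<close> carry the factor
      \<open>Delta\<close> squared, so the strict gap required by \<open>key\<close> comes from
      \<open>\<epsilon>\<close> alone.\<close>
    have "r p = 0" by (simp add: r_def Delta_bar_def z split_beta)
    moreover have "0 \<le> ?ub" using lower b0 \<theta> by (smt (verit) mult_nonneg_nonneg)
    ultimately show "\<exists>t\<ge>t'. t \<ge> start_time ts del \<and>
        held_disagreement A ts del x t \<bullet> held_disagreement A ts del x t \<le> ?ub + \<epsilon>"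
      using e by (intro key[OF p]) simp
  qed
qed

end
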